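(* Let $M\ge 0$ and $h\ge 0$ be an integer, and let $(A_N)_{N\ge1}$, $(B_N)_{N\ge1}$ be $(M,h)$-regular sequences of normal matrices with limit moments $\Phi=(\phi_k)_{k\ge1}$ and $\Psi=(\psi_k)_{k\ge1}$ respectively. Then for every fixed $d\ge 1$, \[ \mathbf{F}_N^{(d)}(0;A_N,B_N)=\sum_{g=0}^{h}\frac{C_{g,d}(\Phi,\Psi)}{N^{2g}}+o\!\left(\frac{1}{N^{2h}}\right)\quad\text{as }N\to\infty, \] where $C_{g,d}(\Phi,\Psi)=\sum_{\alpha,\beta\vdash d}(-1)^{d+\ell(\alpha)+\ell(\beta)}\vec{H}_g(\alpha,\beta)\,\phi_\alpha\psi_\beta$.
   Context: A sequence $(A_N)_{N\ge1}$ of normal matrices, $A_N$ of size $N\times N$, is $(M,h)$-regular with limit moments $\Phi=(\phi_k)_{k\ge1}\subset\mathbb{C}$ if (i) $\|A_N\|\le M$ (operator norm) for all $N$, and (ii) for each $k\ge1$, $N^{-1}\operatorname{Tr}(A_N^k)=\phi_k+o(N^{-2h})$ as $N\to\infty$. $\kappa_N$ is normalized Haar measure on $\mathrm{U}(N)$; $\mathbf{I}_N(z;A,B)=\int_{\mathrm{U}(N)}e^{-zN\operatorname{Tr}(AUBU^{-1})}\kappa_N(\mathrm{d}U)$ is entire with $\mathbf{I}_N(0;A,B)=1$, and $\mathbf{F}_N(z;A,B)$ is the holomorphic function near $0$ with $\mathbf{F}_N(0;A,B)=0$ and $\mathbf{I}_N=e^{N^2\mathbf{F}_N}$; $\mathbf{F}_N^{(d)}(0;\cdot,\cdot)$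 is its $d$-th derivative at $0$. For partitions, $\ell(\alpha)$ is the number of parts and $\phi_\alpha=\prod_{i}\phi_{\alpha_i}$, $\psi_\beta=\prod_j\psi_{\beta_j}$. For $g\ge0$ and $\alpha,\beta\vdash d$, $\vec{H}_g(\alpha,\beta)$ is the number of tuples $(\rho,\sigma,\tau_1,\dots,\tau_r)$ in $S(d)$ with $r=2g-2+\ell(\alpha)+\ell(\beta)$ such that $\rho$ has cycle type $\alpha$, $\sigma$ has cycle type $\beta$, each $\tau_i$ is a transposition, $\rho\sigma\tau_1\cdots\tau_r=\mathrm{id}$, $\langle\rho,\sigma,\tau_1,\dots,\tau_r\rangle$ is transitive on $\{1,\dots,d\}$, and writing $\tau_i=(s_i\ t_i)$ with $s_i<t_i$ one has $t_1\le\dots\le t_r$ (zero if $r<0$). *)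

theory Defs
  imports
    "HOL-Probability.Probability"
    "HOL-Library.Landau_Symbols"
    "HOL-Library.Multiset"
    "HOL-Combinatorics.Orbits"
    "HOL-Algebra.Sym_Groups"
    "Jordan_Normal_Form.Schur_Decomposition"
begin

section \<open>Matrices of varying size\<close>

definition mat_trace :: "complex mat \<Rightarrow> complex" where
  "mat_trace A = (\<Sum>i<dim_row A. A $$ (i, i))"

definition vec_l2norm :: "complex Matrix.vec \<Rightarrow> real" where
  "vec_l2norm v = sqrt (\<Sum>i<dim_vec v. (cmod (vec_index v i))\<^sup>2)"

definition mat_opnorm :: "complex mat \<Rightarrow> real" where
  "mat_opnorm A =
     (SUP v \<in> {v \<in> carrier_vec (dim_col A). vec_l2norm v \<le> 1}. vec_l2norm (A *\<^sub>v v))"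

definition normal_mat :: "complex mat \<Rightarrow> bool" where
  "normal_mat A \<longleftrightarrow> A * mat_adjoint A = mat_adjoint A * A"

definition regular_seq :: "real \<Rightarrow> nat \<Rightarrow> (nat \<Rightarrow> complex mat) \<Rightarrow> (nat \<Rightarrow> complex) \<Rightarrow> bool" where
  "regular_seq M h A \<phi> \<longleftrightarrow>
     (\<forall>N\<ge>1. A N \<in> carrier_mat N N \<and> normal_mat (A N) \<and> mat_opnorm (A N) \<le> M) \<and>
     (\<forall>k\<ge>1. (\<lambda>N. mat_trace (A N ^\<^sub>m k) / of_nat N - \<phi> k) \<in> o(\<lambda>N. 1 / of_nat N ^ (2 * h)))"


section \<open>Haar measure on the unitary group\<close>

definition unitary_mats :: "nat \<Rightarrow> complex mat set" where
  "unitary_mats N =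
     {U \<in> carrier_mat N N. U * mat_adjoint U = 1\<^sub>m N \<and> mat_adjoint U * U = 1\<^sub>m N}"

text \<open>The type of matrices carries no topology. The Borel sets of the unitary group are
  obtained from the embedding that sends a matrix to its family of entries (extended by
  zero outside the index range), where the target carries the product topology.\<close>

definition unitary_borel :: "nat \<Rightarrow> complex mat measure" where
  "unitary_borel N = vimage_algebra (unitary_mats N)
     (\<lambda>U (i, j). if i < N \<and> j < N then U $$ (i, j) else 0)
     (borel :: (nat \<times> nat \<Rightarrow> complex) measure)"

text \<open>Normalized (left) Haar measure is unique, so the measure is a parameter below,
  constrained by this predicate.\<close>

definition normalized_haar :: "nat \<Rightarrow> complex mat measure \<Rightarrow> bool" where
  "normalized_haar N \<kappa> \<longleftrightarrow>
     sets \<kappa> = sets (unitary_borel N) \<and> prob_space \<kappa> \<and>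
     (\<forall>V\<in>unitary_mats N. \<forall>S\<in>sets \<kappa>. emeasure \<kappa> ((\<lambda>U. V * U) ` S) = emeasure \<kappa> S)"


section \<open>The integral and its logarithm\<close>

text \<open>The inverse of a unitary matrix is written as its adjoint.\<close>

definition I_int :: "complex mat measure \<Rightarrow> nat \<Rightarrow> complex mat \<Rightarrow> complex mat \<Rightarrow> complex \<Rightarrow> complex" where
  "I_int \<kappa> N A B z =
     (LINT U|\<kappa>. exp (- z * of_nat N * mat_trace (A * U * B * mat_adjoint U)))"

text \<open>Only the germ at the origin is determined; derivatives at the origin do not depend
  on the chosen representative.\<close>

definition F_log :: "complex mat measure \<Rightarrow> nat \<Rightarrow> complex mat \<Rightarrow> complex mat \<Rightarrow> complex \<Rightarrow> complex" where
  "F_log \<kappa> N A B =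
     (SOME F. F 0 = 0 \<and> (\<exists>r>0. F holomorphic_on ball 0 r \<and>
        (\<forall>z\<in>ball 0 r. I_int \<kappa> N A B z = exp (of_nat N ^ 2 * F z))))"


section \<open>Monotone double Hurwitz numbers\<close>

text \<open>A partition is the multiset of its parts, so that the number of parts is its size.\<close>

definition partitions :: "nat \<Rightarrow> nat multiset set" where
  "partitions d = {\<alpha>. sum_mset \<alpha> = d \<and> 0 \<notin># \<alpha>}"

definition part_prod :: "(nat \<Rightarrow> complex) \<Rightarrow> nat multiset \<Rightarrow> complex" where
  "part_prod \<phi> \<alpha> = (\<Prod>i\<in>#\<alpha>. \<phi> i)"

definition cycle_type_of :: "nat \<Rightarrow> (nat \<Rightarrow> nat) \<Rightarrow> nat multiset" where
  "cycle_type_of d p = image_mset card (mset_set (Orbits.orbit p ` {1..d}))"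

definition monotone_transpositions :: "nat \<Rightarrow> (nat \<Rightarrow> nat) list \<Rightarrow> bool" where
  "monotone_transpositions d \<tau>s \<longleftrightarrow>
     (\<exists>ss ts. length ss = length \<tau>s \<and> length ts = length \<tau>s \<and>
        set ss \<subseteq> {1..d} \<and> set ts \<subseteq> {1..d} \<and>
        (\<forall>i<length \<tau>s. ss ! i < ts ! i \<and> \<tau>s ! i = Transposition.transpose (ss ! i) (ts ! i)) \<and>
        sorted ts)"

text \<open>The number of transpositions is compared in the integers, so that no tuple
  qualifies if the prescribed number is negative. Products of permutations are
  compositions of functions; replacing rho and sigma by their inverses shows that
  the opposite convention gives the same number.\<close>

definition monotone_hurwitz :: "nat \<Rightarrow> nat multiset \<Rightarrow> nat multiset \<Rightarrow> nat" where
  "monotone_hurwitz g \<alpha> \<beta> = (let d = sum_mset \<alpha> in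
     card {(\<rho>, \<sigma>, \<tau>s).
       \<rho> \<in> carrier (sym_group d) \<and> \<sigma> \<in> carrier (sym_group d) \<and>
       cycle_type_of d \<rho> = \<alpha> \<and> cycle_type_of d \<sigma> = \<beta> \<and>
       int (length \<tau>s) = 2 * int g - 2 + int (size \<alpha>) + int (size \<beta>) \<and>
       monotone_transpositions d \<tau>s \<and>
       \<rho> \<circ> \<sigma> \<circ> foldr (\<circ>) \<tau>s id = id \<and>
       (\<forall>x\<in>{1..d}. \<forall>y\<in>{1..d}.
          \<exists>p\<in>generate (sym_group d) ({\<rho>, \<sigma>} \<union> set \<tau>s). p x = y)})"

definition C_coeff :: "nat \<Rightarrow> nat \<Rightarrow> (nat \<Rightarrow> complex) \<Rightarrow> (nat \<Rightarrow> complex) \<Rightarrow> complex" where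
  "C_coeff g d \<phi> \<psi> = (\<Sum>\<alpha>\<in>partitions d. \<Sum>\<beta>\<in>partitions d.
     (-1) ^ (d + size \<alpha> + size \<beta>) * of_nat (monotone_hurwitz g \<alpha> \<beta>)
       * part_prod \<phi> \<alpha> * part_prod \<psi> \<beta>)"

end

(* Let T be the expectation of the tensor product of the matrices U B_k U^* over a finite set
   of sites k. Left invariance of Haar measure makes T commute with tensor powers of unitary
   matrices; differentiating along phase rotations and polarizing turns this into loop
   equations (N + J_m) T = ..., where J_m is the m-th Jucys-Murphy element and the right-hand
   side has one active site less. For large N the operator N + J_m is invertible by a maximum
   argument, and iterating the Neumann series over the sites in increasing order writes the
   moments of tr(A U B U^* ) as a power series in -1/N whose r-th coefficient sums the traces
   of pairs (sigma, sigma tau_1 ... tau_r) over monotone sequences of transpositions. A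
   monotone sequence is determined by its restrictions to the orbits of the generated group,
   since the larger elements t_i belonging to different orbits are distinct. Hence an
   exponential formula holds, and the derivatives of the logarithm are the same series
   restricted to transitive tuples. Multiplying by a transposition splits or joins a cycle, so
   a transitive tuple satisfies r + 2 = l(alpha) + l(beta) + 2 g with g >= 0. The contribution
   of a tuple therefore has order N^(-2g), and cutting off the series at a fixed length leaves
   finitely many terms, each of which converges by regularity. *)

theory Submission
  imports Defs "HOL-Complex_Analysis.Cauchy_Integral_Formula"
begin

section \<open>Contractions of matrices along a permutation and their evaluation on cycles\<close>

section \<open>Traces along permutations\<close>

text \<open>The loop equations have a closed solution because the operators \<open>J_m\<close>
  multiply the permutation argument from the left, whereas the source terms, in which two sites are
  merged, multiply it from the right. The two actions commute, so the sources accumulate into one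
  sum over all permutations, independently of the Neumann series. The largest active site is always
  eliminated first; this is what makes the transpositions come out monotone.

  The variable -1/N is not formal, since the traces depend on N as well. The exponential formula is
  therefore a finite identity for each number of transpositions and passes to the series by absolute
  convergence, which a crude count of lists guarantees once N > d^2. Since d is fixed, only
  derivatives at the origin enter, each N may have its own disc of holomorphy, and the derivatives
  are reached through the recursion contained in f' = c F' f.

  The genus is controlled by counting invariant sets instead of components: c components have 2^c
  invariant unions, and a further transposition halves this number or keeps it.\<close>

abbreviation swp :: "nat \<Rightarrow> nat \<Rightarrow> nat \<Rightarrow> nat" where
  "swp \<equiv> Transposition.transpose"

text \<open>Total functions, of which only the entries with indices below \<open>N\<close> matter.
  Identities such as associativity then hold without side conditions on dimensions.\<close>

type_synonym cmat = "nat \<Rightarrow> nat \<Rightarrow> complex"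

definition cmat_mult :: "nat \<Rightarrow> cmat \<Rightarrow> cmat \<Rightarrow> cmat" where
  "cmat_mult N X Y = (\<lambda>i j. \<Sum>a<N. X i a * Y a j)"

definition cmat_id :: cmat where
  "cmat_id = (\<lambda>i j. if i = j then 1 else 0)"

definition cmat_trace :: "nat \<Rightarrow> cmat \<Rightarrow> complex" where
  "cmat_trace N X = (\<Sum>a<N. X a a)"

text \<open>A product of \<open>n + 1\<close> factors. Starting at \<open>C 0\<close> avoids an
  empty product: \<open>cmat_id\<close> fails to be neutral for \<open>cmat_mult\<close> at indices
  outside \<open>{..<N}\<close>.\<close>

primrec cmat_prod :: "nat \<Rightarrow> (nat \<Rightarrow> cmat) \<Rightarrow> nat \<Rightarrow> cmat" where
  "cmat_prod N C 0 = C 0"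
| "cmat_prod N C (Suc n) = cmat_mult N (cmat_prod N C n) (C (Suc n))"

abbreviation idx :: "nat \<Rightarrow> nat set \<Rightarrow> (nat \<Rightarrow> nat) set" where
  "idx N S \<equiv> PiE S (\<lambda>_. {..<N})"

text \<open>For a permutation \<open>p\<close> this is the product over its cycles of the traces of
  the matrix products along the cycles. The matrix may vary with the site because the loop equations
  multiply matrices of different sites together.\<close>

definition ptrace :: "nat \<Rightarrow> nat set \<Rightarrow> (nat \<Rightarrow> cmat) \<Rightarrow> (nat \<Rightarrow> nat) \<Rightarrow> complex" where
  "ptrace N S C p = (\<Sum>i\<in>idx N S. \<Prod>k\<in>S. C k (i k) (i (p k)))"

lemma finite_idx [simp]: "finite S \<Longrightarrow> finite (idx N S)"
  by (intro finite_PiE) auto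

lemma cmat_mult_assoc: "cmat_mult N (cmat_mult N X Y) Z = cmat_mult N X (cmat_mult N Y Z)"
proof (intro ext)
  fix i j
  have "cmat_mult N (cmat_mult N X Y) Z i j = (\<Sum>a<N. \<Sum>b<N. X i b * Y b a * Z a j)"
    by (simp add: cmat_mult_def sum_distrib_right)
  also have "\<dots> = (\<Sum>b<N. \<Sum>a<N. X i b * Y b a * Z a j)" by (rule sum.swap)
  also have "\<dots> = cmat_mult N X (cmat_mult N Y Z) i j"
    by (simp add: cmat_mult_def sum_distrib_left mult.assoc)
  finally show "cmat_mult N (cmat_mult N X Y) Z i j = cmat_mult N X (cmat_mult N Y Z) i j" .
qed

lemma ptrace_cong:
  assumes "\<And>k. k \<in> S \<Longrightarrow> C k = D k" "\<And>k. k \<in> S \<Longrightarrow> p k = q k"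
  shows "ptrace N S C p = ptrace N S D q"
  unfolding ptrace_def using assms by (intro sum.cong prod.cong) auto

lemma ptrace_empty [simp]: "ptrace N {} C p = 1"
  by (simp add: ptrace_def)

lemma sum_idx_insert:
  assumes "m \<notin> R"
  shows "(\<Sum>i\<in>idx N (insert m R). f i) = (\<Sum>i\<in>idx N R. \<Sum>a<N. f (i(m := a)))"
proof -
  have "(\<Sum>i\<in>idx N (insert m R). f i) = (\<Sum>(a,i)\<in>{..<N} \<times> idx N R. f (i(m := a)))"
    unfolding PiE_insert_eq
    by (subst sum.reindex[OF inj_combinator[OF assms]]) (auto intro!: sum.cong)
  also have "\<dots> = (\<Sum>i\<in>idx N R. \<Sum>a<N. f (i(m := a)))"
    by (subst sum.cartesian_product[symmetric]) (rule sum.swap)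
  finally show ?thesis .
qed

text \<open>An index family on the union is a pair of index families, and invariance of both blocks
  keeps every factor within one block.\<close>

lemma ptrace_Un:
  assumes "finite S" "finite T" "S \<inter> T = {}" "p ` S \<subseteq> S" "p ` T \<subseteq> T"
  shows "ptrace N (S \<union> T) C p = ptrace N S C p * ptrace N T C p"
proof -
  have "ptrace N S C p * ptrace N T C p = (\<Sum>(i,j)\<in>idx N S \<times> idx N T.
     (\<Prod>k\<in>S. C k (i k) (i (p k))) * (\<Prod>k\<in>T. C k (j k) (j (p k))))"
    unfolding ptrace_def by (simp add: sum_product sum.cartesian_product)
  also have "\<dots> = ptrace N (S \<union> T) C p"
    unfolding ptrace_def
  proof (rule sum.reindex_bij_witness[where i = "\<lambda>i. (restrict i S, restrict i T)"
        and j = "\<lambda>(i,j) k. if k \<in> S then i k else j k"], goal_cases)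
    case (1 a)
    then show ?case using assms(3)
      by (auto simp: fun_eq_iff PiE_def extensional_def restrict_def)
  next
    case (2 a)
    then show ?case using assms(3) by (auto simp: PiE_def Pi_def extensional_def)
  next
    case (3 b)
    then show ?case by (auto simp: fun_eq_iff PiE_def extensional_def restrict_def)
  next
    case (4 b)
    then show ?case by auto
  next
    case (5 a)
    obtain i j where a: "a = (i,j)" by (cases a)
    have "p k \<in> S" if "k \<in> S" for k using that assms(4) by auto
    moreover have "p k \<notin> S" "k \<notin> S" if "k \<in> T" for k using that assms(3,5) by auto
    ultimately show ?case using assms(1-3)
      by (simp add: a prod.union_disjoint)
  qed
  finally show ?thesis by simp
qed

lemma ptrace_Union:
  assumes "finite F" "\<And>X. X \<in> F \<Longrightarrow> finite X" "disjoint F" "\<And>X. X \<in> F \<Longrightarrow> p ` X \<subseteq> X"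
  shows "ptrace N (\<Union>F) C p = (\<Prod>X\<in>F. ptrace N X C p)"
  using assms
proof (induction F rule: finite_induct)
  case (insert X F)
  have "X \<inter> \<Union>F = {}" using insert.hyps insert.prems(2) by (auto simp: disjoint_def)
  moreover have "p ` \<Union>F \<subseteq> \<Union>F" using insert.prems by blast
  moreover have "disjoint F" using insert.prems(2) by (auto simp: disjoint_def)
  ultimately show ?case using insert by (simp add: ptrace_Un)
qed auto

lemma ptrace_reindex:
  assumes e: "bij_betw e S' S" and p': "p' ` S' \<subseteq> S'" and ep: "\<And>k. k \<in> S' \<Longrightarrow> e (p' k) = p (e k)"
  shows "ptrace N S C p = ptrace N S' (\<lambda>k. C (e k)) p'"
proof -
  have eS: "e k \<in> S" if "k \<in> S'" for k using e that by (auto simp: bij_betw_def)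
  have inv1: "inv_into S' e (e k) = k" if "k \<in> S'" for k
    using e that by (auto simp: bij_betw_def)
  have inv2: "e (inv_into S' e k) = k" "inv_into S' e k \<in> S'" if "k \<in> S" for k
    using e that by (auto simp: bij_betw_def f_inv_into_f inv_into_into)
  show ?thesis unfolding ptrace_def
  proof (rule sum.reindex_bij_witness[where j = "\<lambda>i. restrict (i \<circ> e) S'"
        and i = "\<lambda>j. restrict (j \<circ> inv_into S' e) S"], goal_cases)
    case (1 a)
    then show ?case by (auto simp: fun_eq_iff PiE_def extensional_def restrict_def inv2)
  next
    case (3 b)
    then show ?case by (auto simp: fun_eq_iff PiE_def extensional_def restrict_def inv1 eS)
  next
    case (5 i)
    have "(\<Prod>k\<in>S. C k (i k) (i (p k))) = (\<Prod>k\<in>S'. C (e k) (i (e k)) (i (p (e k))))"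
      using prod.reindex_bij_betw[OF e, of "\<lambda>k. C k (i k) (i (p k))"] by simp
    also have "\<dots> = (\<Prod>k\<in>S'. C (e k) (restrict (i \<circ> e) S' k) (restrict (i \<circ> e) S' (p' k)))"
      using p' by (intro prod.cong) (auto simp: ep)
    finally show ?case by simp
  qed (use eS inv2 in auto)
qed

lemma ptrace_insert_fixed:
  assumes "finite R" "m \<notin> R" "s m = m" "s ` R \<subseteq> R"
  shows "ptrace N (insert m R) B s = cmat_trace N (B m) * ptrace N R B s"
proof -
  have "ptrace N (insert m R) B s = ptrace N {m} B s * ptrace N R B s"
    using ptrace_Un[of "{m}" R s N B] assms by simp
  moreover have "ptrace N {m} B s = cmat_trace N (B m)"
    unfolding ptrace_def by (subst sum_idx_insert) (auto simp: assms cmat_trace_def)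
  ultimately show ?thesis by simp
qed

text \<open>Composing with the transposition inserts the fixed point \<open>m\<close> directly after
  \<open>k\<close> in its cycle. The sum over the index at \<open>m\<close> is then the matrix
  product of \<open>B k\<close> and \<open>B m\<close>.\<close>

lemma ptrace_insert_merge:
  assumes "finite R" "m \<notin> R" "s m = m" "s ` R \<subseteq> R" "k \<in> R"
  shows "ptrace N (insert m R) B (s \<circ> swp k m) = ptrace N R (B(k := cmat_mult N (B k) (B m))) s"
proof -
  have "ptrace N (insert m R) B (s \<circ> swp k m) =
     (\<Sum>i\<in>idx N R. \<Sum>a<N. \<Prod>l\<in>insert m R. B l ((i(m:=a)) l) ((i(m:=a)) (s (swp k m l))))"
    unfolding ptrace_def by (subst sum_idx_insert) (use assms in auto)
  also have "\<dots> = (\<Sum>i\<in>idx N R. \<Sum>a<N. B k (i k) a * B m a (i (s k)) *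
      (\<Prod>l\<in>R-{k}. B l (i l) (i (s l))))"
  proof (intro sum.cong refl)
    fix i a
    have mk: "m \<noteq> k" "k \<noteq> m" "s k \<noteq> m" and sl: "\<And>l. l \<in> R \<Longrightarrow> s l \<noteq> m" "\<And>l. l \<in> R \<Longrightarrow> l \<noteq> m"
      using assms by auto
    have R: "R = insert k (R - {k})" using assms by auto
    have "(\<Prod>l\<in>insert m R. B l ((i(m:=a)) l) ((i(m:=a)) (s (swp k m l))))
      = B m a (i (s k)) * (\<Prod>l\<in>R. B l ((i(m:=a)) l) ((i(m:=a)) (s (swp k m l))))"
      using assms mk by (subst prod.insert) auto
    also have "(\<Prod>l\<in>R. B l ((i(m:=a)) l) ((i(m:=a)) (s (swp k m l))))
      = B k (i k) a * (\<Prod>l\<in>R-{k}. B l ((i(m:=a)) l) ((i(m:=a)) (s (swp k m l))))"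
      using assms mk by (subst prod.remove[of R k]) auto
    also have "(\<Prod>l\<in>R-{k}. B l ((i(m:=a)) l) ((i(m:=a)) (s (swp k m l))))
      = (\<Prod>l\<in>R-{k}. B l (i l) (i (s l)))"
    proof (intro prod.cong refl)
      fix l assume l: "l \<in> R - {k}"
      then have "l \<noteq> k" "l \<noteq> m" "s l \<noteq> m" using sl by auto
      then show "B l ((i(m:=a)) l) ((i(m:=a)) (s (swp k m l))) = B l (i l) (i (s l))"
        by simp
    qed
    finally show "(\<Prod>l\<in>insert m R. B l ((i(m:=a)) l) ((i(m:=a)) (s (swp k m l))))
      = B k (i k) a * B m a (i (s k)) * (\<Prod>l\<in>R-{k}. B l (i l) (i (s l)))" by simp
  qed
  also have "\<dots> = (\<Sum>i\<in>idx N R. cmat_mult N (B k) (B m) (i k) (i (s k))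
      * (\<Prod>l\<in>R-{k}. B l (i l) (i (s l))))"
    by (simp add: cmat_mult_def sum_distrib_right)
  also have "\<dots> = ptrace N R (B(k := cmat_mult N (B k) (B m))) s"
    unfolding ptrace_def using assms by (intro sum.cong refl) (subst prod.remove[of R k], auto)
  finally show ?thesis .
qed

definition rot :: "nat \<Rightarrow> nat \<Rightarrow> nat" where
  "rot n k = (if k < n then Suc k else if k = n then 0 else k)"

text \<open>The standard cycle on \<open>n + 1\<close> sites is contracted by merging its last site
  into the one before it.\<close>

lemma ptrace_rot: "ptrace N {..n} C (rot n) = cmat_trace N (cmat_prod N C n)"
proof (induction n arbitrary: C)
  case 0
  have "{..0::nat} = insert 0 {}" by auto
  then show ?case
    using ptrace_insert_fixed[of "{}" 0 "rot 0" N C]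
        by (simp add: rot_def del: One_nat_def) (simp add: rot_def[abs_def])
next
  case (Suc n)
  have rs: "rot (Suc n) = rot n \<circ> swp n (Suc n)"
    by (auto simp: rot_def fun_eq_iff Transposition.transpose_def)
  have "ptrace N {..Suc n} C (rot (Suc n)) = ptrace N (insert (Suc n) {..n}) C (rot n \<circ> swp n (Suc n))"
    by (simp add: rs atMost_Suc)
  also have "\<dots> = ptrace N {..n} (C(n := cmat_mult N (C n) (C (Suc n)))) (rot n)"
    by (rule ptrace_insert_merge) (auto simp: rot_def)
  also have "\<dots> = cmat_trace N (cmat_prod N (C(n := cmat_mult N (C n) (C (Suc n)))) n)" by (rule Suc.IH)
  also have "cmat_prod N (C(n := cmat_mult N (C n) (C (Suc n)))) n = cmat_prod N C (Suc n)"
  proof -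
    have eq: "cmat_prod N (C(k := X)) j = cmat_prod N C j" if "j < k" for j k X
      using that by (induction j) auto
    show ?thesis by (cases n) (simp_all add: eq cmat_mult_assoc)
  qed
  finally show ?case .
qed

lemma disjoint_orbits:
  assumes "p permutes S" "finite S"
  shows "disjoint (orbit p ` S)"
proof (rule disjointI)
  fix X Y assume "X \<in> orbit p ` S" "Y \<in> orbit p ` S" "X \<noteq> Y"
  moreover have "orbit p z = orbit p x" if "z \<in> orbit p x" for x z
    using orbit_cyclic_eq3[OF cyclic_on_orbit[OF assms] that] .
  then have "orbit p x = orbit p y" if "z \<in> orbit p x" "z \<in> orbit p y" for x y z
    using that by metis
  ultimately show "X \<inter> Y = {}" by auto
qed

lemma Union_orbits:
  assumes "p permutes S" "finite S"
  shows "\<Union> (orbit p ` S) = S"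
proof -
  have "x \<in> orbit p x" for x
    using assms by (intro permutation_self_in_orbit) (auto simp: permutation_permutes)
  then show ?thesis using permutes_orbit_subset[OF assms(1)] by auto
qed

text \<open>The powers of \<open>p\<close> applied to \<open>x\<close> conjugate \<open>p\<close> on
  this orbit to the standard cycle \<open>rot n\<close>.\<close>

lemma ptrace_orbit:
  assumes "p permutes S" "finite S"
  shows "ptrace N (orbit p x) (\<lambda>_. X) p = cmat_trace N (cmat_prod N (\<lambda>_. X) (card (orbit p x) - 1))"
proof -
  have x: "x \<in> orbit p x"
    using assms by (intro permutation_self_in_orbit) (auto simp: permutation_permutes)
  \<comment> \<open>With this choice \<open>Suc n\<close> is the length of the cycle, so
    \<open>{..n}\<close> enumerates its elements.\<close>
  define n where "n = funpow_dist p (p x) x"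
  have fd: "funpow_dist1 p x x = Suc n" by (simp add: n_def)
  have orb: "orbit p x = (\<lambda>k. (p ^^ k) x) ` {..n}"
    using orbit_conv_funpow_dist1[OF x] unfolding fd
    by (simp add: atLeast0LessThan lessThan_Suc_atMost)
  have inj: "inj_on (\<lambda>k. (p ^^ k) x) {..n}"
    using inj_on_funpow_dist1[OF x] unfolding fd
    by (simp add: atLeast0LessThan lessThan_Suc_atMost)
  have per: "(p ^^ Suc n) x = x" using funpow_dist1_prop[OF x] unfolding fd .
  have "card (orbit p x) = Suc n" unfolding orb by (subst card_image[OF inj]) simp
  moreover have "ptrace N (orbit p x) (\<lambda>_. X) p = ptrace N {..n} (\<lambda>_. X) (rot n)"
  proof (rule ptrace_reindex[where e = "\<lambda>k. (p ^^ k) x" and C = "\<lambda>_. X"])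
    show "bij_betw (\<lambda>k. (p ^^ k) x) {..n} (orbit p x)" using inj orb by (auto simp: bij_betw_def)
    show "rot n ` {..n} \<subseteq> {..n}" by (auto simp: rot_def)
    show "(p ^^ rot n k) x = p ((p ^^ k) x)" if "k \<in> {..n}" for k
      using that per by (auto simp: rot_def)
  qed
  ultimately show ?thesis by (simp add: ptrace_rot)
qed

lemma ptrace_orbits:
  assumes "p permutes S" "finite S"
  shows "ptrace N S (\<lambda>_. X) p = (\<Prod>Z\<in>orbit p ` S. cmat_trace N (cmat_prod N (\<lambda>_. X) (card Z - 1)))"
proof -
  have "ptrace N (\<Union>(orbit p ` S)) (\<lambda>_. X) p = (\<Prod>Z\<in>orbit p ` S. ptrace N Z (\<lambda>_. X) p)"
  proof (rule ptrace_Union)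
    show "finite (orbit p ` S)" using assms by simp
    show "finite Z" if "Z \<in> orbit p ` S" for Z
      using that cyclic_on_orbit[OF assms] by (auto intro: finite_cyclic_on)
    show "disjoint (orbit p ` S)" by (rule disjoint_orbits[OF assms])
    show "p ` Z \<subseteq> Z" if "Z \<in> orbit p ` S" for Z
      using that cyclic_on_inI[OF cyclic_on_orbit[OF assms]] by auto
  qed
  also have "\<Union>(orbit p ` S) = S" by (rule Union_orbits[OF assms])
  also have "(\<Prod>Z\<in>orbit p ` S. ptrace N Z (\<lambda>_. X) p)
      = (\<Prod>Z\<in>orbit p ` S. cmat_trace N (cmat_prod N (\<lambda>_. X) (card Z - 1)))"
    by (intro prod.cong refl) (auto simp: ptrace_orbit[OF assms])
  finally show ?thesis .
qed

text \<open>With the same matrix at every site only the cycle lengths matter, and a permutation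
  shares them with its inverse.\<close>

lemma ptrace_inv:
  assumes "p permutes S" "finite S"
  shows "ptrace N S (\<lambda>_. X) (inv' p) = ptrace N S (\<lambda>_. X) p"
proof -
  have "orbit (inv' p) = orbit p"
    using assms by (intro ext orbit_inv_eq) (auto simp: permutation_permutes)
  then show ?thesis using ptrace_orbits[OF permutes_inv[OF assms(1)] assms(2)] ptrace_orbits[OF assms]
      by simp
qed

lemma ptrace_conj:
  assumes "t permutes S" "p permutes S"
  shows "ptrace N S (\<lambda>_. X) (t \<circ> p \<circ> inv' t) = ptrace N S (\<lambda>_. X) p"
proof (rule ptrace_reindex[where C = "\<lambda>_. X"])
  show "bij_betw t S S" using assms(1) by (rule permutes_imp_bij)
  show "p ` S \<subseteq> S" using assms(2) by (simp add: permutes_image)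
  show "t (p k) = (t \<circ> p \<circ> inv' t) (t k)" for k
    using assms(1) by (simp add: permutes_inverses)
qed

section \<open>Complete homogeneous sums in Jucys-Murphy elements\<close>

section \<open>Monotone transposition lists and the loop equations\<close>

definition transp_prod :: "(nat \<times> nat) list \<Rightarrow> nat \<Rightarrow> nat" where
  "transp_prod l = foldr (\<lambda>(s,t) f. swp s t \<circ> f) l id"

lemma transp_prod_simps [simp]: "transp_prod [] = id" "transp_prod ((s,t) # l)
    = swp s t \<circ> transp_prod l"
  by (simp_all add: transp_prod_def)

lemma transp_prod_append [simp]: "transp_prod (l @ l') = transp_prod l \<circ> transp_prod l'"
  by (induction l) (auto simp: comp_assoc)

text \<open>Ordered pairs stand for the transpositions, so that the larger entry is at hand for
  sorting, filtering and merging.\<close>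

definition mono_lists :: "nat set \<Rightarrow> nat \<Rightarrow> (nat \<times> nat) list set" where
  "mono_lists S r = {l. length l = r \<and> set l \<subseteq> {(s,t). s \<in> S \<and> t \<in> S \<and> s < t} \<and> sorted (map snd l)}"

lemma mono_lists_0 [simp]: "mono_lists S 0 = {[]}"
  by (auto simp: mono_lists_def)

lemma mono_lists_empty_Suc [simp]: "mono_lists {} (Suc r) = {}"
  by (auto simp: mono_lists_def)

lemma mono_lists_subset: "mono_lists S r \<subseteq> {l. set l \<subseteq> S \<times> S \<and> length l = r}"
  by (auto simp: mono_lists_def)

lemma finite_mono_lists [simp]: "finite S \<Longrightarrow> finite (mono_lists S r)"
  by (rule finite_subset[OF mono_lists_subset]) (auto intro: finite_lists_length_eq)

text \<open>Monotonicity is discarded and all lists of pairs are counted. This crude bound is the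
  origin of the threshold \<open>N > card S ^ 2\<close>.\<close>

lemma card_mono_lists:
  assumes "finite S"
  shows "card (mono_lists S r) \<le> (card S ^ 2) ^ r"
proof -
  have "card (mono_lists S r) \<le> card {l. set l \<subseteq> S \<times> S \<and> length l = r}"
    using assms by (intro card_mono mono_lists_subset finite_lists_length_eq) auto
  also have "\<dots> = (card S ^ 2) ^ r"
    using assms by (simp add: card_lists_length_eq power2_eq_square)
  finally show ?thesis .
qed

lemma transp_prod_permutes:
  assumes "set l \<subseteq> S \<times> S"
  shows "transp_prod l permutes S"
  using assms
proof (induction l)
  case (Cons a l)
  obtain s t where "a = (s,t)" by (cases a)
  moreover from this Cons have "transp_prod l permutes S" "swp s t permutes S"
    by (auto intro: permutes_swap_id)
  ultimately show ?case by (simp only: transp_prod_simps permutes_compose)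
qed (auto simp: permutes_id)

lemma mono_lists_permutes: "l \<in> mono_lists R r \<Longrightarrow> R \<subseteq> S \<Longrightarrow> transp_prod l permutes S"
  by (rule transp_prod_permutes) (auto simp: mono_lists_def)

text \<open>Split by the last transposition: its larger entry is \<open>m\<close>, or sortedness
  keeps all larger entries below \<open>m\<close>. This is the recursion h_(r+1)(J_1,...,J_m) =
  h_(r+1)(J_1,...,J_(m-1)) + h_r(J_1,...,J_m) J_m of complete homogeneous polynomials.\<close>

lemma mono_lists_insert_max:
  assumes "\<And>k. k \<in> R \<Longrightarrow> k < m"
  shows "mono_lists (insert m R) (Suc r) =
    mono_lists R (Suc r) \<union> (\<lambda>(l,k). l @ [(k,m)]) ` (mono_lists (insert m R) r \<times> R)" (is "?A = ?B \<union> ?C")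
proof (intro Set.equalityI Un_least subsetI)
  fix l assume l: "l \<in> ?A"
  then obtain l' k t where l': "l = l' @ [(k,t)]"
    by (cases l rule: rev_cases) (auto simp: mono_lists_def)
  show "l \<in> ?B \<union> ?C"
  proof (cases "t = m")
    case True
    then have "k \<in> R" using l l' assms by (auto simp: mono_lists_def)
    moreover have "l' \<in> mono_lists (insert m R) r" using l l'
        by (auto simp: mono_lists_def sorted_append)
    ultimately show ?thesis using l' True by auto
  next
    case False
    then have t: "t \<in> R" "t < m" using l l' assms by (auto simp: mono_lists_def)
    have "snd x \<le> t" if "x \<in> set l" for x
      using that l l' by (auto simp: mono_lists_def sorted_append)
    then have le: "snd x < m" if "x \<in> set l" for x using that t(2) by fastforce
    have "set l \<subseteq> {(s,t). s \<in> R \<and> t \<in> R \<and> s < t}"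
    proof (clarify)
      fix a b assume ab: "(a,b) \<in> set l"
      then have "b < m" using le by force
      moreover have "a \<in> insert m R" "b \<in> insert m R" "a < b" using l ab by (auto simp: mono_lists_def)
      ultimately show "a \<in> R \<and> b \<in> R \<and> a < b" by auto
    qed
    then show ?thesis using l by (auto simp: mono_lists_def)
  qed
next
  fix l assume "l \<in> ?B" then show "l \<in> ?A" by (auto simp: mono_lists_def)
next
  fix l assume "l \<in> ?C"
  then obtain l' k where l: "l = l' @ [(k,m)]" "l' \<in> mono_lists (insert m R) r" "k \<in> R" by auto
  have "snd x \<le> m" if "x \<in> set l'" for x
  proof -
    have "snd x \<in> insert m R" using l(2) that by (auto simp: mono_lists_def)
    then show ?thesis using assms less_imp_le by auto
  qed
  then show "l \<in> ?A" using l assms by (auto simp: mono_lists_def sorted_append)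
qed

text \<open>The complete homogeneous polynomial of degree \<open>r\<close> in the Jucys-Murphy
  elements of \<open>R\<close>, acting on \<open>v\<close> through left multiplication of the
  argument.\<close>

definition mono_sum :: "nat set \<Rightarrow> ((nat \<Rightarrow> nat) \<Rightarrow> complex) \<Rightarrow> nat \<Rightarrow> (nat \<Rightarrow> nat) \<Rightarrow> complex" where
  "mono_sum R v r p = (\<Sum>l\<in>mono_lists R r. v (transp_prod l \<circ> p))"

lemma mono_sum_insert_max:
  assumes "finite R" "\<And>k. k \<in> R \<Longrightarrow> k < m"
  shows "mono_sum (insert m R) v (Suc r) p = mono_sum R v (Suc r) p
      + (\<Sum>k\<in>R. mono_sum (insert m R) v r (swp k m \<circ> p))"
proof -
  let ?C = "(\<lambda>(l,k). l @ [(k,m)]) ` (mono_lists (insert m R) r \<times> R)"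
  have m: "m \<notin> R" using assms(2) by auto
  have disj: "mono_lists R (Suc r) \<inter> ?C = {}" using m by (auto simp: mono_lists_def)
  have "mono_sum (insert m R) v (Suc r) p = mono_sum R v (Suc r) p + (\<Sum>l\<in>?C. v (transp_prod l \<circ> p))"
  proof -
    have "mono_lists (insert m R) (Suc r) = mono_lists R (Suc r) \<union> ?C"
      by (rule mono_lists_insert_max) (rule assms(2))
    then show ?thesis
      unfolding mono_sum_def using assms(1) by (simp add: sum.union_disjoint[OF _ _ disj])
  qed
  also have "(\<Sum>l\<in>?C. v (transp_prod l \<circ> p)) = (\<Sum>(l,k)\<in>mono_lists (insert m R) r \<times> R. v (transp_prod l \<circ>
      (swp k m \<circ> p)))"
    by (subst sum.reindex) (auto simp: inj_on_def comp_assoc intro!: sum.cong)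
  also have "\<dots> = (\<Sum>k\<in>R. mono_sum (insert m R) v r (swp k m \<circ> p))"
    unfolding mono_sum_def by (subst sum.cartesian_product[symmetric]) (rule sum.swap)
  finally show ?thesis .
qed

lemma mono_sum_bound:
  assumes "finite S" "R \<subseteq> S" "\<And>p. p permutes S \<Longrightarrow> norm (v p) \<le> K" "p permutes S" "K \<ge> 0"
  shows "norm (mono_sum R v r p) \<le> (real (card S ^ 2)) ^ r * K"
proof -
  have fR: "finite R" using assms finite_subset by blast
  have "norm (mono_sum R v r p) \<le> (\<Sum>l\<in>mono_lists R r. K)"
    unfolding mono_sum_def using assms
    by (intro sum_norm_le assms(3) permutes_compose[OF assms(4)]) (auto intro: mono_lists_permutes)
  also have "\<dots> = real (card (mono_lists R r)) * K" by simp
  also have "\<dots> \<le> real ((card S ^ 2) ^ r) * K"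
  proof (intro mult_right_mono)
    have "card (mono_lists R r) \<le> (card R ^ 2) ^ r" by (rule card_mono_lists[OF fR])
    also have "\<dots> \<le> (card S ^ 2) ^ r"
      by (intro power_mono card_mono assms) auto
    finally show "real (card (mono_lists R r)) \<le> real ((card S ^ 2) ^ r)" by (simp only: of_nat_le_iff)
  qed (rule assms)
  finally show ?thesis by simp
qed

lemma mono_sum_summable:
  assumes "finite S" "R \<subseteq> S" "p permutes S" and x: "norm x * real (card S ^ 2) < 1"
  shows "summable (\<lambda>r. norm (x ^ r * mono_sum R v r p))"
proof -
  define K where "K = (\<Sum>p | p permutes S. norm (v p))"
  have K: "norm (v p) \<le> K" if "p permutes S" for p
    unfolding K_def by (rule member_le_sum) (use that assms finite_permutations in auto)
  have K0: "K \<ge> 0" unfolding K_def by (intro sum_nonneg) auto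
  show ?thesis
  proof (rule summable_comparison_test')
    show "summable (\<lambda>r. K * (norm x * real (card S ^ 2)) ^ r)"
      by (intro summable_mult summable_geometric) (use x in \<open>simp add: abs_mult\<close>)
    fix r :: nat
    have "norm (mono_sum R v r p) \<le> (real (card S ^ 2)) ^ r * K"
      by (rule mono_sum_bound[OF assms(1,2) _ assms(3) K0]) (rule K)
    then have "norm x ^ r * norm (mono_sum R v r p) \<le> norm x ^ r * ((real (card S ^ 2)) ^ r * K)"
      by (intro mult_left_mono) auto
    then show "norm (norm (x ^ r * mono_sum R v r p)) \<le> K * (norm x * real (card S ^ 2)) ^ r"
      by (simp add: norm_mult norm_power power_mult_distrib mult_ac)
  qed
qed

text \<open>For \<open>x = - 1 / N\<close> this is, up to a power of \<open>N\<close>, the product over \<open>m \<in> R\<close> of the inverses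
  of \<open>N + J\<^sub>m\<close> applied to \<open>v\<close>, with the Neumann series multiplied out. Here \<open>J\<^sub>m\<close> composes with the
  transpositions of \<open>k\<close> and \<open>m\<close>, for \<open>k < m\<close>, on the left.\<close>

definition mono_series :: "complex \<Rightarrow> nat set \<Rightarrow> ((nat \<Rightarrow> nat) \<Rightarrow> complex) \<Rightarrow> (nat \<Rightarrow> nat) \<Rightarrow> complex" where
  "mono_series x R v p = (\<Sum>r. x ^ r * mono_sum R v r p)"

lemma mono_series_empty [simp]: "mono_series x {} v p = v p"
proof -
  have "(\<lambda>r. x ^ r * mono_sum {} v r p) = (\<lambda>r. if r = 0 then v p else 0)"
  proof
    fix r show "x ^ r * mono_sum {} v r p = (if r = 0 then v p else 0)"
      by (cases r) (auto simp: mono_sum_def)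
  qed
  then show ?thesis unfolding mono_series_def using sums_single[of 0 "\<lambda>_. v p"] by (simp add: sums_iff)
qed

text \<open>In operator form, 1 - x J_m removes the factor of the largest site. It is the recursion
  \<open>mono_sum_insert_max\<close> summed against powers of \<open>x\<close>.\<close>

lemma mono_series_insert_max:
  assumes S: "finite S" "insert m R \<subseteq> S" "p permutes S" and x: "norm x * real (card S ^ 2) < 1"
    and max: "\<And>k. k \<in> R \<Longrightarrow> k < m"
  shows "mono_series x (insert m R) v p = mono_series x R v p + x
      * (\<Sum>k\<in>R. mono_series x (insert m R) v (swp k m \<circ> p))"
proof -
  have RS: "R \<subseteq> S" using S by auto
  have fR: "finite R" by (rule finite_subset[OF RS S(1)])
  have perm: "swp k m \<circ> p permutes S" if "k \<in> R" for k
    by (intro permutes_compose S permutes_swap_id) (use that S in auto)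
  have sm: "summable (\<lambda>r. x ^ r * mono_sum Q v r q)" if "Q \<subseteq> S" "q permutes S" for Q q
    by (rule summable_norm_cancel[OF mono_sum_summable[OF S(1) that x]])
  have "mono_series x (insert m R) v p = mono_sum (insert m R) v 0 p + (\<Sum>r. x ^ Suc r
      * mono_sum (insert m R) v (Suc r) p)"
    using suminf_split_head[OF sm[OF S(2,3)]] by (simp add: mono_series_def)
  also have "(\<Sum>r. x ^ Suc r * mono_sum (insert m R) v (Suc r) p)
     = (\<Sum>r. x ^ Suc r * mono_sum R v (Suc r) p + x * (\<Sum>k\<in>R. x ^ r
         * mono_sum (insert m R) v r (swp k m \<circ> p)))"
  proof -
    have "mono_sum (insert m R) v (Suc r) p = mono_sum R v (Suc r) p
        + (\<Sum>k\<in>R. mono_sum (insert m R) v r (swp k m \<circ> p))" for r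
      by (rule mono_sum_insert_max[OF fR max])
    then show ?thesis by (simp only: distrib_left sum_distrib_left power_Suc mult.assoc)
  qed
  also have "\<dots> = (\<Sum>r. x ^ Suc r * mono_sum R v (Suc r) p) +
      (\<Sum>r. x * (\<Sum>k\<in>R. x ^ r * mono_sum (insert m R) v r (swp k m \<circ> p)))"
  proof (rule suminf_add[symmetric])
    show "summable (\<lambda>r. x ^ Suc r * mono_sum R v (Suc r) p)"
      using sm[OF RS S(3)] by (subst summable_Suc_iff)
    show "summable (\<lambda>r. x * (\<Sum>k\<in>R. x ^ r * mono_sum (insert m R) v r (swp k m \<circ> p)))"
      by (intro summable_mult summable_sum sm S perm)
  qed
  also have "(\<Sum>r. x * (\<Sum>k\<in>R. x ^ r * mono_sum (insert m R) v r (swp k m \<circ> p)))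
     = x * (\<Sum>k\<in>R. mono_series x (insert m R) v (swp k m \<circ> p))"
  proof -
    have "(\<Sum>r. (\<Sum>k\<in>R. x ^ r * mono_sum (insert m R) v r (swp k m \<circ> p)))
      = (\<Sum>k\<in>R. mono_series x (insert m R) v (swp k m \<circ> p))"
      unfolding mono_series_def by (rule suminf_sum) (intro sm S perm)
    moreover have "summable (\<lambda>r. (\<Sum>k\<in>R. x ^ r * mono_sum (insert m R) v r (swp k m \<circ> p)))"
      by (intro summable_sum sm S perm)
    ultimately show ?thesis by (simp add: suminf_mult)
  qed
  also have "mono_sum (insert m R) v 0 p + ((\<Sum>r. x ^ Suc r * mono_sum R v (Suc r) p) +
        x * (\<Sum>k\<in>R. mono_series x (insert m R) v (swp k m \<circ> p)))
     = (mono_sum R v 0 p + (\<Sum>r. x ^ Suc r * mono_sum R v (Suc r) p)) + x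
         * (\<Sum>k\<in>R. mono_series x (insert m R) v (swp k m \<circ> p))"
    by (simp add: mono_sum_def)
  also have "mono_sum R v 0 p + (\<Sum>r. x ^ Suc r * mono_sum R v (Suc r) p) = mono_series x R v p"
    using suminf_split_head[OF sm[OF RS S(3)]] by (simp add: mono_series_def)
  finally show ?thesis .
qed

text \<open>In a permutation of \<open>insert m R\<close> the point \<open>m\<close> is fixed or
  inserted into a cycle after some \<open>k\<close>. The transposition has to stand on the right to
  fit \<open>ptrace_insert_merge\<close>; passing to inverses moves it there.\<close>

lemma permutes_sum_insert_right:
  assumes "finite R" "m \<notin> R"
  shows "(\<Sum>s | s permutes insert m R. f s) = (\<Sum>k\<in>insert m R. \<Sum>q | q permutes R. f (q \<circ> swp k m))"
proof -
  have "(\<Sum>s | s permutes insert m R. f s) = (\<Sum>s | s permutes insert m R. f (inv' s))"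
    by (rule sum_permutations_inverse)
  also have "\<dots> = (\<Sum>k\<in>insert m R. \<Sum>q | q permutes R. f (inv' (swp m k \<circ> q)))"
    by (rule sum_over_permutations_insert[OF assms])
  also have "\<dots> = (\<Sum>k\<in>insert m R. \<Sum>q | q permutes R. f (inv' q \<circ> swp k m))"
  proof (intro sum.cong refl arg_cong[of _ _ f])
    fix k q assume "q \<in> {q. q permutes R}"
    then show "inv' (swp m k \<circ> q) = inv' q \<circ> swp k m"
      by (subst o_inv_distrib) (auto simp: permutes_bij transpose_commute)
  qed
  also have "\<dots> = (\<Sum>k\<in>insert m R. \<Sum>q | q permutes R. f (q \<circ> swp k m))"
    by (intro sum.cong refl sum_permutations_inverse[symmetric])
  finally show ?thesis .
qed

section \<open>The abstract loop equations and their solution\<close>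

locale loop_functional =
  fixes N :: nat and S :: "nat set"
    and T :: "(nat \<Rightarrow> cmat) \<Rightarrow> (nat \<Rightarrow> nat) \<Rightarrow> (nat \<Rightarrow> nat) \<Rightarrow> complex"
  \<comment> \<open>The threshold serves twice: it makes the Neumann series converge absolutely
    (\<open>xi_small\<close>), and it makes the loop operator injective (\<open>card_less_N\<close>,
    \<open>swp_unique\<close>).\<close>
  assumes finS: "finite S" and N: "N > card S ^ 2"
    and T_id: "\<And>B i j. \<lbrakk>\<And>k. k \<in> S \<Longrightarrow> B k = cmat_id; i \<in> idx N S; j \<in> idx N S\<rbrakk> \<Longrightarrow>
        T B i j = (\<Prod>k\<in>S. cmat_id (i k) (j k))"
    and T_loop: "\<And>Q m B i j. \<lbrakk>Q \<subseteq> S; m \<in> Q; \<And>k. k \<in> S - Q \<Longrightarrow> B k = cmat_id; i \<in> idx N S; j \<in> idx N S\<rbrakk> \<Longrightarrow>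
        of_nat N * T B i j + (\<Sum>k\<in>Q-{m}. T B (i \<circ> swp k m) j) =
        cmat_trace N (B m) * T (B(m := cmat_id)) i j +
        (\<Sum>k\<in>Q-{m}. T (B(k := cmat_mult N (B k) (B m), m := cmat_id)) i (j \<circ> swp k m))"
begin

text \<open>In the application \<open>T B\<close> is the matrix of the expectation of the tensor
  product of the U B_k U^*. At \<open>p = id\<close> and constant \<open>B\<close> this contraction
  is a moment of Tr(A U B U^-1). A general \<open>p\<close> is carried along because the loop
  equations move it.\<close>

definition tensor_trace :: "cmat \<Rightarrow> (nat \<Rightarrow> cmat) \<Rightarrow> (nat \<Rightarrow> nat) \<Rightarrow> complex" where
  "tensor_trace A B p = (\<Sum>i\<in>idx N S. \<Sum>j\<in>idx N S. (\<Prod>k\<in>S. A (j k) (i (p k))) * T B i j)"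

lemma tensor_trace_id:
  assumes "\<And>k. k \<in> S \<Longrightarrow> B k = cmat_id"
  shows "tensor_trace A B p = ptrace N S (\<lambda>_. A) p"
proof -
  have "tensor_trace A B p = (\<Sum>i\<in>idx N S. \<Sum>j\<in>idx N S. if i = j then (\<Prod>k\<in>S. A (j k) (i (p k))) else 0)"
    unfolding tensor_trace_def
  proof (intro sum.cong refl)
    fix i j assume ij: "i \<in> idx N S" "j \<in> idx N S"
    have "T B i j = (\<Prod>k\<in>S. cmat_id (i k) (j k))" by (rule T_id) (use assms ij in auto)
    also have "\<dots> = (if i = j then 1 else 0)"
    proof (cases "i = j")
      case False
      then obtain k where "k \<in> S" "i k \<noteq> j k" using ij by (metis PiE_ext)
      then show ?thesis using False finS by (auto simp: cmat_id_def prod_zero_iff)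
    qed (simp add: cmat_id_def)
    finally show "(\<Prod>k\<in>S. A (j k) (i (p k))) * T B i j =
      (if i = j then (\<Prod>k\<in>S. A (j k) (i (p k))) else 0)" by simp
  qed
  also have "\<dots> = (\<Sum>i\<in>idx N S. (\<Prod>k\<in>S. A (i k) (i (p k))))"
    using finS by (intro sum.cong refl) (simp add: sum.delta')
  finally show ?thesis by (simp add: ptrace_def)
qed

lemma idx_comp_swp:
  assumes "k \<in> S" "m \<in> S" "i \<in> idx N S"
  shows "i \<circ> swp k m \<in> idx N S"
proof (rule PiE_I)
  fix x
  show "(i \<circ> swp k m) x \<in> {..<N}" if "x \<in> S" using assms that
      by (auto simp: Transposition.transpose_def)
  show "(i \<circ> swp k m) x = undefined" if "x \<notin> S"
    using assms that by (auto simp: Transposition.transpose_def)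
qed

lemma sum_idx_swp:
  assumes "k \<in> S" "m \<in> S"
  shows "(\<Sum>i\<in>idx N S. f (i \<circ> swp k m)) = (\<Sum>i\<in>idx N S. f i)"
  by (rule sum.reindex_bij_witness[where i = "\<lambda>i. i \<circ> swp k m" and j = "\<lambda>i. i \<circ> swp k m"])
     (use idx_comp_swp[OF assms] in \<open>auto simp: comp_assoc\<close>)

text \<open>Relabelling the row index \<open>i\<close> of \<open>T\<close> becomes left
  multiplication of \<open>p\<close>, relabelling the column index \<open>j\<close> becomes right
  multiplication. The unknown is thus moved from the left and the source from the right.\<close>

lemma tensor_trace_loop:
  assumes "Q \<subseteq> S" "m \<in> Q" "\<And>k. k \<in> S - Q \<Longrightarrow> B k = cmat_id"
  shows "of_nat N * tensor_trace A B p + (\<Sum>k\<in>Q-{m}. tensor_trace A B (swp k m \<circ> p)) =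
        cmat_trace N (B m) * tensor_trace A (B(m := cmat_id)) p +
        (\<Sum>k\<in>Q-{m}. tensor_trace A (B(k := cmat_mult N (B k) (B m), m := cmat_id)) (p \<circ> swp k m))"
proof -
  let ?a = "\<lambda>p i j. (\<Prod>k\<in>S. A (j k) (i (p k)))"
  let ?B = "\<lambda>k. B(k := cmat_mult N (B k) (B m), m := cmat_id)"
  have 1: "tensor_trace A B (swp k m \<circ> p) = (\<Sum>i\<in>idx N S. \<Sum>j\<in>idx N S. ?a p i j * T B (i \<circ> swp k m) j)"
    if k: "k \<in> Q - {m}" for k
  proof -
    have km: "k \<in> S" "m \<in> S" using k assms by auto
    have "(\<Sum>i\<in>idx N S. \<Sum>j\<in>idx N S. ?a p i j * T B (i \<circ> swp k m) j) =
      (\<Sum>i\<in>idx N S. \<Sum>j\<in>idx N S. ?a p (i \<circ> swp k m) j * T B (i \<circ> swp k m \<circ> swp k m) j)"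
      by (rule sum_idx_swp[OF km, symmetric])
    then show ?thesis unfolding tensor_trace_def by (simp add: comp_assoc)
  qed
  have 2: "tensor_trace A (?B k) (p \<circ> swp k m) = (\<Sum>i\<in>idx N S. \<Sum>j\<in>idx N S. ?a p i j
      * T (?B k) i (j \<circ> swp k m))"
    if k: "k \<in> Q - {m}" for k
  proof -
    have km: "k \<in> S" "m \<in> S" using k assms by auto
    have bij: "bij_betw (swp k m) S S"
      using km by (intro permutes_imp_bij permutes_swap_id)
    have "(\<Sum>j\<in>idx N S. ?a p i j * T (?B k) i (j \<circ> swp k m)) =
      (\<Sum>j\<in>idx N S. ?a p i (j \<circ> swp k m) * T (?B k) i (j \<circ> swp k m \<circ> swp k m))" for i
      by (rule sum_idx_swp[OF km, symmetric])
    moreover have "?a p i (j \<circ> swp k m) = ?a (p \<circ> swp k m) i j" for i j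
      by (subst prod.reindex_bij_betw[OF bij, symmetric]) simp
    ultimately show ?thesis unfolding tensor_trace_def by (simp add: comp_assoc)
  qed
  have fQ: "finite (Q - {m})" using assms finS finite_subset by blast
  have dist: "(\<Sum>i\<in>idx N S. \<Sum>j\<in>idx N S. ?a p i j * (c * f i j + (\<Sum>k\<in>Q-{m}. t k i j)))
     = c * (\<Sum>i\<in>idx N S. \<Sum>j\<in>idx N S. ?a p i j * f i j) +
       (\<Sum>k\<in>Q-{m}. \<Sum>i\<in>idx N S. \<Sum>j\<in>idx N S. ?a p i j * t k i j)" for c f
           and t :: "nat \<Rightarrow> (nat \<Rightarrow> nat) \<Rightarrow> (nat \<Rightarrow> nat) \<Rightarrow> complex"
  proof -
    have "(\<Sum>k\<in>Q-{m}. \<Sum>i\<in>idx N S. \<Sum>j\<in>idx N S. ?a p i j * t k i j) =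
       (\<Sum>i\<in>idx N S. \<Sum>j\<in>idx N S. \<Sum>k\<in>Q-{m}. ?a p i j * t k i j)"
      by (subst sum.swap, intro sum.cong refl, rule sum.swap)
    then show ?thesis
      by (simp add: distrib_left sum.distrib sum_distrib_left mult.left_commute)
  qed
  have "of_nat N * tensor_trace A B p + (\<Sum>k\<in>Q-{m}. tensor_trace A B (swp k m \<circ> p)) =
    of_nat N * (\<Sum>i\<in>idx N S. \<Sum>j\<in>idx N S. ?a p i j * T B i j) +
    (\<Sum>k\<in>Q-{m}. \<Sum>i\<in>idx N S. \<Sum>j\<in>idx N S. ?a p i j * T B (i \<circ> swp k m) j)"
    by (simp only: 1 tensor_trace_def[of A B p] cong: sum.cong)
  also have "\<dots> =
    (\<Sum>i\<in>idx N S. \<Sum>j\<in>idx N S. ?a p i j * (of_nat N * T B i j + (\<Sum>k\<in>Q-{m}. T B (i \<circ> swp k m) j)))"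
    by (rule dist[symmetric])
  also have "\<dots> = (\<Sum>i\<in>idx N S. \<Sum>j\<in>idx N S. ?a p i j *
     (cmat_trace N (B m) * T (B(m := cmat_id)) i j + (\<Sum>k\<in>Q-{m}. T (?B k) i (j \<circ> swp k m))))"
    by (intro sum.cong refl) (subst T_loop[OF assms], auto)
  also have "\<dots> = cmat_trace N (B m) * (\<Sum>i\<in>idx N S. \<Sum>j\<in>idx N S. ?a p i j * T (B(m := cmat_id)) i j) +
    (\<Sum>k\<in>Q-{m}. \<Sum>i\<in>idx N S. \<Sum>j\<in>idx N S. ?a p i j * T (?B k) i (j \<circ> swp k m))"
    by (rule dist)
  also have "\<dots> = cmat_trace N (B m) * tensor_trace A (B(m := cmat_id)) p
      + (\<Sum>k\<in>Q-{m}. tensor_trace A (?B k) (p \<circ> swp k m))"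
    by (simp only: 2 tensor_trace_def[of A "B(m := cmat_id)" p] cong: sum.cong)
  finally show ?thesis .
qed

lemma N_pos: "N > 0"
  using N by simp

lemma card_less_N: "R \<subseteq> S \<Longrightarrow> card R < N"
proof -
  assume "R \<subseteq> S"
  then have "card R \<le> card S" by (intro card_mono finS)
  also have "card S \<le> card S ^ 2" by (simp add: power2_eq_square)
  finally show ?thesis using N by simp
qed

text \<open>A maximum argument replaces the inverse operator: where the difference of two solutions
  is largest, \<open>N\<close> times it is bounded by \<open>card R\<close> terms of at most that
  size, and \<open>card R < N\<close>.\<close>

lemma swp_unique:
  assumes "R \<subseteq> S" "m \<in> S"
    and f: "\<And>p. p permutes S \<Longrightarrow> of_nat N * f p + (\<Sum>k\<in>R. f (swp k m \<circ> p)) = of_nat N * g p"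
    and h: "\<And>p. p permutes S \<Longrightarrow> of_nat N * h p + (\<Sum>k\<in>R. h (swp k m \<circ> p)) = of_nat N * g p"
    and p: "p permutes S"
  shows "f p = (h p :: complex)"
proof -
  define D where "D = (\<lambda>p. norm (f p - h p))"
  have fin: "finite (D ` {p. p permutes S})" using finS by (simp add: finite_permutations)
  define M where "M = Max (D ` {p. p permutes S})"
  have DM: "D q \<le> M" if "q permutes S" for q
    unfolding M_def using that by (intro Max_ge fin) auto
  obtain q where q: "q permutes S" "D q = M"
  proof -
    have "D ` {p. p permutes S} \<noteq> {}" using p by auto
    from Max_in[OF fin this] show ?thesis using that unfolding M_def by auto
  qed
  have "of_nat N * (f q - h q) = - (\<Sum>k\<in>R. f (swp k m \<circ> q) - h (swp k m \<circ> q))"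
  proof -
    have "of_nat N * (f q - h q) = of_nat N * f q - of_nat N * h q" by (rule right_diff_distrib)
    also have "\<dots> = (\<Sum>k\<in>R. h (swp k m \<circ> q)) - (\<Sum>k\<in>R. f (swp k m \<circ> q))"
      using f[OF q(1)] h[OF q(1)] by (simp add: algebra_simps eq_diff_eq)
    finally show ?thesis by (simp add: sum_subtractf)
  qed
  then have "real N * M = norm (\<Sum>k\<in>R. f (swp k m \<circ> q) - h (swp k m \<circ> q))"
  proof -
    assume eq: "of_nat N * (f q - h q) = - (\<Sum>k\<in>R. f (swp k m \<circ> q) - h (swp k m \<circ> q))"
    have "norm (of_nat N * (f q - h q)) = real N * M"
      using q(2) by (simp add: D_def norm_mult)
    then show ?thesis unfolding eq by simp
  qed
  also have "\<dots> \<le> (\<Sum>k\<in>R. M)"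
  proof (rule sum_norm_le)
    fix k assume "k \<in> R"
    then have "swp k m \<circ> q permutes S"
      using assms(1,2) by (intro permutes_compose q permutes_swap_id) auto
    from DM[OF this] show "norm (f (swp k m \<circ> q) - h (swp k m \<circ> q)) \<le> M" by (simp add: D_def)
  qed
  finally have "(real N - real (card R)) * M \<le> 0" by (simp add: algebra_simps)
  moreover have "real N - real (card R) > 0" using card_less_N[OF assms(1)] by simp
  ultimately have "M \<le> 0" by (simp add: mult_le_0_iff)
  then have "norm (f p - h p) \<le> 0" using DM[OF p] unfolding D_def by linarith
  then show ?thesis by simp
qed

definition xi :: complex where "xi = - 1 / of_nat N"

lemma xi_small: "norm xi * real (card S ^ 2) < 1"
proof -
  have "real (card S ^ 2) < real N" using N by (simp only: of_nat_less_iff)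
  then show ?thesis using N_pos by (simp add: xi_def norm_divide)
qed

text \<open>The series multiplies the argument from the left, the summands translate it from the
  right; associativity of composition interchanges the two.\<close>

lemma mono_series_linear:
  assumes "R \<subseteq> S" "p permutes S" "K \<subseteq> S" "m \<in> S"
  shows "mono_series xi R (\<lambda>p. c * v0 p + (\<Sum>k\<in>K. v k (p \<circ> swp k m))) p =
     c * mono_series xi R v0 p + (\<Sum>k\<in>K. mono_series xi R (v k) (p \<circ> swp k m))"
proof -
  have sm: "summable (\<lambda>r. xi ^ r * mono_sum R v r q)" if "q permutes S" for q v
    by (rule summable_norm_cancel[OF mono_sum_summable[OF finS assms(1) that xi_small]])
  have perm: "p \<circ> swp k m permutes S" if "k \<in> K" for k
    using that assms by (intro permutes_compose permutes_swap_id) auto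
  have "xi ^ r * mono_sum R (\<lambda>p. c * v0 p + (\<Sum>k\<in>K. v k (p \<circ> swp k m))) r p =
     c * (xi ^ r * mono_sum R v0 r p) + (\<Sum>k\<in>K. xi ^ r * mono_sum R (v k) r (p \<circ> swp k m))" for r
    unfolding mono_sum_def
    by (simp add: sum.distrib sum_distrib_left distrib_left sum.swap[of _ K] comp_assoc
        mult.left_commute)
  then have "mono_series xi R (\<lambda>p. c * v0 p + (\<Sum>k\<in>K. v k (p \<circ> swp k m))) p =
     (\<Sum>r. c * (xi ^ r * mono_sum R v0 r p) + (\<Sum>k\<in>K. xi ^ r * mono_sum R (v k) r (p \<circ> swp k m)))"
    by (simp add: mono_series_def)
  also have "\<dots> = (\<Sum>r. c * (xi ^ r * mono_sum R v0 r p)) + (\<Sum>r. \<Sum>k\<in>K. xi ^ r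
      * mono_sum R (v k) r (p \<circ> swp k m))"
    by (intro suminf_add[symmetric] summable_mult summable_sum sm assms perm)
  also have "(\<Sum>r. c * (xi ^ r * mono_sum R v0 r p)) = c * mono_series xi R v0 p"
    unfolding mono_series_def by (intro suminf_mult sm assms)
  also have "(\<Sum>r. \<Sum>k\<in>K. xi ^ r * mono_sum R (v k) r (p \<circ> swp k m))
      = (\<Sum>k\<in>K. mono_series xi R (v k) (p \<circ> swp k m))"
    unfolding mono_series_def by (intro suminf_sum sm perm)
  finally show ?thesis .
qed

text \<open>The source once all sites of \<open>R\<close> are eliminated. Each elimination closes a
  cycle and emits a trace, or merges the site into another one, so the histories are the
  permutations of \<open>R\<close>. The inverse arranges the right translations in the order in
  which they occur.\<close>

definition weighted_sum :: "cmat \<Rightarrow> nat set \<Rightarrow> (nat \<Rightarrow> cmat) \<Rightarrow> (nat \<Rightarrow> nat) \<Rightarrow> complex" where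
  "weighted_sum A R B p = (\<Sum>s | s permutes R. ptrace N R B s * ptrace N S (\<lambda>_. A) (p \<circ> inv' s))"

lemma weighted_sum_insert:
  assumes "finite R" "m \<notin> R"
  shows "weighted_sum A (insert m R) B p = cmat_trace N (B m) * weighted_sum A R (B(m := cmat_id)) p +
    (\<Sum>k\<in>R. weighted_sum A R (B(k := cmat_mult N (B k) (B m), m := cmat_id)) (p \<circ> swp k m))"
proof -
  have q: "q m = m" "q ` R \<subseteq> R" if "q permutes R" for q
    using that assms(2) by (auto simp: permutes_not_in permutes_image)
  have off: "ptrace N R B q = ptrace N R (B(m := cmat_id)) q" for q and B :: "nat \<Rightarrow> cmat"
    using assms by (intro ptrace_cong) auto
  have "weighted_sum A (insert m R) B p = (\<Sum>k\<in>insert m R. \<Sum>q | q permutes R.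
      ptrace N (insert m R) B (q \<circ> swp k m) * ptrace N S (\<lambda>_. A) (p \<circ> inv' (q \<circ> swp k m)))"
    unfolding weighted_sum_def by (rule permutes_sum_insert_right[OF assms])
  also have "\<dots> = (\<Sum>q | q permutes R. ptrace N (insert m R) B q * ptrace N S (\<lambda>_. A) (p \<circ> inv' q)) +
     (\<Sum>k\<in>R. \<Sum>q | q permutes R.
      ptrace N (insert m R) B (q \<circ> swp k m) * ptrace N S (\<lambda>_. A) (p \<circ> inv' (q \<circ> swp k m)))"
    using assms by simp
  also have "(\<Sum>q | q permutes R. ptrace N (insert m R) B q * ptrace N S (\<lambda>_. A) (p \<circ> inv' q)) =
      cmat_trace N (B m) * weighted_sum A R (B(m := cmat_id)) p"
    unfolding weighted_sum_def sum_distrib_left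
  proof (intro sum.cong refl)
    fix s assume "s \<in> {s. s permutes R}"
    then have "ptrace N (insert m R) B s = cmat_trace N (B m) * ptrace N R (B(m := cmat_id)) s"
      using ptrace_insert_fixed[OF assms] q off by simp
    then show "ptrace N (insert m R) B s * ptrace N S (\<lambda>_. A) (p \<circ> inv' s) =
      cmat_trace N (B m) * (ptrace N R (B(m := cmat_id)) s * ptrace N S (\<lambda>_. A) (p \<circ> inv' s))" by simp
  qed
  also have "(\<Sum>k\<in>R. \<Sum>q | q permutes R.
      ptrace N (insert m R) B (q \<circ> swp k m) * ptrace N S (\<lambda>_. A) (p \<circ> inv' (q \<circ> swp k m))) =
    (\<Sum>k\<in>R. weighted_sum A R (B(k := cmat_mult N (B k) (B m), m := cmat_id)) (p \<circ> swp k m))"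
    unfolding weighted_sum_def
  proof (intro sum.cong refl)
    fix k s assume k: "k \<in> R" and "s \<in> {s. s permutes R}"
    then have s: "s permutes R" by simp
    have "ptrace N (insert m R) B (s \<circ> swp k m)
        = ptrace N R (B(k := cmat_mult N (B k) (B m), m := cmat_id)) s"
      using ptrace_insert_merge[OF assms q[OF s] k] off by simp
    moreover have "inv' (s \<circ> swp k m) = swp k m \<circ> inv' s"
      by (subst o_inv_distrib) (use s in \<open>auto simp: permutes_bij\<close>)
    ultimately show "ptrace N (insert m R) B (s \<circ> swp k m)
        * ptrace N S (\<lambda>_. A) (p \<circ> inv' (s \<circ> swp k m)) =
      ptrace N R (B(k := cmat_mult N (B k) (B m), m := cmat_id)) s
          * ptrace N S (\<lambda>_. A) (p \<circ> swp k m \<circ> inv' s)"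
      by (simp add: comp_assoc)
  qed
  finally show ?thesis .
qed

text \<open>The largest active site \<open>m\<close> is removed. Both sides solve the same equation
  for N + J_m, whose source is given by the induction hypothesis for families in which
  \<open>m\<close> is already inactive; hence \<open>B\<close> must be arbitrary. The power of
  \<open>N\<close> turns each N + J_m into 1 - \<open>xi\<close> J_m.\<close>

theorem tensor_trace_formula:
  assumes "R \<subseteq> S" "\<And>k. k \<in> S - R \<Longrightarrow> B k = cmat_id" "p permutes S"
  shows "of_nat N ^ card R * tensor_trace A B p = mono_series xi R (weighted_sum A R B) p"
proof -
  have "finite R" using assms(1) finS finite_subset by blast
  then show ?thesis using assms
  proof (induction R arbitrary: B p rule: finite_linorder_max_induct)
    case empty
    have "tensor_trace A B p = ptrace N S (\<lambda>_. A) p" by (rule tensor_trace_id) (use empty in auto)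
    moreover have "weighted_sum A {} B p = ptrace N S (\<lambda>_. A) p"
      by (simp add: weighted_sum_def)
    ultimately show ?case by simp
  next
    case (insert m R)
    have m: "m \<notin> R" "m \<in> S" "R \<subseteq> S" and mx: "\<And>k. k \<in> R \<Longrightarrow> k < m" using insert by auto
    let ?Q = "insert m R"
    show ?case
    proof (rule swp_unique[where f = "\<lambda>p. of_nat N ^ card ?Q * tensor_trace A B p" and h
        = "mono_series xi ?Q (weighted_sum A ?Q B)"
          and R = R and g = "mono_series xi R (weighted_sum A ?Q B)"])
      fix p assume p: "p permutes S"
      have "mono_series xi ?Q (weighted_sum A ?Q B) p = mono_series xi R (weighted_sum A ?Q B) p + xi
          * (\<Sum>k\<in>R. mono_series xi ?Q (weighted_sum A ?Q B) (swp k m \<circ> p))"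
        by (rule mono_series_insert_max[OF finS _ p xi_small mx]) (use insert in auto)
      then have "of_nat N * mono_series xi ?Q (weighted_sum A ?Q B) p = of_nat N
          * mono_series xi R (weighted_sum A ?Q B) p +
        (of_nat N * xi) * (\<Sum>k\<in>R. mono_series xi ?Q (weighted_sum A ?Q B) (swp k m \<circ> p))"
        by (simp only: distrib_left mult.assoc)
      also have "of_nat N * xi = -1" using N_pos by (simp add: xi_def)
      finally show "of_nat N * mono_series xi ?Q (weighted_sum A ?Q B) p
          + (\<Sum>k\<in>R. mono_series xi ?Q (weighted_sum A ?Q B) (swp k m \<circ> p)) =
         of_nat N * mono_series xi R (weighted_sum A ?Q B) p"
             by (simp only: mult_minus1 add.assoc left_minus add_0_right)
      let ?B = "\<lambda>k. B(k := cmat_mult N (B k) (B m), m := cmat_id)"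
      have QR: "?Q - {m} = R" using m by auto
      have "of_nat N * tensor_trace A B p + (\<Sum>k\<in>R. tensor_trace A B (swp k m \<circ> p)) =
        cmat_trace N (B m) * tensor_trace A (B(m := cmat_id)) p
            + (\<Sum>k\<in>R. tensor_trace A (?B k) (p \<circ> swp k m))"
        using tensor_trace_loop[of ?Q m B A p] insert.prems unfolding QR by simp
      then have "of_nat N ^ card R * (of_nat N * tensor_trace A B p
          + (\<Sum>k\<in>R. tensor_trace A B (swp k m \<circ> p))) =
        cmat_trace N (B m) * (of_nat N ^ card R * tensor_trace A (B(m := cmat_id)) p) +
        (\<Sum>k\<in>R. of_nat N ^ card R * tensor_trace A (?B k) (p \<circ> swp k m))"
        by (simp add: distrib_left sum_distrib_left mult.left_commute)
      also have "of_nat N ^ card R * tensor_trace A (B(m := cmat_id)) p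
          = mono_series xi R (weighted_sum A R (B(m := cmat_id))) p"
        by (rule insert.IH) (use insert.prems p m in auto)
      also have "(\<Sum>k\<in>R. of_nat N ^ card R * tensor_trace A (?B k) (p \<circ> swp k m)) =
        (\<Sum>k\<in>R. mono_series xi R (weighted_sum A R (?B k)) (p \<circ> swp k m))"
      proof (intro sum.cong refl insert.IH)
        fix k assume k: "k \<in> R"
        show "p \<circ> swp k m permutes S" using k m p by (intro permutes_compose permutes_swap_id) auto
      qed (use insert.prems m in auto)
      also have "cmat_trace N (B m) * mono_series xi R (weighted_sum A R (B(m := cmat_id))) p
          + (\<Sum>k\<in>R. mono_series xi R (weighted_sum A R (?B k)) (p \<circ> swp k m))
         = mono_series xi R (weighted_sum A ?Q B) p"
        by (subst mono_series_linear[OF m(3) p m(3) m(2), symmetric]) (simp add: weighted_sum_insert[OF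
            insert.hyps(1) m(1), symmetric])
      finally have *: "of_nat N ^ card R * (of_nat N * tensor_trace A B p
          + (\<Sum>k\<in>R. tensor_trace A B (swp k m \<circ> p))) =
         mono_series xi R (weighted_sum A ?Q B) p" .
      have card: "card ?Q = Suc (card R)" using insert.hyps(1) m by simp
      show "of_nat N * (of_nat N ^ card ?Q * tensor_trace A B p) + (\<Sum>k\<in>R. of_nat N ^ card ?Q
          * tensor_trace A B (swp k m \<circ> p)) =
         of_nat N * mono_series xi R (weighted_sum A ?Q B) p"
        unfolding *[symmetric] card by (simp add: distrib_left sum_distrib_left mult_ac)
    qed (use m insert.prems in auto)
  qed
qed

end

definition full_sum :: "nat \<Rightarrow> cmat \<Rightarrow> cmat \<Rightarrow> nat set \<Rightarrow> nat \<Rightarrow> complex" where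
  "full_sum N A B S r = (\<Sum>s | s permutes S. \<Sum>l\<in>mono_lists S r. ptrace N S (\<lambda>_. B) s
      * ptrace N S (\<lambda>_. A) (s \<circ> transp_prod l))"

theorem (in loop_functional) tensor_trace_id_formula:
  shows "of_nat N ^ card S * tensor_trace A (\<lambda>_. B) id = (\<Sum>r. xi ^ r * full_sum N A B S r)"
    and "summable (\<lambda>r. norm (xi ^ r * full_sum N A B S r))"
proof -
  have eq: "mono_sum S (weighted_sum A S (\<lambda>_. B)) r id = full_sum N A B S r" for r
  proof -
    have "weighted_sum A S (\<lambda>_. B) (transp_prod l) = (\<Sum>s | s permutes S. ptrace N S (\<lambda>_. B) s
        * ptrace N S (\<lambda>_. A) (s \<circ> transp_prod l))"
      if l: "l \<in> mono_lists S r" for l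
    proof -
      have t: "transp_prod l permutes S" using l by (rule mono_lists_permutes) simp
      \<comment> \<open>Summing over inverses and conjugating by \<open>s\<close> turns
        \<open>transp_prod l \<circ> inv' s\<close> into \<open>s \<circ> transp_prod l\<close>, the
        order of factors in the relation that defines the Hurwitz numbers.\<close>
      have "weighted_sum A S (\<lambda>_. B) (transp_prod l) = (\<Sum>s | s permutes S. ptrace N S (\<lambda>_. B) (inv' s)
          * ptrace N S (\<lambda>_. A) (transp_prod l \<circ> inv' (inv' s)))"
        unfolding weighted_sum_def by (rule sum_permutations_inverse)
      also have "\<dots> = (\<Sum>s | s permutes S. ptrace N S (\<lambda>_. B) s * ptrace N S (\<lambda>_. A) (s \<circ> transp_prod l))"
      proof (intro sum.cong refl)
        fix s assume "s \<in> {s. s permutes S}"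
        then have s: "s permutes S" by simp
        have "ptrace N S (\<lambda>_. A) (s \<circ> (transp_prod l \<circ> s) \<circ> inv' s)
            = ptrace N S (\<lambda>_. A) (transp_prod l \<circ> s)"
          by (rule ptrace_conj[OF s permutes_compose[OF s t]])
        moreover have "s \<circ> (transp_prod l \<circ> s) \<circ> inv' s = s \<circ> transp_prod l"
          using s by (auto simp: fun_eq_iff permutes_inverses)
        ultimately show "ptrace N S (\<lambda>_. B) (inv' s)
            * ptrace N S (\<lambda>_. A) (transp_prod l \<circ> inv' (inv' s)) =
            ptrace N S (\<lambda>_. B) s * ptrace N S (\<lambda>_. A) (s \<circ> transp_prod l)"
          using s by (simp add: ptrace_inv[OF s finS] permutes_inv_inv)
      qed
      finally show ?thesis .
    qed
    then show ?thesis
      unfolding mono_sum_def full_sum_def by (subst sum.swap) simp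
  qed
  show "of_nat N ^ card S * tensor_trace A (\<lambda>_. B) id = (\<Sum>r. xi ^ r * full_sum N A B S r)"
    using tensor_trace_formula[of S "\<lambda>_. B" id A] by (simp add: mono_series_def eq permutes_id)
  show "summable (\<lambda>r. norm (xi ^ r * full_sum N A B S r))"
    using mono_sum_summable[OF finS subset_refl permutes_id xi_small, of "weighted_sum A S (\<lambda>_. B)"]
        by (simp add: eq)
qed

section \<open>Entrywise calculus of unitary conjugation\<close>

section \<open>Conjugation by unitary matrices\<close>

lemma adj_carrier [simp]: "A \<in> carrier_mat n m \<Longrightarrow> mat_adjoint (A :: complex mat) \<in> carrier_mat m n"
  by (intro carrier_matI) (auto simp: mat_adjoint_def)

lemma adj_index:
  assumes "A \<in> carrier_mat n m" "i < m" "j < n"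
  shows "mat_adjoint (A :: complex mat) $$ (i, j) = cnj (A $$ (j, i))"
proof -
  have dims: "dim_row A = n" "dim_col A = m" using assms(1) by auto
  have i: "i < length (map conjugate (cols A))" "i < length (cols A)" "i < dim_col A"
      and j: "j < dim_row A"
    using assms(2,3) by (simp_all only: length_map cols_length dims)
  have "mat_adjoint A $$ (i, j) = vec_index (conjugate (col A i)) j"
    by (simp only: mat_adjoint_def mat_of_rows_index[OF i(1) j] nth_map[OF i(2)] cols_nth[OF i(3)])
  also have "\<dots> = cnj (A $$ (j, i))"
    using i j by (simp only: vec_index_conjugate dim_col index_col conjugate_complex_def)
  finally show ?thesis .
qed

lemma mult_index:
  assumes "A \<in> carrier_mat n m" "B \<in> carrier_mat m k" "i < n" "j < k"
  shows "(A * B :: complex mat) $$ (i, j) = (\<Sum>a<m. A $$ (i, a) * B $$ (a, j))"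
proof -
  have dims: "dim_row A = n" "dim_col A = m" "dim_row B = m" "dim_col B = k" using assms(1,2) by auto
  have "(A * B) $$ (i, j) = row A i \<bullet> col B j"
    using assms(3,4) dims by (simp only: index_mult_mat(1))
  also have "\<dots> = (\<Sum>a<m. vec_index (row A i) a * vec_index (col B j) a)"
    by (simp only: scalar_prod_def dim_col dims lessThan_atLeast0)
  also have "\<dots> = (\<Sum>a<m. A $$ (i, a) * B $$ (a, j))"
    using assms(3,4) dims by (intro sum.cong refl) (simp only: index_row(1) index_col lessThan_iff)
  finally show ?thesis .
qed

lemma unitary_carrier: "U \<in> unitary_mats N \<Longrightarrow> U \<in> carrier_mat N N"
  by (simp add: unitary_mats_def)

lemma unitary_rows:
  assumes "U \<in> unitary_mats N" "i < N" "j < N"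
  shows "(\<Sum>a<N. U $$ (i, a) * cnj (U $$ (j, a))) = (if i = j then 1 else 0)"
proof -
  have U: "U \<in> carrier_mat N N" using assms unitary_carrier by auto
  have "(U * mat_adjoint U) $$ (i, j) = (\<Sum>a<N. U $$ (i, a) * cnj (U $$ (j, a)))"
    by (subst mult_index[OF U adj_carrier[OF U]]) (use assms adj_index[OF U] in auto)
  then show ?thesis using assms by (simp add: unitary_mats_def)
qed

lemma unitary_cols:
  assumes "U \<in> unitary_mats N" "i < N" "j < N"
  shows "(\<Sum>a<N. cnj (U $$ (a, i)) * U $$ (a, j)) = (if i = j then 1 else 0)"
proof -
  have U: "U \<in> carrier_mat N N" using assms unitary_carrier by auto
  have "(mat_adjoint U * U) $$ (i, j) = (\<Sum>a<N. cnj (U $$ (a, i)) * U $$ (a, j))"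
    by (subst mult_index[OF adj_carrier[OF U] U]) (use assms adj_index[OF U] in auto)
  then show ?thesis using assms by (simp add: unitary_mats_def)
qed

lemma unitary_entry_le_1:
  assumes "U \<in> unitary_mats N" "i < N" "j < N"
  shows "norm (U $$ (i, j)) \<le> 1"
proof -
  have "(\<Sum>a<N. complex_of_real ((norm (U $$ (i, a)))\<^sup>2)) = 1"
    using unitary_rows[OF assms(1,2,2)] by (simp only: complex_norm_square simp_thms if_True)
  then have "complex_of_real (\<Sum>a<N. (norm (U $$ (i, a)))\<^sup>2) = 1"
    by (simp only: of_real_sum)
  then have "(\<Sum>a<N. (norm (U $$ (i, a)))\<^sup>2) = 1"
    by (simp only: of_real_eq_1_iff)
  moreover have "(norm (U $$ (i, j)))\<^sup>2 \<le> (\<Sum>a<N. (norm (U $$ (i, a)))\<^sup>2)"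
    by (rule member_le_sum) (use assms in auto)
  ultimately show ?thesis using abs_square_le_1[of "norm (U $$ (i, j))"] by simp
qed

lemma unitary_adjoint:
  assumes "U \<in> unitary_mats N"
  shows "mat_adjoint U \<in> unitary_mats N"
proof -
  have U: "U \<in> carrier_mat N N" using assms unitary_carrier by auto
  have "mat_adjoint (mat_adjoint U) = U"
    by (rule eq_matI) (use U in \<open>auto simp: adj_index[OF U] adj_index[OF adj_carrier[OF U]]
          carrier_matD[OF adj_carrier[OF adj_carrier[OF U]]]\<close>)
  then show ?thesis using assms by (auto simp: unitary_mats_def)
qed

lemma unitary_mult:
  assumes "U \<in> unitary_mats N" "V \<in> unitary_mats N"
  shows "V * U \<in> unitary_mats N"
proof -
  have U: "U \<in> carrier_mat N N" and V: "V \<in> carrier_mat N N" using assms unitary_carrier by auto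
  have UV: "V * U \<in> carrier_mat N N" using U V by simp
  have adj: "mat_adjoint (V * U) = mat_adjoint U * mat_adjoint V"
  proof (rule eq_matI)
    fix i j assume "i < dim_row (mat_adjoint U * mat_adjoint V)" "j < dim_col (mat_adjoint U
        * mat_adjoint V)"
    then have ij: "i < N" "j < N"
      using adj_carrier[OF U] adj_carrier[OF V] by auto
    then show "mat_adjoint (V * U) $$ (i, j) = (mat_adjoint U * mat_adjoint V) $$ (i, j)"
      unfolding adj_index[OF UV ij] mult_index[OF V U ij(2,1)] mult_index[OF adj_carrier[OF U]
          adj_carrier[OF V] ij]
      by (auto simp: adj_index[OF U] adj_index[OF V] mult.commute)
  qed (use carrier_matD[OF adj_carrier[OF UV]] carrier_matD[OF adj_carrier[OF U]] carrier_matD[OF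
      adj_carrier[OF V]] in auto)
  have aU: "mat_adjoint U \<in> carrier_mat N N" and aV: "mat_adjoint V \<in> carrier_mat N N"
    using U V by simp_all
  note cl = mult_carrier_mat[of _ N N _ N]
  have as: "A * (B * C) = A * B * C" if "A \<in> carrier_mat N N" "B \<in> carrier_mat N N" "C \<in> carrier_mat N
      N" for A B C :: "complex mat"
    using assoc_mult_mat[OF that] by simp
  have "V * U * mat_adjoint (V * U) = V * (U * mat_adjoint U) * mat_adjoint V"
    unfolding adj as[OF cl[OF V U] aU aV] as[OF V U aU] ..
  also have "\<dots> = 1\<^sub>m N" using assms right_mult_one_mat[OF V] by (simp add: unitary_mats_def)
  finally have 1: "V * U * mat_adjoint (V * U) = 1\<^sub>m N" .
  have "mat_adjoint (V * U) * (V * U) = mat_adjoint U * (mat_adjoint V * V) * U"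
    unfolding adj as[OF cl[OF aU aV] V U] as[OF aU aV V] ..
  also have "\<dots> = 1\<^sub>m N" using assms right_mult_one_mat[OF aU] by (simp add: unitary_mats_def)
  finally show ?thesis using 1 UV by (simp add: unitary_mats_def)
qed

text \<open>The entries of U B U^*, written as a double sum because \<open>B\<close> is a function
  and not a matrix with a carrier.\<close>

definition conj_mat :: "nat \<Rightarrow> cmat \<Rightarrow> complex mat \<Rightarrow> cmat" where
  "conj_mat N B U = (\<lambda>i j. \<Sum>a<N. \<Sum>b<N. U $$ (i, a) * B a b * cnj (U $$ (j, b)))"

lemma conj_mat_cmat_id:
  assumes "U \<in> unitary_mats N" "i < N" "j < N"
  shows "conj_mat N cmat_id U i j = cmat_id i j"
proof -
  have "conj_mat N cmat_id U i j = (\<Sum>a<N. \<Sum>b<N. if a = b then U $$ (i, a) * cnj (U $$ (j, b)) else 0)"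
    unfolding conj_mat_def cmat_id_def by (intro sum.cong) auto
  also have "\<dots> = (\<Sum>a<N. U $$ (i, a) * cnj (U $$ (j, a)))"
    by (intro sum.cong refl) (simp add: sum.delta')
  finally show ?thesis using unitary_rows[OF assms] by (simp add: cmat_id_def)
qed

lemma conj_mat_cmat_trace:
  assumes "U \<in> unitary_mats N"
  shows "(\<Sum>i<N. conj_mat N B U i i) = cmat_trace N B"
proof -
  have "(\<Sum>i<N. conj_mat N B U i i) = (\<Sum>a<N. \<Sum>b<N. \<Sum>i<N. B a b * (cnj (U $$ (i, b)) * U $$ (i, a)))"
  proof -
    have "(\<Sum>i<N. conj_mat N B U i i) = (\<Sum>a<N. \<Sum>i<N. \<Sum>b<N. U $$ (i, a) * B a b * cnj (U $$ (i, b)))"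
      unfolding conj_mat_def by (rule sum.swap)
    also have "\<dots> = (\<Sum>a<N. \<Sum>b<N. \<Sum>i<N. U $$ (i, a) * B a b * cnj (U $$ (i, b)))"
      by (intro sum.cong refl sum.swap)
    finally show ?thesis by (simp add: mult_ac)
  qed
  also have "\<dots> = (\<Sum>a<N. \<Sum>b<N. if b = a then B a b else 0)"
    by (intro sum.cong refl) (simp add: sum_distrib_left[symmetric] unitary_cols[OF assms])
  also have "\<dots> = cmat_trace N B" unfolding cmat_trace_def by (intro sum.cong refl) (simp add: sum.delta)
  finally show ?thesis .
qed

lemma conj_mat_mult:
  assumes "U \<in> unitary_mats N"
  shows "(\<Sum>c<N. conj_mat N X U i c * conj_mat N Y U c j) = conj_mat N (cmat_mult N X Y) U i j"
proof -
  define P where "P = (\<lambda>b. \<Sum>a<N. U $$ (i, a) * X a b)"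
  define R where "R = (\<lambda>a. \<Sum>b<N. Y a b * cnj (U $$ (j, b)))"
  have 1: "conj_mat N X U i c = (\<Sum>b<N. P b * cnj (U $$ (c, b)))" for c
    unfolding conj_mat_def P_def by (subst sum.swap) (simp add: sum_distrib_right)
  have 2: "conj_mat N Y U c j = (\<Sum>a<N. U $$ (c, a) * R a)" for c
    unfolding conj_mat_def R_def by (simp add: sum_distrib_left mult.assoc)
  have "(\<Sum>c<N. conj_mat N X U i c * conj_mat N Y U c j) = (\<Sum>c<N. \<Sum>b<N. \<Sum>a<N. P b * cnj (U $$ (c, b))
      * (U $$ (c, a) * R a))"
    unfolding 1 2 sum_product ..
  also have "\<dots> = (\<Sum>b<N. \<Sum>c<N. \<Sum>a<N. P b * cnj (U $$ (c, b)) * (U $$ (c, a) * R a))"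
    by (rule sum.swap)
  also have "\<dots> = (\<Sum>b<N. \<Sum>a<N. \<Sum>c<N. P b * cnj (U $$ (c, b)) * (U $$ (c, a) * R a))"
    by (intro sum.cong refl sum.swap)
  also have "\<dots> = (\<Sum>b<N. \<Sum>a<N. P b * R a * (\<Sum>c<N. cnj (U $$ (c, b)) * U $$ (c, a)))"
    by (simp add: sum_distrib_left mult_ac)
  also have "\<dots> = (\<Sum>b<N. \<Sum>a<N. if b = a then P b * R a else 0)"
    by (intro sum.cong refl) (simp add: unitary_cols[OF assms])
  also have "\<dots> = (\<Sum>b<N. P b * R b)"
    by (intro sum.cong refl) (simp add: sum.delta')
  also have "\<dots> = (\<Sum>b<N. \<Sum>a<N. \<Sum>b'<N. U $$ (i, a) * X a b * (Y b b' * cnj (U $$ (j, b'))))"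
    unfolding P_def R_def sum_product ..
  also have "\<dots> = (\<Sum>a<N. \<Sum>b<N. \<Sum>b'<N. U $$ (i, a) * X a b * (Y b b' * cnj (U $$ (j, b'))))"
    by (rule sum.swap)
  also have "\<dots> = (\<Sum>a<N. \<Sum>b'<N. \<Sum>b<N. U $$ (i, a) * X a b * (Y b b' * cnj (U $$ (j, b'))))"
    by (intro sum.cong refl sum.swap)
  also have "\<dots> = conj_mat N (cmat_mult N X Y) U i j"
    by (simp add: conj_mat_def cmat_mult_def sum_distrib_left sum_distrib_right mult_ac)
  finally show ?thesis .
qed

lemma conj_mat_conj:
  assumes "V \<in> carrier_mat N N" "U \<in> carrier_mat N N" "i < N" "j < N"
  shows "conj_mat N B (V * U) i j = (\<Sum>a<N. \<Sum>b<N. V $$ (i, a) * conj_mat N B U a b * cnj (V $$ (j, b)))"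
proof -
  let ?f = "\<lambda>a b a' b'. V $$ (i, a) * U $$ (a, a') * B a' b' * cnj (V $$ (j, b) * U $$ (b, b'))"
  have "conj_mat N B (V * U) i j = (\<Sum>a'<N. \<Sum>b'<N. \<Sum>a<N. \<Sum>b<N. ?f a b a' b')"
    unfolding conj_mat_def
  proof (intro sum.cong refl)
    fix a' b' assume "a' \<in> {..<N}" "b' \<in> {..<N}"
    then show "(V * U) $$ (i, a') * B a' b' * cnj ((V * U) $$ (j, b')) = (\<Sum>a<N. \<Sum>b<N. ?f a b a' b')"
      using assms
      by (simp only: mult_index[OF assms(1,2)] lessThan_iff cnj_sum)
         (simp only: sum_distrib_right[of _ _ "B a' b'"] sum_product)
  qed
  also have "\<dots> = (\<Sum>a'<N. \<Sum>a<N. \<Sum>b'<N. \<Sum>b<N. ?f a b a' b')"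
    by (intro sum.cong refl sum.swap)
  also have "\<dots> = (\<Sum>a<N. \<Sum>a'<N. \<Sum>b'<N. \<Sum>b<N. ?f a b a' b')"
    by (rule sum.swap)
  also have "\<dots> = (\<Sum>a<N. \<Sum>a'<N. \<Sum>b<N. \<Sum>b'<N. ?f a b a' b')"
    by (intro sum.cong refl sum.swap)
  also have "\<dots> = (\<Sum>a<N. \<Sum>b<N. \<Sum>a'<N. \<Sum>b'<N. ?f a b a' b')"
    by (intro sum.cong refl sum.swap)
  also have "\<dots> = (\<Sum>a<N. \<Sum>b<N. V $$ (i, a) * conj_mat N B U a b * cnj (V $$ (j, b)))"
    by (simp add: conj_mat_def sum_distrib_left sum_distrib_right mult_ac)
  finally show ?thesis .
qed

lemma trace_eq_conj_mat:
  assumes "A \<in> carrier_mat N N" "B \<in> carrier_mat N N" "U \<in> carrier_mat N N"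
  shows "mat_trace (A * U * B * mat_adjoint U) =
    (\<Sum>i<N. \<Sum>j<N. A $$ (j, i) * conj_mat N (\<lambda>a b. B $$ (a, b)) U i j)"
proof -
  have aU: "mat_adjoint U \<in> carrier_mat N N" using assms by simp
  have UB1: "U * B \<in> carrier_mat N N" by (rule mult_carrier_mat[OF assms(3,2)])
  have UB: "U * B * mat_adjoint U \<in> carrier_mat N N" by (rule mult_carrier_mat[OF UB1 aU])
  have assoc: "A * U * B * mat_adjoint U = A * (U * B * mat_adjoint U)"
    using assoc_mult_mat[OF assms(1,3,2)] assoc_mult_mat[OF assms(1) UB1 aU] by simp
  have "(U * B * mat_adjoint U) $$ (i, j) = conj_mat N (\<lambda>a b. B $$ (a, b)) U i j" if "i < N" "j < N"
      for i j
  proof -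
    have "(U * B * mat_adjoint U) $$ (i, j) = (\<Sum>b<N. (\<Sum>a<N. U $$ (i, a) * B $$ (a, b))
        * cnj (U $$ (j, b)))"
      using that by (simp add: mult_index[OF UB1 aU] mult_index[OF assms(3,2)] adj_index[OF assms(3)])
    also have "\<dots> = (\<Sum>a<N. \<Sum>b<N. U $$ (i, a) * B $$ (a, b) * cnj (U $$ (j, b)))"
      by (subst sum.swap) (simp add: sum_distrib_right)
    finally show ?thesis by (simp add: conj_mat_def)
  qed
  then have "mat_trace (A * (U * B * mat_adjoint U)) = (\<Sum>j<N. \<Sum>i<N. A $$ (j, i)
      * conj_mat N (\<lambda>a b. B $$ (a, b)) U i j)"
    unfolding mat_trace_def using assms by (auto simp: mult_index[OF assms(1) UB] intro!: sum.cong)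
  then show ?thesis unfolding assoc by (subst sum.swap)
qed

section \<open>Invariance and integrability for Haar measure\<close>

section \<open>Haar measure\<close>

locale haar =
  fixes N :: nat and \<kappa> :: "complex mat measure"
  assumes haar: "normalized_haar N \<kappa>"
begin

sublocale prob_space \<kappa>
  using haar by (simp add: normalized_haar_def)

lemma sets_kappa: "sets \<kappa> = sets (unitary_borel N)"
  using haar by (simp add: normalized_haar_def)

lemma space_kappa: "space \<kappa> = unitary_mats N"
  using sets_eq_imp_space_eq[OF sets_kappa] by (simp add: unitary_borel_def)

lemma entry_measurable:
  assumes "i < N" "j < N"
  shows "(\<lambda>U. U $$ (i, j)) \<in> borel_measurable \<kappa>"
proof -
  let ?f = "\<lambda>U :: complex mat. \<lambda>(i, j). if i < N \<and> j < N then U $$ (i, j) else 0"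
  have "?f \<in> measurable (unitary_borel N) borel"
    unfolding unitary_borel_def by (rule measurable_vimage_algebra1) simp
  then have "?f \<in> measurable \<kappa> borel"
    using measurable_cong_sets[OF sets_kappa refl] by blast
  from measurable_product_then_coordinatewise[OF this, of "(i, j)"]
  show ?thesis using assms by simp
qed

lemma mult_measurable:
  assumes V: "V \<in> unitary_mats N"
  shows "(\<lambda>U. V * U) \<in> measurable \<kappa> \<kappa>"
proof -
  let ?f = "\<lambda>U :: complex mat. \<lambda>(i, j). if i < N \<and> j < N then U $$ (i, j) else 0"
  have "(\<lambda>U. V * U) \<in> measurable \<kappa> (unitary_borel N)"
    unfolding unitary_borel_def
  proof (rule measurable_vimage_algebra2)
    show "(\<lambda>U. V * U) \<in> space \<kappa> \<rightarrow> unitary_mats N"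
      unfolding space_kappa using unitary_mult[OF _ V] by auto
    show "(\<lambda>U. ?f (V * U)) \<in> measurable \<kappa> borel"
    proof (rule measurable_coordinatewise_then_product)
      fix ij :: "nat \<times> nat"
      obtain i j where ij: "ij = (i, j)" by (cases ij)
      show "(\<lambda>U. ?f (V * U) ij) \<in> borel_measurable \<kappa>"
      proof (cases "i < N \<and> j < N")
        case True
        have "(\<lambda>U. \<Sum>a<N. V $$ (i, a) * U $$ (a, j)) \<in> borel_measurable \<kappa>"
          using True entry_measurable by (intro borel_measurable_sum borel_measurable_times) auto
        moreover have "?f (V * U) ij = (\<Sum>a<N. V $$ (i, a) * U $$ (a, j))" if "U \<in> space \<kappa>" for U
          using True mult_index[OF unitary_carrier[OF V] unitary_carrier, of U i j] that
          by (simp add: ij space_kappa)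
        ultimately show ?thesis by (subst measurable_cong) auto
      qed (auto simp: ij)
    qed
  qed
  then show ?thesis using measurable_cong_sets[OF refl sets_kappa] by blast
qed

text \<open>The invariance in \<open>normalized_haar\<close> speaks of images of sets. A preimage
  under multiplication by \<open>V\<close> is an image under multiplication by its adjoint, which is
  unitary as well, so the push-forward is invariant too.\<close>

lemma distr_mult:
  assumes V: "V \<in> unitary_mats N"
  shows "distr \<kappa> \<kappa> (\<lambda>U. V * U) = \<kappa>"
proof (rule measure_eqI)
  fix X assume "X \<in> sets (distr \<kappa> \<kappa> (\<lambda>U. V * U))"
  then have X: "X \<in> sets \<kappa>" by simp
  let ?W = "mat_adjoint V"
  have W: "?W \<in> unitary_mats N" by (rule unitary_adjoint[OF V])
  have cV: "V \<in> carrier_mat N N" and cW: "?W \<in> carrier_mat N N"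
    using V W unitary_carrier by auto
  have VW: "V * ?W = 1\<^sub>m N" "?W * V = 1\<^sub>m N" using V by (auto simp: unitary_mats_def)
  have c1: "V * (?W * U) = U" "?W * (V * U) = U" if "U \<in> carrier_mat N N" for U
    using assoc_mult_mat[OF cV cW that] assoc_mult_mat[OF cW cV that] VW left_mult_one_mat[OF that]
        by simp_all
  have XU: "U \<in> unitary_mats N" if "U \<in> X" for U
    using sets.sets_into_space[OF X] that space_kappa by auto
  have "(\<lambda>U. V * U) -` X \<inter> space \<kappa> = (\<lambda>U. ?W * U) ` X"
  proof (intro Set.equalityI subsetI)
    fix U assume "U \<in> (\<lambda>U. V * U) -` X \<inter> space \<kappa>"
    then have "V * U \<in> X" "U = ?W * (V * U)"
      using c1 unitary_carrier by (auto simp: space_kappa)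
    then show "U \<in> (\<lambda>U. ?W * U) ` X" by blast
  next
    fix U assume "U \<in> (\<lambda>U. ?W * U) ` X"
    then obtain Y where Y: "Y \<in> X" "U = ?W * Y" by auto
    then show "U \<in> (\<lambda>U. V * U) -` X \<inter> space \<kappa>"
      using c1 unitary_carrier[OF XU[OF Y(1)]] unitary_mult[OF XU[OF Y(1)] W]
          by (auto simp: space_kappa)
  qed
  then have "emeasure (distr \<kappa> \<kappa> (\<lambda>U. V * U)) X = emeasure \<kappa> ((\<lambda>U. ?W * U) ` X)"
    using X by (simp add: emeasure_distr[OF mult_measurable[OF V]])
  also have "\<dots> = emeasure \<kappa> X"
    using haar W X unfolding normalized_haar_def by blast
  finally show "emeasure (distr \<kappa> \<kappa> (\<lambda>U. V * U)) X = emeasure \<kappa> X" .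
qed simp

text \<open>A class of integrable functions closed under finite sums, products and conjugation.
  Integrability then follows from the shape of an expression.\<close>

definition bdd_meas :: "(complex mat \<Rightarrow> complex) \<Rightarrow> bool" where
  "bdd_meas f \<longleftrightarrow> f \<in> borel_measurable \<kappa> \<and> (\<exists>K. \<forall>U\<in>space \<kappa>. norm (f U) \<le> K)"

lemma bdd_meas_integrable: "bdd_meas f \<Longrightarrow> integrable \<kappa> f"
  unfolding bdd_meas_def by (auto intro!: integrable_const_bound AE_I2)

lemma bdd_meas_const: "bdd_meas (\<lambda>_. c)"
  unfolding bdd_meas_def by (auto intro: exI[of _ "norm c"])

lemma bdd_meas_add: "bdd_meas f \<Longrightarrow> bdd_meas g \<Longrightarrow> bdd_meas (\<lambda>U. f U + g U)"
  unfolding bdd_meas_def by (auto intro!: borel_measurable_add) (meson norm_add_rule_thm)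

lemma bdd_meas_mult:
  assumes "bdd_meas f" "bdd_meas g"
  shows "bdd_meas (\<lambda>U. f U * g U)"
proof -
  obtain K tensor_trace where K: "\<And>U. U \<in> space \<kappa> \<Longrightarrow> norm (f U) \<le> K" and tensor_trace: "\<And>U. U \<in> space \<kappa>
      \<Longrightarrow> norm (g U) \<le> tensor_trace"
    using assms unfolding bdd_meas_def by metis
  have "norm (f U * g U) \<le> \<bar>K\<bar> * \<bar>tensor_trace\<bar>" if "U \<in> space \<kappa>" for U
    using K[OF that] tensor_trace[OF that] unfolding norm_mult by (intro mult_mono) auto
  then show ?thesis using assms unfolding bdd_meas_def by (auto intro!: borel_measurable_times)
qed

lemma bdd_meas_uminus: "bdd_meas f \<Longrightarrow> bdd_meas (\<lambda>U. - f U)"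
  using bdd_meas_mult[OF bdd_meas_const[of "-1"]] by simp

lemma bdd_meas_diff: "bdd_meas f \<Longrightarrow> bdd_meas g \<Longrightarrow> bdd_meas (\<lambda>U. f U - g U)"
  using bdd_meas_add[OF _ bdd_meas_uminus] by simp

lemma bdd_meas_sum: "(\<And>x. x \<in> X \<Longrightarrow> bdd_meas (f x)) \<Longrightarrow> bdd_meas (\<lambda>U. \<Sum>x\<in>X. f x U)"
  by (induction X rule: infinite_finite_induct) (auto intro: bdd_meas_const bdd_meas_add)

lemma bdd_meas_prod: "(\<And>x. x \<in> X \<Longrightarrow> bdd_meas (f x)) \<Longrightarrow> bdd_meas (\<lambda>U. \<Prod>x\<in>X. f x U)"
  by (induction X rule: infinite_finite_induct) (auto intro: bdd_meas_const bdd_meas_mult)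

lemma bdd_meas_entry: "i < N \<Longrightarrow> j < N \<Longrightarrow> bdd_meas (\<lambda>U. U $$ (i, j))"
  unfolding bdd_meas_def using entry_measurable unitary_entry_le_1
      by (auto simp: space_kappa intro!: exI[of _ 1])

lemma bdd_meas_cnj: "bdd_meas f \<Longrightarrow> bdd_meas (\<lambda>U. cnj (f U))"
  unfolding bdd_meas_def by (auto intro!: borel_measurable_continuous_on[of cnj] continuous_intros)

lemma bdd_meas_conj_mat: "i < N \<Longrightarrow> j < N \<Longrightarrow> bdd_meas (\<lambda>U. conj_mat N B U i j)"
  unfolding conj_mat_def by (intro bdd_meas_sum bdd_meas_mult bdd_meas_entry bdd_meas_const
      bdd_meas_cnj) auto

lemma haar_invariant:
  assumes V: "V \<in> unitary_mats N" and f: "bdd_meas f"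
  shows "(LINT U|\<kappa>. f (V * U)) = (LINT U|\<kappa>. f U)"
proof -
  have "(LINT U|\<kappa>. f U) = (LINT U|distr \<kappa> \<kappa> (\<lambda>U. V * U). f U)" by (simp add: distr_mult[OF V])
  also have "\<dots> = (LINT U|\<kappa>. f (V * U))"
    using f by (intro integral_distr mult_measurable V) (auto simp: bdd_meas_def)
  finally show ?thesis by simp
qed

text \<open>The parameter \<open>t\<close> sits only in finitely many scalar coefficients, so
  differentiating under the integral sign reduces to linearity of the integral.\<close>

lemma deriv_integral_zero:
  fixes c :: "'g \<Rightarrow> real \<Rightarrow> complex"
  assumes G: "finite G" and Y: "\<And>g. g \<in> G \<Longrightarrow> bdd_meas (Y g)"
    and c: "\<And>g. g \<in> G \<Longrightarrow> (c g has_vector_derivative c' g) (at 0)"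
    and const: "\<And>t. (LINT U|\<kappa>. (\<Sum>g\<in>G. c g t * Y g U)) = K"
    and D: "\<And>U. U \<in> space \<kappa> \<Longrightarrow> ((\<lambda>t. \<Sum>g\<in>G. c g t * Y g U) has_vector_derivative D U) (at 0)"
  shows "(LINT U|\<kappa>. D U) = 0"
proof -
  have DU: "D U = (\<Sum>g\<in>G. c' g * Y g U)" if "U \<in> space \<kappa>" for U
  proof -
    have "((\<lambda>t. \<Sum>g\<in>G. c g t * Y g U) has_vector_derivative (\<Sum>g\<in>G. c' g * Y g U)) (at 0)"
      by (intro has_vector_derivative_sum has_vector_derivative_mult_left c)
    from vector_derivative_unique_at[OF D[OF that] this] show ?thesis .
  qed
  have int: "(LINT U|\<kappa>. (\<Sum>g\<in>G. a g * Y g U)) = (\<Sum>g\<in>G. a g * (LINT U|\<kappa>. Y g U))" for a :: "'g \<Rightarrow> complex"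
    using Y by (subst Bochner_Integration.integral_sum) (auto intro: bdd_meas_integrable)
  have "((\<lambda>t. \<Sum>g\<in>G. c g t * (LINT U|\<kappa>. Y g U)) has_vector_derivative (\<Sum>g\<in>G. c' g
      * (LINT U|\<kappa>. Y g U))) (at 0)"
    by (intro has_vector_derivative_sum has_vector_derivative_mult_left c)
  moreover have "((\<lambda>t. \<Sum>g\<in>G. c g t * (LINT U|\<kappa>. Y g U)) has_vector_derivative 0) (at 0)"
    using const unfolding int by simp
  ultimately have "(\<Sum>g\<in>G. c' g * (LINT U|\<kappa>. Y g U)) = 0"
    by (rule vector_derivative_unique_at)
  moreover have "(LINT U|\<kappa>. D U) = (LINT U|\<kappa>. (\<Sum>g\<in>G. c' g * Y g U))"
    by (rule Bochner_Integration.integral_cong) (use DU in auto)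
  ultimately show ?thesis using int[of c'] by simp
qed

end

section \<open>Infinitesimal invariance, from phase rotations to all matrix directions\<close>

text \<open>If \<open>P\<close> is an orthogonal projection and \<open>1 + z\<close> has modulus one, then this matrix is
  unitary. It multiplies the range of \<open>P\<close> by the phase \<open>1 + z\<close>.\<close>

definition phase_rotation :: "nat \<Rightarrow> cmat \<Rightarrow> complex \<Rightarrow> complex mat" where
  "phase_rotation N P z = mat N N (\<lambda>(i, j). cmat_id i j + z * P i j)"

definition orth_proj :: "nat \<Rightarrow> cmat \<Rightarrow> bool" where
  "orth_proj N P \<longleftrightarrow> (\<forall>i<N. \<forall>j<N. P j i = cnj (P i j) \<and> cmat_mult N P P i j = P i j)"

lemma cmat_id_sym: "cmat_id i j = cmat_id j i"
  by (simp add: cmat_id_def eq_commute)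

lemma sum_cmat_id:
  assumes "i < N"
  shows "(\<Sum>a<N. cmat_id i a * f a) = f i" "(\<Sum>a<N. f a * cmat_id a i) = f i"
        "(\<Sum>a<N. cmat_id a i * f a) = f i" "(\<Sum>a<N. f a * cmat_id i a) = f i"
proof -
  have "(\<Sum>a<N. cmat_id i a * f a) = (\<Sum>a<N. if i = a then f a else 0)"
      by (intro sum.cong) (auto simp: cmat_id_def)
  also have "\<dots> = f i" using assms by simp
  finally show 1: "(\<Sum>a<N. cmat_id i a * f a) = f i" .
  show 2: "(\<Sum>a<N. cmat_id a i * f a) = f i" using 1 by (subst cmat_id_sym)
  show "(\<Sum>a<N. f a * cmat_id i a) = f i" using 1 by (subst mult.commute)
  show "(\<Sum>a<N. f a * cmat_id a i) = f i" using 2 by (subst mult.commute)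
qed

text \<open>Idempotence gives (1 + w P)(1 + w' P) = 1 + (w + w' + w w') P. The hypothesis on
  \<open>z\<close> says that 1 + z has modulus one, which makes the product with the adjoint
  trivial.\<close>

lemma phase_rotation_unitary:
  assumes P: "orth_proj N P" and z: "z + cnj z + z * cnj z = 0"
  shows "phase_rotation N P z \<in> unitary_mats N"
proof -
  have car: "phase_rotation N P w \<in> carrier_mat N N" for w by (simp add: phase_rotation_def)
  have ent: "phase_rotation N P w $$ (i, j) = cmat_id i j + w * P i j" if "i < N" "j < N" for i j w
    using that by (simp add: phase_rotation_def)
  have adj: "mat_adjoint (phase_rotation N P w) = phase_rotation N P (cnj w)" for w
  proof (rule eq_matI)
    fix i j assume "i < dim_row (phase_rotation N P (cnj w))" "j < dim_col (phase_rotation N P (cnj w))"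
    then have ij: "i < N" "j < N" by (simp_all add: phase_rotation_def)
    then show "mat_adjoint (phase_rotation N P w) $$ (i, j) = phase_rotation N P (cnj w) $$ (i, j)"
    proof -
      have "cnj (P j i) = P i j" using P ij by (metis orth_proj_def)
      then show ?thesis
        unfolding adj_index[OF car ij] ent[OF ij] ent[OF ij(2,1)] by (simp add: cmat_id_def)
    qed
  qed (use carrier_matD[OF adj_carrier[OF car]] in \<open>auto simp: phase_rotation_def\<close>)
  have mult: "phase_rotation N P w * phase_rotation N P w' = phase_rotation N P (w + w' + w * w')"
      for w w'
  proof (rule eq_matI)
    fix i j assume "i < dim_row (phase_rotation N P (w + w' + w
        * w'))" "j < dim_col (phase_rotation N P (w + w' + w * w'))"
    then have ij: "i < N" "j < N" by (simp_all add: phase_rotation_def)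
    have "(phase_rotation N P w * phase_rotation N P w') $$ (i, j) = (\<Sum>a<N. (cmat_id i a + w * P i a)
        * (cmat_id a j + w' * P a j))"
      unfolding mult_index[OF car car ij] using ij by (intro sum.cong refl) (simp add: ent)
    also have "\<dots> = (\<Sum>a<N. cmat_id i a * cmat_id a j) + w' * (\<Sum>a<N. cmat_id i a * P a j) +
       w * (\<Sum>a<N. P i a * cmat_id a j) + w * w' * (\<Sum>a<N. P i a * P a j)"
      by (simp add: algebra_simps sum.distrib sum_distrib_left)
    also have "\<dots> = cmat_id i j + (w + w' + w * w') * P i j"
    proof -
      have PP: "(\<Sum>a<N. P i a * P a j) = P i j" using P ij
          by (metis (no_types) orth_proj_def cmat_mult_def)
      show ?thesis
        by (simp only: PP sum_cmat_id(1)[OF ij(1)] sum_cmat_id(2)[OF ij(2)]) (simp add: algebra_simps)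
    qed
    finally show "(phase_rotation N P w * phase_rotation N P w') $$ (i, j) = phase_rotation N P (w + w'
        + w * w') $$ (i, j)"
      using ij by (simp add: ent)
  qed (simp_all add: phase_rotation_def)
  have "phase_rotation N P 0 = 1\<^sub>m N" by (rule eq_matI) (auto simp: phase_rotation_def cmat_id_def)
  then show ?thesis
    using car z unfolding unitary_mats_def adj mult by (simp add: adj mult algebra_simps)
qed

lemma has_vector_derivative_prod:
  fixes f :: "'k \<Rightarrow> real \<Rightarrow> complex"
  assumes "\<And>k. k \<in> S \<Longrightarrow> (f k has_vector_derivative f' k) (at x)"
  shows "((\<lambda>t. \<Prod>k\<in>S. f k t) has_vector_derivative (\<Sum>k\<in>S. f' k * (\<Prod>l\<in>S-{k}. f l x))) (at x)"
proof -
  have "((\<lambda>t. \<Prod>k\<in>S. f k t) has_derivative (\<lambda>y. \<Sum>k\<in>S. (y *\<^sub>R f' k) * (\<Prod>l\<in>S-{k}. f l x))) (at x)"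
    by (rule has_derivative_prod) (use assms in \<open>simp add: has_vector_derivative_def\<close>)
  then show ?thesis by (simp add: has_vector_derivative_def scaleR_sum_right)
qed

text \<open>Polarization with v = e_a + w e_b. Adding the identities for the fourth roots of unity
  w, each multiplied by w, leaves 4 F_ab, since the sums of w and of w^2 vanish. The computation
  covers a = b as well.\<close>

lemma hermitian_form_zero:
  fixes F :: "nat \<Rightarrow> nat \<Rightarrow> complex" and N a b :: nat
  assumes H: "\<And>v. (\<Sum>p<N. \<Sum>q<N. v p * cnj (v q) * F p q) = 0" and ab: "a < N" "b < N"
  shows "F a b = (0 :: complex)"
proof -
  have *: "F a a + cnj w * F a b + w * F b a + w * cnj w * F b b = 0" for w
  proof -
    let ?v = "\<lambda>p. cmat_id a p + w * cmat_id b p"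
    have cm: "cnj (cmat_id x y) = cmat_id x y" for x y by (simp add: cmat_id_def)
    have "(\<Sum>p<N. \<Sum>q<N. ?v p * cnj (?v q) * F p q) =
      (\<Sum>p<N. ?v p * ((\<Sum>q<N. cmat_id a q * F p q) + cnj w * (\<Sum>q<N. cmat_id b q * F p q)))"
      by (simp add: cm sum_distrib_left sum.distrib distrib_left distrib_right mult_ac)
    also have "\<dots> = (\<Sum>p<N. ?v p * (F p a + cnj w * F p b))"
      by (simp only: sum_cmat_id(1)[OF ab(1)] sum_cmat_id(1)[OF ab(2)])
    also have "\<dots> = (\<Sum>p<N. cmat_id a p * (F p a + cnj w * F p b)) + w * (\<Sum>p<N. cmat_id b p * (F p a
        + cnj w * F p b))"
      by (simp only: sum_distrib_left sum.distrib distrib_right mult.assoc)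
    also have "\<dots> = F a a + cnj w * F a b + w * F b a + w * cnj w * F b b"
      by (simp only: sum_cmat_id(1)[OF ab(1)] sum_cmat_id(1)[OF ab(2)]) (simp add: algebra_simps)
    finally show ?thesis unfolding H[of ?v] by (rule sym)
  qed
  have "4 * F a b = 0"
    using *[of 1] *[of "-1"] *[of \<i>] *[of "-\<i>"] by (simp add: complex_eq_iff)
  then show ?thesis by simp
qed

context haar
begin

text \<open>The derivative of the product of the entries when the elementary matrix E_pq acts by a
  commutator on one site after another, as in the Leibniz rule.\<close>

definition lie_term :: "nat set \<Rightarrow> (nat \<Rightarrow> cmat) \<Rightarrow> (nat \<Rightarrow> nat) \<Rightarrow> (nat \<Rightarrow> nat) \<Rightarrow> nat \<Rightarrow> nat \<Rightarrow> complex mat \<Rightarrow>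
    complex" where
  "lie_term S B i j p q U = (\<Sum>k\<in>S. (cmat_id (i k) p * conj_mat N (B k) U q (j k)
      - conj_mat N (B k) U (i k) p * cmat_id q (j k)) *
      (\<Prod>l\<in>S-{k}. conj_mat N (B l) U (i l) (j l)))"

lemma bdd_meas_lie_term:
  assumes "i \<in> idx N S" "j \<in> idx N S" "p < N" "q < N"
  shows "bdd_meas (lie_term S B i j p q)"
  unfolding lie_term_def using assms
  by (intro bdd_meas_sum bdd_meas_mult bdd_meas_diff bdd_meas_const bdd_meas_prod bdd_meas_conj_mat)
      (auto simp: PiE_iff)

text \<open>The derivative at t = 0 of left invariance under the rotations of the range of
  \<open>P\<close> by the phase e^(it). The generator is i P, whence the factor \<open>\<i>\<close>
  that is divided out at the end.\<close>

lemma lie_term_orth_proj: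
  assumes S: "finite S" and ij: "i \<in> idx N S" "j \<in> idx N S" and P: "orth_proj N P"
  shows "(\<Sum>p<N. \<Sum>q<N. P p q * (LINT U|\<kappa>. lie_term S B i j p q U)) = 0"
proof -
  have iN: "i k < N" and jN: "j k < N" if "k \<in> S" for k using ij that by (auto simp: PiE_iff)
  \<comment> \<open>With z = e^(it) - 1, each site carries (1 + z P) M (1 + cnj z P), which has four
    terms with coefficients 1, z, cnj z and z cnj z. The index \<open>c\<close> enumerates them,
    \<open>Y\<close> holds the matrix parts, and \<open>q'\<close> the derivatives at 0; the last
    one vanishes because both of its factors do.\<close>
  define q where "q = (\<lambda>c t. let z = cis t - 1 in if c = (0::nat) then 1 else if c = 1 then z else if c
      = 2 then cnj z else z * cnj z)"
  define q' where "q' = (\<lambda>c. if c = (1::nat) then \<i> else if c = 2 then - \<i> else 0)"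
  define Y where "Y = (\<lambda>k c U. if c = (0::nat) then conj_mat N (B k) U (i k) (j k)
      else if c = 1 then (\<Sum>a<N. P (i k) a * conj_mat N (B k) U a (j k))
      else if c = 2 then (\<Sum>b<N. conj_mat N (B k) U (i k) b * P b (j k))
      else (\<Sum>a<N. \<Sum>b<N. P (i k) a * conj_mat N (B k) U a b * P b (j k)))"
  have goodY: "bdd_meas (Y k c)" if "k \<in> S" for k c
    unfolding Y_def using iN[OF that] jN[OF that]
    by (cases "c = 0"; cases "c = 1"; cases "c
        = 2") (auto intro!: bdd_meas_sum bdd_meas_mult bdd_meas_const bdd_meas_conj_mat)
  have q0: "q c 0 = (if c = 0 then 1 else 0)" for c by (simp add: q_def)
  have dz: "((\<lambda>t. cis t - 1) has_vector_derivative \<i>) (at 0)"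
    using has_derivative_diff[OF has_derivative_cis[OF has_derivative_ident, of 0 UNIV]
        has_derivative_const[of 1]]
    by (simp add: has_vector_derivative_def)
  have dcz: "((\<lambda>t. cnj (cis t - 1)) has_vector_derivative (- \<i>)) (at 0)"
    using has_vector_derivative_cnj[OF dz] by simp
  have dq: "(q c has_vector_derivative q' c) (at 0)" for c
  proof -
    consider (1) "c = 0" | (2) "c = 1" | (3) "c = 2" | (4) "c \<noteq> 0" "c \<noteq> 1" "c \<noteq> 2" by auto
    then show ?thesis
    proof cases
      case 4
      have "((\<lambda>t. (cis t - 1) * cnj (cis t - 1)) has_vector_derivative ((cis 0 - 1) * (- \<i>) + \<i>
          * cnj (cis 0 - 1))) (at 0)"
        by (rule has_vector_derivative_mult[OF dz dcz])
      then show ?thesis using 4 by (simp add: q_def q'_def Let_def)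
    qed (use dz dcz in \<open>auto simp: q_def q'_def Let_def\<close>)
  qed
  have rot: "conj_mat N (B k) (phase_rotation N P (cis t - 1) * U) (i k) (j k) = (\<Sum>c<4. q c t
      * Y k c U)"
    if k: "k \<in> S" and U: "U \<in> unitary_mats N" for k t U
  proof -
    let ?z = "cis t - 1" and ?M = "conj_mat N (B k) U"
    let ?R = "phase_rotation N P ?z"
    have ent: "?R $$ (x, y) = cmat_id x y + ?z * P x y" if "x < N" "y < N" for x y
      using that by (simp add: phase_rotation_def)
    have cP: "cnj (P (j k) b) = P b (j k)" if "b < N" for b
      using P that jN[OF k] by (metis orth_proj_def)
    have "conj_mat N (B k) (?R * U) (i k) (j k) = (\<Sum>a<N. \<Sum>b<N. ?R $$ (i k, a) * ?M a b
        * cnj (?R $$ (j k, b)))"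
      by (rule conj_mat_conj) (use iN jN k U unitary_carrier in \<open>auto simp: phase_rotation_def\<close>)
    also have "\<dots> = (\<Sum>a<N. \<Sum>b<N. (cmat_id (i k) a + ?z * P (i k) a) * ?M a b * (cmat_id (j k) b + cnj ?z
        * P b (j k)))"
    proof (intro sum.cong refl)
      fix a b assume "a \<in> {..<N}" "b \<in> {..<N}"
      then have ab: "a < N" "b < N" by auto
      show "?R $$ (i k, a) * ?M a b * cnj (?R $$ (j k, b)) =
        (cmat_id (i k) a + ?z * P (i k) a) * ?M a b * (cmat_id (j k) b + cnj ?z * P b (j k))"
        unfolding ent[OF iN[OF k] ab(1)] ent[OF jN[OF k] ab(2)] by (simp add: cP[OF ab(2)] cmat_id_def)
    qed
    also have "\<dots> = (\<Sum>a<N. (cmat_id (i k) a + ?z * P (i k) a) * (?M a (j k) + cnj ?z * (\<Sum>b<N. ?M a b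
        * P b (j k))))"
    proof (intro sum.cong refl)
      fix a
      have "(\<Sum>b<N. (cmat_id (i k) a + ?z * P (i k) a) * ?M a b * (cmat_id (j k) b + cnj ?z
          * P b (j k))) =
        (cmat_id (i k) a + ?z * P (i k) a) * ((\<Sum>b<N. ?M a b * cmat_id (j k) b) + cnj ?z * (\<Sum>b<N. ?M a b
            * P b (j k)))"
        by (simp add: sum_distrib_left sum.distrib distrib_left mult_ac)
      then show "(\<Sum>b<N. (cmat_id (i k) a + ?z * P (i k) a) * ?M a b * (cmat_id (j k) b + cnj ?z
          * P b (j k))) =
         (cmat_id (i k) a + ?z * P (i k) a) * (?M a (j k) + cnj ?z * (\<Sum>b<N. ?M a b * P b (j k)))"
        by (simp only: sum_cmat_id(4)[OF jN[OF k]])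
    qed
    also have "\<dots> = (\<Sum>a<N. cmat_id (i k) a * (?M a (j k) + cnj ?z * (\<Sum>b<N. ?M a b * P b (j k)))) +
       ?z * (\<Sum>a<N. P (i k) a * ?M a (j k)) + ?z * cnj ?z * (\<Sum>a<N. \<Sum>b<N. P (i k) a * ?M a b * P b (j k))"
      by (simp add: sum_distrib_left sum.distrib distrib_left distrib_right mult_ac del:
          complex_cnj_diff)
    also have "\<dots> = (\<Sum>c<4. q c t * Y k c U)"
      by (simp only: sum_cmat_id(1)[OF iN[OF k]]) (simp add: eval_nat_numeral q_def Y_def Let_def)
    finally show ?thesis .
  qed
  \<comment> \<open>An element of \<open>?G\<close> selects one of the four terms at each site. This
    gives the finite expansion required by \<open>deriv_integral_zero\<close>.\<close>
  let ?G = "PiE S (\<lambda>_. {..<4::nat})"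
  have expand: "(\<Prod>k\<in>S. \<Sum>c<4. q c t * Y k c U) = (\<Sum>g\<in>?G. (\<Prod>k\<in>S. q (g k) t) * (\<Prod>k\<in>S. Y k (g k) U))"
      for t U
    using S by (simp add: prod_sum_PiE prod.distrib)
  define D where "D = (\<lambda>U. \<Sum>k\<in>S. (\<Sum>c<4. q' c * Y k c U) * (\<Prod>l\<in>S-{k}. \<Sum>c<4. q c 0 * Y l c U))"
  have "(LINT U|\<kappa>. D U) = 0"
  proof (rule deriv_integral_zero[where G = ?G and c = "\<lambda>g t. \<Prod>k\<in>S. q (g k) t" and Y
      = "\<lambda>g U. \<Prod>k\<in>S. Y k (g k) U"
        and c' = "\<lambda>g. \<Sum>k\<in>S. q' (g k) * (\<Prod>l\<in>S-{k}. q (g l) 0)"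
        and K = "LINT U|\<kappa>. (\<Prod>k\<in>S. conj_mat N (B k) U (i k) (j k))"])
    show "finite ?G" using S by (intro finite_PiE) auto
    show "bdd_meas (\<lambda>U. \<Prod>k\<in>S. Y k (g k) U)" for g by (intro bdd_meas_prod goodY)
    show "((\<lambda>t. \<Prod>k\<in>S. q (g k) t) has_vector_derivative (\<Sum>k\<in>S. q' (g k) * (\<Prod>l\<in>S-{k}. q (g l) 0))) (at 0)"
        for g
      by (intro has_vector_derivative_prod dq)
    fix t :: real
    have V: "phase_rotation N P (cis t - 1) \<in> unitary_mats N"
      by (rule phase_rotation_unitary[OF P]) (simp add: algebra_simps cis_cnj cis_mult)
    have "bdd_meas (\<lambda>U. \<Prod>k\<in>S. conj_mat N (B k) U (i k) (j k))"
        by (intro bdd_meas_prod bdd_meas_conj_mat iN jN)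
    from haar_invariant[OF V this]
    have "(LINT U|\<kappa>. (\<Prod>k\<in>S. conj_mat N (B k) U (i k) (j k))) =
       (LINT U|\<kappa>. (\<Prod>k\<in>S. conj_mat N (B k) (phase_rotation N P (cis t - 1) * U) (i k) (j k)))" by simp
    also have "\<dots> = (LINT U|\<kappa>. (\<Sum>g\<in>?G. (\<Prod>k\<in>S. q (g k) t) * (\<Prod>k\<in>S. Y k (g k) U)))"
      unfolding expand[symmetric]
      by (intro Bochner_Integration.integral_cong refl prod.cong rot) (auto simp: space_kappa)
    finally show "(LINT U|\<kappa>. (\<Sum>g\<in>?G. (\<Prod>k\<in>S. q (g k) t) * (\<Prod>k\<in>S. Y k (g k) U))) =
       (LINT U|\<kappa>. (\<Prod>k\<in>S. conj_mat N (B k) U (i k) (j k)))" ..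
  next
    fix U
    show "((\<lambda>t. \<Sum>g\<in>?G. (\<Prod>k\<in>S. q (g k) t) * (\<Prod>k\<in>S. Y k (g k) U)) has_vector_derivative D U) (at 0)"
      unfolding expand[symmetric] D_def
      by (intro has_vector_derivative_prod has_vector_derivative_sum has_vector_derivative_mult_left dq)
  qed
  moreover have "D U = \<i> * (\<Sum>p<N. \<Sum>q<N. P p q * lie_term S B i j p q U)" for U
  proof -
    let ?R = "\<lambda>k. \<Prod>l\<in>S-{k}. conj_mat N (B l) U (i l) (j l)"
    have "(\<Sum>p<N. \<Sum>q<N. P p q * lie_term S B i j p q U) = (\<Sum>p<N. \<Sum>k\<in>S. \<Sum>q<N.
       P p q * ((cmat_id (i k) p * conj_mat N (B k) U q (j k) - conj_mat N (B k) U (i k) p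
           * cmat_id q (j k)) * ?R k))"
      unfolding lie_term_def sum_distrib_left by (intro sum.cong refl sum.swap)
    also have "\<dots> = (\<Sum>k\<in>S. \<Sum>p<N. \<Sum>q<N.
       P p q * ((cmat_id (i k) p * conj_mat N (B k) U q (j k) - conj_mat N (B k) U (i k) p
           * cmat_id q (j k)) * ?R k))"
      by (rule sum.swap)
    also have "\<dots> = (\<Sum>k\<in>S. (Y k 1 U - Y k 2 U) * ?R k)"
    proof (intro sum.cong refl)
      fix k assume k: "k \<in> S"
      have "(\<Sum>p<N. \<Sum>q<N. P p q * ((cmat_id (i k) p * conj_mat N (B k) U q (j k)
          - conj_mat N (B k) U (i k) p * cmat_id q (j k)) * ?R k)) =
        ((\<Sum>p<N. cmat_id (i k) p * (\<Sum>q<N. P p q * conj_mat N (B k) U q (j k))) -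
         (\<Sum>p<N. conj_mat N (B k) U (i k) p * (\<Sum>q<N. P p q * cmat_id q (j k)))) * ?R k"
        by (simp add: sum_distrib_left sum_distrib_right left_diff_distrib right_diff_distrib
            sum_subtractf mult_ac)
      also have "\<dots> = (Y k 1 U - Y k 2 U) * ?R k"
        by (simp only: sum_cmat_id(1)[OF iN[OF k]] sum_cmat_id(2)[OF jN[OF k]]) (simp add: Y_def)
      finally show "(\<Sum>p<N. \<Sum>q<N. P p q * ((cmat_id (i k) p * conj_mat N (B k) U q (j k)
          - conj_mat N (B k) U (i k) p * cmat_id q (j k)) * ?R k)) =
        (Y k 1 U - Y k 2 U) * ?R k" .
    qed
    finally have "\<i> * (\<Sum>p<N. \<Sum>q<N. P p q * lie_term S B i j p q U) = (\<Sum>k\<in>S. \<i> * (Y k 1 U - Y k 2 U)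
        * ?R k)"
      by (simp add: sum_distrib_left mult.assoc)
    moreover have "(\<Sum>c<4. q c 0 * Y l c U) = conj_mat N (B l) U (i l) (j l)" for l
      unfolding q0 by (simp add: eval_nat_numeral Y_def)
    moreover have "(\<Sum>c<4. q' c * Y k c U) = \<i> * (Y k 1 U - Y k 2 U)" for k
      by (simp add: eval_nat_numeral q'_def algebra_simps)
    ultimately show ?thesis unfolding D_def by simp
  qed
  ultimately have "\<i> * (LINT U|\<kappa>. (\<Sum>p<N. \<Sum>q<N. P p q * lie_term S B i j p q U)) = 0" by simp
  moreover have "(LINT U|\<kappa>. (\<Sum>p<N. \<Sum>q<N. P p q * lie_term S B i j p q U)) =
     (\<Sum>p<N. LINT U|\<kappa>. (\<Sum>q<N. P p q * lie_term S B i j p q U))"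
    using ij by (intro Bochner_Integration.integral_sum bdd_meas_integrable bdd_meas_sum bdd_meas_mult
        bdd_meas_const bdd_meas_lie_term) auto
  moreover have "(LINT U|\<kappa>. (\<Sum>q<N. P p q * lie_term S B i j p q U)) = (\<Sum>q<N. P p q
      * (LINT U|\<kappa>. lie_term S B i j p q U))"
    if "p < N" for p
  proof -
    have "(LINT U|\<kappa>. (\<Sum>q<N. P p q * lie_term S B i j p q U)) = (\<Sum>q<N. LINT U|\<kappa>. P p q
        * lie_term S B i j p q U)"
      using ij that by (intro Bochner_Integration.integral_sum bdd_meas_integrable bdd_meas_mult
          bdd_meas_const bdd_meas_lie_term) auto
    then show ?thesis by simp
  qed
  ultimately show ?thesis by simp
qed

text \<open>Projections onto lines show that a Hermitian form vanishes on every vector, and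
  polarization then isolates its entries. Directions such as E_ab, which generate no unitary
  matrices, are reached in this way.\<close>

lemma lie_term_zero:
  assumes S: "finite S" and ij: "i \<in> idx N S" "j \<in> idx N S" and ab: "a < N" "b < N"
  shows "(LINT U|\<kappa>. lie_term S B i j a b U) = 0"
proof (rule hermitian_form_zero[OF _ ab])
  fix v :: "nat \<Rightarrow> complex"
  let ?F = "\<lambda>p q. LINT U|\<kappa>. lie_term S B i j p q U"
  \<comment> \<open>The squared length of \<open>v\<close>, which normalizes the projection v v^* /
    n. If it is zero, all relevant entries of \<open>v\<close> vanish.\<close>
  define n where "n = (\<Sum>a<N. v a * cnj (v a))"
  show "(\<Sum>p<N. \<Sum>q<N. v p * cnj (v q) * ?F p q) = 0"
  proof (cases "n = 0")
    case True
    have "n = of_real (\<Sum>a<N. (norm (v a))\<^sup>2)" unfolding n_def of_real_sum complex_norm_square ..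
    then have "(\<Sum>a<N. (norm (v a))\<^sup>2) = 0" using True by (metis of_real_eq_0_iff)
    then have "v a = 0" if "a < N" for a using that by (subst (asm) sum_nonneg_eq_0_iff) auto
    then show ?thesis by simp
  next
    case False
    define P where "P = (\<lambda>p q. v p * cnj (v q) / n)"
    have cn: "cnj n = n" by (simp add: n_def mult.commute)
    have "orth_proj N P"
      unfolding orth_proj_def
    proof (intro allI impI conjI)
      fix p q
      show "P q p = cnj (P p q)" by (simp add: P_def cn mult.commute)
      have "cmat_mult N P P p q = (\<Sum>a<N. v a * cnj (v a)) * (v p * cnj (v q)) / (n * n)"
        unfolding cmat_mult_def P_def sum_distrib_right sum_divide_distrib by (intro sum.cong refl) simp
      then show "cmat_mult N P P p q = P p q" using False by (simp add: n_def[symmetric] P_def)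
    qed
    from lie_term_orth_proj[OF S ij this] have "(\<Sum>p<N. \<Sum>q<N. P p q * ?F p q) = 0" .
    then have "n * (\<Sum>p<N. \<Sum>q<N. P p q * ?F p q) = 0" by simp
    then have "(\<Sum>p<N. \<Sum>q<N. n * (P p q * ?F p q)) = 0" by (simp only: sum_distrib_left)
    moreover have "n * (P p q * ?F p q) = v p * cnj (v q) * ?F p q" for p q
      using False by (simp add: P_def)
    ultimately show ?thesis by simp
  qed
qed

section \<open>The loop equations for Haar measure\<close>

definition haar_tensor :: "nat set \<Rightarrow> (nat \<Rightarrow> cmat) \<Rightarrow> (nat \<Rightarrow> nat) \<Rightarrow> (nat \<Rightarrow> nat) \<Rightarrow> complex" where
  "haar_tensor S B i j = (LINT U|\<kappa>. (\<Prod>k\<in>S. conj_mat N (B k) U (i k) (j k)))"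

text \<open>The direction E_(a, i m) is used with the row index at \<open>m\<close> replaced by
  \<open>a\<close>, and \<open>a\<close> is summed. Site \<open>m\<close> itself yields
  \<open>N\<close> and a trace. Another active site yields an exchange of row indices and, since the
  sum over \<open>a\<close> multiplies two matrices, a merged site.\<close>

lemma contraction:
  assumes S: "finite S" and Q: "Q \<subseteq> S" "m \<in> Q" "\<And>k. k \<in> S - Q \<Longrightarrow> B k = cmat_id"
    and ij: "i \<in> idx N S" "j \<in> idx N S" and U: "U \<in> unitary_mats N"
  shows "(\<Sum>a<N. lie_term S B (i(m := a)) j a (i m) U) =
    of_nat N * (\<Prod>k\<in>S. conj_mat N (B k) U (i k) (j k)) +
    (\<Sum>k\<in>Q-{m}. \<Prod>l\<in>S. conj_mat N (B l) U ((i \<circ> swp k m) l) (j l)) -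
    cmat_trace N (B m) * (\<Prod>l\<in>S. conj_mat N ((B(m := cmat_id)) l) U (i l) (j l)) -
    (\<Sum>k\<in>Q-{m}. \<Prod>l\<in>S. conj_mat N ((B(k := cmat_mult N (B k) (B m), m := cmat_id)) l) U (i l) ((j \<circ> swp k
        m) l))"
proof -
  let ?M = "\<lambda>k. conj_mat N (B k) U"
  have iN: "i k < N" and jN: "j k < N" if "k \<in> S" for k using ij that by (auto simp: PiE_iff)
  have mS: "m \<in> S" using Q by auto
  define g where "g = (\<lambda>k. \<Sum>a<N. (cmat_id ((i(m := a)) k) a * ?M k (i m) (j k) - ?M k ((i(m := a)) k) a
      * cmat_id (i m) (j k)) *
      (\<Prod>l\<in>S-{k}. ?M l ((i(m := a)) l) (j l)))"
  have "(\<Sum>a<N. lie_term S B (i(m := a)) j a (i m) U) = (\<Sum>k\<in>S. g k)"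
    unfolding lie_term_def g_def by (rule sum.swap)
  \<comment> \<open>An inactive site carries the identity, which commutes with every matrix, so its
    commutator is zero.\<close>
  also have "\<dots> = (\<Sum>k\<in>Q. g k)"
  proof (rule sum.mono_neutral_right[OF S Q(1)], intro ballI)
    fix k assume k: "k \<in> S - Q"
    then have kS: "k \<in> S" and km: "k \<noteq> m" using Q by auto
    have "cmat_id ((i(m := a)) k) a * ?M k (i m) (j k) - ?M k ((i(m := a)) k) a * cmat_id (i m) (j k)
        = 0" if "a < N" for a
      using Q(3)[OF k] conj_mat_cmat_id[OF U iN[OF mS] jN[OF kS]] conj_mat_cmat_id[OF U iN[OF kS] that]
          km by simp
    then show "g k = 0" unfolding g_def by (intro sum.neutral ballI) simp
  qed
  also have "\<dots> = g m + (\<Sum>k\<in>Q-{m}. g k)"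
    using Q S finite_subset by (intro sum.remove) auto
  also have "g m = of_nat N * (\<Prod>k\<in>S. ?M k (i k) (j k)) - cmat_trace N (B m)
      * (\<Prod>l\<in>S. conj_mat N ((B(m := cmat_id)) l) U (i l) (j l))"
  proof -
    let ?R = "\<Prod>l\<in>S-{m}. ?M l (i l) (j l)"
    have "g m = (\<Sum>a<N. (?M m (i m) (j m) - ?M m a a * cmat_id (i m) (j m)) * ?R)"
      unfolding g_def by (intro sum.cong refl arg_cong2[of _ _ _ _ "(*)"] prod.cong) (auto simp:
          cmat_id_def)
    also have "\<dots> = of_nat N * (?M m (i m) (j m) * ?R) - (\<Sum>a<N. ?M m a a) * (cmat_id (i m) (j m) * ?R)"
      by (simp add: left_diff_distrib sum_subtractf sum_distrib_right mult.assoc)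
    also have "(\<Sum>a<N. ?M m a a) = cmat_trace N (B m)" by (rule conj_mat_cmat_trace[OF U])
    also have "?M m (i m) (j m) * ?R = (\<Prod>k\<in>S. ?M k (i k) (j k))"
      by (rule prod.remove[OF S mS, symmetric])
    also have "cmat_id (i m) (j m) * ?R = (\<Prod>l\<in>S. conj_mat N ((B(m := cmat_id)) l) U (i l) (j l))"
      by (subst prod.remove[OF S mS]) (simp add: conj_mat_cmat_id[OF U iN[OF mS] jN[OF mS]])
    finally show ?thesis .
  qed
  also have "(\<Sum>k\<in>Q-{m}. g k) = (\<Sum>k\<in>Q-{m}. \<Prod>l\<in>S. conj_mat N (B l) U ((i \<circ> swp k m) l) (j l)) -
    (\<Sum>k\<in>Q-{m}. \<Prod>l\<in>S. conj_mat N ((B(k := cmat_mult N (B k) (B m), m := cmat_id)) l) U (i l) ((j \<circ> swp k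
        m) l))"
    unfolding sum_subtractf[symmetric]
  proof (intro sum.cong refl)
    fix k assume "k \<in> Q - {m}"
    then have kS: "k \<in> S" and km: "k \<noteq> m" "m \<noteq> k" using Q by auto
    let ?R = "\<Prod>l\<in>S-{k}-{m}. ?M l (i l) (j l)"
    have split: "(\<Prod>l\<in>S. f l) = f k * (f m * (\<Prod>l\<in>S-{k}-{m}. f l))" for f :: "nat \<Rightarrow> complex"
    proof -
      have "(\<Prod>l\<in>S. f l) = f k * (\<Prod>l\<in>S-{k}. f l)" by (rule prod.remove[OF S kS])
      also have "(\<Prod>l\<in>S-{k}. f l) = f m * (\<Prod>l\<in>S-{k}-{m}. f l)"
        using S mS km by (intro prod.remove) auto
      finally show ?thesis .
    qed
    have "g k = (\<Sum>a<N. (cmat_id (i k) a * ?M k (i m) (j k) - ?M k (i k) a * cmat_id (i m) (j k))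
        * (?M m a (j m) * ?R))"
      unfolding g_def
    proof (intro sum.cong refl arg_cong2[of _ _ _ _ "(*)"])
      fix a
      have "(\<Prod>l\<in>S-{k}. ?M l ((i(m := a)) l) (j l)) = ?M m ((i(m := a)) m) (j m)
          * (\<Prod>l\<in>S-{k}-{m}. ?M l ((i(m := a)) l) (j l))"
        using S mS km by (intro prod.remove) auto
      also have "(\<Prod>l\<in>S-{k}-{m}. ?M l ((i(m := a)) l) (j l)) = ?R" by (intro prod.cong) auto
      finally show "(\<Prod>l\<in>S-{k}. ?M l ((i(m := a)) l) (j l)) = ?M m a (j m) * ?R" by simp
    qed (use km in auto)
    also have "\<dots> = (\<Sum>a<N. cmat_id (i k) a * ?M m a (j m)) * (?M k (i m) (j k) * ?R) -
       (\<Sum>a<N. ?M k (i k) a * ?M m a (j m)) * (cmat_id (i m) (j k) * ?R)"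
      unfolding sum_distrib_right sum_subtractf[symmetric]
          by (intro sum.cong refl) (simp add: algebra_simps)
    also have "(\<Sum>a<N. cmat_id (i k) a * ?M m a (j m)) = ?M m (i k) (j m)"
      by (rule sum_cmat_id(1)[OF iN[OF kS]])
    also have "(\<Sum>a<N. ?M k (i k) a * ?M m a (j m)) = conj_mat N (cmat_mult N (B k) (B m)) U (i k) (j m)"
      by (rule conj_mat_mult[OF U])
    also have "?M m (i k) (j m) * (?M k (i m) (j k) * ?R)
        = (\<Prod>l\<in>S. conj_mat N (B l) U ((i \<circ> swp k m) l) (j l))"
    proof -
      have "(\<Prod>l\<in>S-{k}-{m}. conj_mat N (B l) U ((i \<circ> swp k m) l) (j l)) = ?R" by (intro prod.cong) auto
      then show ?thesis by (subst split) simp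
    qed
    also have "conj_mat N (cmat_mult N (B k) (B m)) U (i k) (j m) * (cmat_id (i m) (j k) * ?R) =
       (\<Prod>l\<in>S. conj_mat N ((B(k := cmat_mult N (B k) (B m), m := cmat_id)) l) U (i l) ((j \<circ> swp k m) l))"
    proof -
      have "(\<Prod>l\<in>S-{k}-{m}. conj_mat N ((B(k := cmat_mult N (B k) (B m), m := cmat_id)) l) U (i l) ((j \<circ>
          swp k m) l)) = ?R"
        by (intro prod.cong) auto
      then show ?thesis using km by (subst split) (simp add: conj_mat_cmat_id[OF U iN[OF mS] jN[OF kS]])
    qed
    finally show "g k = (\<Prod>l\<in>S. conj_mat N (B l) U ((i \<circ> swp k m) l) (j l)) -
      (\<Prod>l\<in>S. conj_mat N ((B(k := cmat_mult N (B k) (B m), m := cmat_id)) l) U (i l) ((j \<circ> swp k m) l))"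
          .
  qed
  finally show ?thesis by (simp only: add_diff_eq diff_add_eq add.assoc diff_diff_eq add.commute
      add.left_commute)
qed

lemma idx_upd: "i \<in> idx N S \<Longrightarrow> m \<in> S \<Longrightarrow> a < N \<Longrightarrow> i(m := a) \<in> idx N S"
  by (auto simp: PiE_iff extensional_def)

lemma haar_tensor_loop:
  assumes S: "finite S" and Q: "Q \<subseteq> S" "m \<in> Q" "\<And>k. k \<in> S - Q \<Longrightarrow> B k = cmat_id"
    and ij: "i \<in> idx N S" "j \<in> idx N S"
  shows "of_nat N * haar_tensor S B i j + (\<Sum>k\<in>Q-{m}. haar_tensor S B (i \<circ> swp k m) j) =
        cmat_trace N (B m) * haar_tensor S (B(m := cmat_id)) i j +
        (\<Sum>k\<in>Q-{m}. haar_tensor S (B(k := cmat_mult N (B k) (B m), m := cmat_id)) i (j \<circ> swp k m))"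
proof -
  have iN: "i k < N" and jN: "j k < N" if "k \<in> S" for k using ij that by (auto simp: PiE_iff)
  have mS: "m \<in> S" using Q by auto
  have sw: "swp k m l \<in> S" if "k \<in> Q - {m}" "l \<in> S" for k l
    using that mS Q by (auto simp: Transposition.transpose_def)
  let ?B = "\<lambda>k. B(k := cmat_mult N (B k) (B m), m := cmat_id)"
  let ?X = "\<lambda>U. \<Prod>k\<in>S. conj_mat N (B k) U (i k) (j k)"
  let ?Xz = "\<lambda>U. \<Prod>l\<in>S. conj_mat N ((B(m := cmat_id)) l) U (i l) (j l)"
  let ?Xl = "\<lambda>k U. \<Prod>l\<in>S. conj_mat N (B l) U ((i \<circ> swp k m) l) (j l)"
  let ?Xr = "\<lambda>k U. \<Prod>l\<in>S. conj_mat N (?B k l) U (i l) ((j \<circ> swp k m) l)"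
  have g: "bdd_meas ?X" "bdd_meas ?Xz" by (intro bdd_meas_prod bdd_meas_conj_mat iN jN; assumption)+
  have g1: "bdd_meas (?Xl k)" if "k \<in> Q - {m}" for k
    using iN jN sw[OF that] by (intro bdd_meas_prod bdd_meas_conj_mat) auto
  have g2: "bdd_meas (?Xr k)" if "k \<in> Q - {m}" for k
    using iN jN sw[OF that] by (intro bdd_meas_prod bdd_meas_conj_mat) auto
  have i1: "integrable \<kappa> (\<lambda>U. of_nat N * ?X U)" "integrable \<kappa> (\<lambda>U. cmat_trace N (B m) * ?Xz U)"
    "integrable \<kappa> (\<lambda>U. \<Sum>k\<in>Q-{m}. ?Xl k U)" "integrable \<kappa> (\<lambda>U. \<Sum>k\<in>Q-{m}. ?Xr k U)"
    by (intro bdd_meas_integrable bdd_meas_sum bdd_meas_mult bdd_meas_const g g1 g2; assumption)+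
  have "0 = (\<Sum>a<N. LINT U|\<kappa>. lie_term S B (i(m := a)) j a (i m) U)"
    using lie_term_zero[OF S idx_upd[OF ij(1) mS] ij(2) _ iN[OF mS]] by simp
  also have "\<dots> = (LINT U|\<kappa>. (\<Sum>a<N. lie_term S B (i(m := a)) j a (i m) U))"
    by (intro Bochner_Integration.integral_sum[symmetric] bdd_meas_integrable bdd_meas_lie_term idx_upd
        ij mS iN) auto
  also have "\<dots> = (LINT U|\<kappa>. of_nat N * ?X U + (\<Sum>k\<in>Q-{m}. ?Xl k U) - cmat_trace N (B m) * ?Xz U
      - (\<Sum>k\<in>Q-{m}. ?Xr k U))"
    by (intro Bochner_Integration.integral_cong refl contraction[OF S Q ij]) (simp_all only:
        space_kappa)
  also have "\<dots> = (LINT U|\<kappa>. of_nat N * ?X U) + (LINT U|\<kappa>. (\<Sum>k\<in>Q-{m}. ?Xl k U)) -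
     (LINT U|\<kappa>. cmat_trace N (B m) * ?Xz U) - (LINT U|\<kappa>. (\<Sum>k\<in>Q-{m}. ?Xr k U))"
    using i1 by simp
  also have "(LINT U|\<kappa>. (\<Sum>k\<in>Q-{m}. ?Xl k U)) = (\<Sum>k\<in>Q-{m}. haar_tensor S B (i \<circ> swp k m) j)"
    unfolding haar_tensor_def by (intro Bochner_Integration.integral_sum bdd_meas_integrable g1)
  also have "(LINT U|\<kappa>. (\<Sum>k\<in>Q-{m}. ?Xr k U)) = (\<Sum>k\<in>Q-{m}. haar_tensor S (?B k) i (j \<circ> swp k m))"
    unfolding haar_tensor_def by (intro Bochner_Integration.integral_sum bdd_meas_integrable g2)
  also have "(LINT U|\<kappa>. of_nat N * ?X U) = of_nat N * haar_tensor S B i j"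
      by (simp add: haar_tensor_def)
  also have "(LINT U|\<kappa>. cmat_trace N (B m) * ?Xz U) = cmat_trace N (B m)
      * haar_tensor S (B(m := cmat_id)) i j"
    by (simp add: haar_tensor_def)
  finally have "0 = of_nat N * haar_tensor S B i j + (\<Sum>k\<in>Q-{m}. haar_tensor S B (i \<circ> swp k m) j) -
        cmat_trace N (B m) * haar_tensor S (B(m := cmat_id)) i j -
        (\<Sum>k\<in>Q-{m}. haar_tensor S (?B k) i (j \<circ> swp k m))" .
  from this[symmetric] show ?thesis by (simp only: diff_diff_eq right_minus_eq)
qed

lemma haar_tensor_id:
  assumes "\<And>k. k \<in> S \<Longrightarrow> B k = cmat_id" "i \<in> idx N S" "j \<in> idx N S"
  shows "haar_tensor S B i j = (\<Prod>k\<in>S. cmat_id (i k) (j k))"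
proof -
  have "haar_tensor S B i j = (LINT U|\<kappa>. (\<Prod>k\<in>S. cmat_id (i k) (j k)))"
    unfolding haar_tensor_def
    by (intro Bochner_Integration.integral_cong refl prod.cong)
       (use assms in \<open>auto simp: PiE_iff conj_mat_cmat_id space_kappa\<close>)
  then show ?thesis by (simp add: prob_space)
qed

lemma loop: "finite S \<Longrightarrow> N > card S ^ 2 \<Longrightarrow> loop_functional N S (haar_tensor S)"
  by unfold_locales (auto intro: haar_tensor_id haar_tensor_loop)

text \<open>The power of the trace is a product over the sites of \<open>S\<close>. Expanding it and
  integrating entrywise gives \<open>tensor_trace\<close> at the identity permutation.\<close>

theorem moment_formula:
  fixes A B :: "complex mat" and S :: "nat set"
  assumes S: "finite S" "N > card S ^ 2" and AB: "A \<in> carrier_mat N N" "B \<in> carrier_mat N N"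
  defines "y \<equiv> - 1 / of_nat N" and "a \<equiv> \<lambda>i j. A $$ (i, j)" and "b \<equiv> \<lambda>i j. B $$ (i, j)"
  shows "of_nat N ^ card S * (LINT U|\<kappa>. mat_trace (A * U * B * mat_adjoint U) ^ card S) =
      (\<Sum>r. y ^ r * full_sum N a b S r)"
    and "summable (\<lambda>r. norm (y ^ r * full_sum N a b S r))"
proof -
  interpret loop_functional N S "haar_tensor S" by (rule loop[OF S])
  have "(LINT U|\<kappa>. mat_trace (A * U * B * mat_adjoint U) ^ card S) =
    (LINT U|\<kappa>. (\<Sum>i\<in>idx N S. \<Sum>j\<in>idx N S. (\<Prod>k\<in>S. a (j k) (i k)) * (\<Prod>k\<in>S. conj_mat N b U (i k) (j k))))"
  proof (intro Bochner_Integration.integral_cong refl)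
    fix U assume "U \<in> space \<kappa>"
    then have U: "U \<in> carrier_mat N N" using unitary_carrier by (simp add: space_kappa)
    have "mat_trace (A * U * B * mat_adjoint U) ^ card S = (\<Prod>k\<in>S. \<Sum>i<N. \<Sum>j<N. a j i
        * conj_mat N b U i j)"
      by (simp add: trace_eq_conj_mat[OF AB U] a_def b_def)
    also have "\<dots> = (\<Sum>i\<in>idx N S. \<Prod>k\<in>S. \<Sum>j<N. a j (i k) * conj_mat N b U (i k) j)"
      using S by (intro prod_sum_PiE) auto
    also have "\<dots> = (\<Sum>i\<in>idx N S. \<Sum>j\<in>idx N S. \<Prod>k\<in>S. a (j k) (i k) * conj_mat N b U (i k) (j k))"
      using S by (intro sum.cong refl prod_sum_PiE) auto
    finally show "mat_trace (A * U * B * mat_adjoint U) ^ card S =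
      (\<Sum>i\<in>idx N S. \<Sum>j\<in>idx N S. (\<Prod>k\<in>S. a (j k) (i k)) * (\<Prod>k\<in>S. conj_mat N b U (i k) (j k)))"
      by (simp add: prod.distrib)
  qed
  also have "\<dots> = (\<Sum>i\<in>idx N S. LINT U|\<kappa>. (\<Sum>j\<in>idx N S. (\<Prod>k\<in>S. a (j k) (i k))
      * (\<Prod>k\<in>S. conj_mat N b U (i k) (j k))))"
    by (intro Bochner_Integration.integral_sum bdd_meas_integrable bdd_meas_sum bdd_meas_mult
        bdd_meas_const bdd_meas_prod bdd_meas_conj_mat) (auto simp: PiE_iff)
  also have "\<dots> = (\<Sum>i\<in>idx N S. \<Sum>j\<in>idx N S. LINT U|\<kappa>. (\<Prod>k\<in>S. a (j k) (i k))
      * (\<Prod>k\<in>S. conj_mat N b U (i k) (j k)))"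
    by (intro sum.cong refl Bochner_Integration.integral_sum bdd_meas_integrable bdd_meas_sum
        bdd_meas_mult bdd_meas_const bdd_meas_prod bdd_meas_conj_mat) (auto simp: PiE_iff)
  also have "\<dots> = tensor_trace a (\<lambda>_. b) id"
    unfolding tensor_trace_def haar_tensor_def by simp
  finally have eq: "(LINT U|\<kappa>. mat_trace (A * U * B * mat_adjoint U) ^ card S)
      = tensor_trace a (\<lambda>_. b) id" .
  have xi_y: "xi = y" unfolding xi_def y_def ..
  show "of_nat N ^ card S * (LINT U|\<kappa>. mat_trace (A * U * B * mat_adjoint U) ^ card S) =
      (\<Sum>r. y ^ r * full_sum N a b S r)"
    unfolding eq using tensor_trace_id_formula(1)[of a b] by (simp add: xi_y)
  show "summable (\<lambda>r. norm (y ^ r * full_sum N a b S r))"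
    using tensor_trace_id_formula(2)[of a b] by (simp add: xi_y)
qed

end

section \<open>Splitting off the component of a marked point\<close>

section \<open>Connected tuples and the exponential formula\<close>

definition inv_under :: "(nat \<Rightarrow> nat) \<Rightarrow> (nat \<times> nat) list \<Rightarrow> nat set \<Rightarrow> bool" where
  "inv_under s l T \<longleftrightarrow> (\<forall>x. s x \<in> T \<longleftrightarrow> x \<in> T) \<and> (\<forall>(a,b)\<in>set l. a \<in> T \<longleftrightarrow> b \<in> T)"

text \<open>Transitivity expressed by invariant sets, which restrict and combine easily. The
  generated group appears only in the comparison with \<open>monotone_hurwitz\<close>.\<close>

definition conn :: "nat set \<Rightarrow> (nat \<Rightarrow> nat) \<Rightarrow> (nat \<times> nat) list \<Rightarrow> bool" where
  "conn S s l \<longleftrightarrow> (\<forall>T\<subseteq>S. inv_under s l T \<longrightarrow> T = {} \<or> T = S)"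

text \<open>A pair \<open>(s, l)\<close> encodes the tuple whose second permutation is \<open>s\<close> and whose transpositions are
  listed in \<open>l\<close>. The first permutation is then forced to be the inverse of \<open>s \<circ> transp_prod l\<close>.\<close>

definition perm_tuples :: "nat set \<Rightarrow> nat \<Rightarrow> ((nat \<Rightarrow> nat) \<times> (nat \<times> nat) list) set" where
  "perm_tuples S r = {s. s permutes S} \<times> mono_lists S r"

definition conn_tuples :: "nat set \<Rightarrow> nat \<Rightarrow> ((nat \<Rightarrow> nat) \<times> (nat \<times> nat) list) set" where
  "conn_tuples S r = {(s,l) \<in> perm_tuples S r. conn S s l}"

definition tuple_weight :: "nat \<Rightarrow> cmat \<Rightarrow> cmat \<Rightarrow> nat set \<Rightarrow> (nat \<Rightarrow> nat) \<times> (nat \<times> nat) list \<Rightarrow> complex"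
    where
  "tuple_weight N A B S = (\<lambda>(s,l). ptrace N S (\<lambda>_. B) s * ptrace N S (\<lambda>_. A) (s \<circ> transp_prod l))"

definition conn_sum :: "nat \<Rightarrow> cmat \<Rightarrow> cmat \<Rightarrow> nat set \<Rightarrow> nat \<Rightarrow> complex" where
  "conn_sum N A B S r = (\<Sum>x\<in>conn_tuples S r. tuple_weight N A B S x)"

lemma full_sum_eq: "full_sum N A B S r = (\<Sum>x\<in>perm_tuples S r. tuple_weight N A B S x)"
  by (simp add: full_sum_def perm_tuples_def tuple_weight_def sum.cartesian_product)

lemma finite_perm_tuples [simp]: "finite S \<Longrightarrow> finite (perm_tuples S r)"
  by (simp add: perm_tuples_def finite_permutations)

lemma finite_conn_tuples [simp]: "finite S \<Longrightarrow> finite (conn_tuples S r)"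
  by (rule finite_subset[of _ "perm_tuples S r"]) (auto simp: conn_tuples_def)

lemma inv_under_image: "inv_under s l T \<Longrightarrow> s ` T \<subseteq> T"
  by (auto simp: inv_under_def)

lemma inv_under_diff:
  assumes "inv_under s l T" "inv_under s l T'"
  shows "inv_under s l (T - T')"
  using assms unfolding inv_under_def by blast

text \<open>An injective map cannot send a finite set into a proper subset of itself, so stability
  already gives the equivalence.\<close>

lemma inv_underI:
  assumes "s permutes S" "finite T" "s ` T \<subseteq> T" "\<And>a b. (a,b) \<in> set l \<Longrightarrow> a \<in> T \<longleftrightarrow> b \<in> T"
  shows "inv_under s l T"
proof -
  have inj: "inj s" using assms(1) by (rule permutes_inj)
  have "s ` T = T"
    using assms(2,3) inj by (intro card_subset_eq) (auto simp: card_image inj_on_subset)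
  then have "s x \<in> T \<longleftrightarrow> x \<in> T" for x using inj by (metis image_eqI inj_image_mem_iff)
  then show ?thesis using assms(4) by (auto simp: inv_under_def)
qed

lemma inv_under_S:
  assumes "s permutes S" "set l \<subseteq> S \<times> S"
  shows "inv_under s l S"
  using assms by (auto simp: inv_under_def permutes_in_image)

lemma inv_under_empty: "inv_under s l {}"
  by (simp add: inv_under_def)

text \<open>A transposition with both entries outside \<open>T\<close> fixes \<open>T\<close>
  pointwise, so deleting it is not noticed on \<open>T\<close>.\<close>

lemma transp_prod_filter:
  assumes "\<And>a b. (a,b) \<in> set l \<Longrightarrow> a \<in> T \<longleftrightarrow> b \<in> T"
  shows "(transp_prod l x \<in> T \<longleftrightarrow> x \<in> T) \<and> (x \<in> T \<longrightarrow> transp_prod l x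
      = transp_prod (filter (\<lambda>p. fst p \<in> T) l) x)"
  using assms
proof (induction l arbitrary: x)
  case (Cons p l)
  obtain a b where p: "p = (a,b)" by (cases p)
  have ab: "a \<in> T \<longleftrightarrow> b \<in> T" using Cons.prems p by auto
  have IH: "transp_prod l x \<in> T \<longleftrightarrow> x \<in> T" "x \<in> T \<Longrightarrow> transp_prod l x
      = transp_prod (filter (\<lambda>p. fst p \<in> T) l) x" for x
    using Cons by auto
  have 1: "swp a b y \<in> T \<longleftrightarrow> y \<in> T" for y using ab by (auto simp: Transposition.transpose_def)
  have 2: "swp a b y = y" if "y \<in> T" "a \<notin> T" for y
    using that ab by (auto simp: Transposition.transpose_def)
  show ?case using IH[of x] 1 2[of "transp_prod l x"] by (auto simp: p)
qed simp

lemma perm_restrict_permutes: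
  assumes "s permutes S" "inv_under s l T"
  shows "perm_restrict s T permutes T"
proof -
  have "s ` T = T"
  proof
    show "s ` T \<subseteq> T" by (rule inv_under_image[OF assms(2)])
    show "T \<subseteq> s ` T"
    proof
      fix y assume "y \<in> T"
      moreover have "y = s (inv' s y)" using assms(1) by (simp add: permutes_inverses)
      ultimately show "y \<in> s ` T" using assms(2) unfolding inv_under_def by (metis image_eqI)
    qed
  qed
  moreover have "inj_on s T" using permutes_inj[OF assms(1)] by (rule inj_on_subset) simp
  ultimately have "bij_betw (perm_restrict s T) T T"
    by (auto simp: bij_betw_def inj_on_def perm_restrict_def image_def)
  then show ?thesis by (intro bij_imp_permutes) (auto simp: perm_restrict_def)
qed

lemma sort_key_sorted: "sorted (map f xs) \<Longrightarrow> sort_key f xs = xs"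
  by (rule properties_for_sort_key) auto

text \<open>This is where monotonicity makes restriction lossless. Pairs with the same larger entry
  lie on the same side of \<open>T\<close>, so the stable sort keeps their order, while the two
  sides interleave by their distinct larger entries.\<close>

lemma sort_merge:
  assumes l: "sorted (map snd l)" and T: "\<And>a b. (a,b) \<in> set l \<Longrightarrow> a \<in> T \<longleftrightarrow> b \<in> T"
  shows "sort_key snd (filter (\<lambda>p. fst p \<in> T) l @ filter (\<lambda>p. fst p \<notin> T) l) = l"
proof (rule properties_for_sort_key)
  show "mset l = mset (filter (\<lambda>p. fst p \<in> T) l @ filter (\<lambda>p. fst p \<notin> T) l)"
    by (simp add: multiset_partition[symmetric])
  fix k assume k: "k \<in> set l"
  have same: "fst x \<in> T \<longleftrightarrow> snd k \<in> T" if "x \<in> set l" "snd k = snd x" for x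
    using T[of "fst x" "snd x"] that by simp
  show "filter (\<lambda>x. snd k = snd x) l =
     filter (\<lambda>x. snd k = snd x) (filter (\<lambda>p. fst p \<in> T) l @ filter (\<lambda>p. fst p \<notin> T) l)"
  proof (cases "snd k \<in> T")
    case True
    then have "filter (\<lambda>x. snd k = snd x) (filter (\<lambda>p. fst p \<in> T) l) = filter (\<lambda>x. snd k = snd x) l"
      "filter (\<lambda>x. snd k = snd x) (filter (\<lambda>p. fst p \<notin> T) l) = []"
      using same by (auto simp: filter_empty_conv intro!: filter_cong)
    then show ?thesis by simp
  next
    case False
    then have "filter (\<lambda>x. snd k = snd x) (filter (\<lambda>p. fst p \<notin> T) l) = filter (\<lambda>x. snd k = snd x) l"
      "filter (\<lambda>x. snd k = snd x) (filter (\<lambda>p. fst p \<in> T) l) = []"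
      using same by (auto simp: filter_empty_conv intro!: filter_cong)
    then show ?thesis by simp
  qed
qed (rule l)

definition component :: "nat set \<Rightarrow> nat \<Rightarrow> (nat \<Rightarrow> nat) \<Rightarrow> (nat \<times> nat) list \<Rightarrow> nat set" where
  "component S m s l = \<Inter>{T. T \<subseteq> S \<and> m \<in> T \<and> inv_under s l T}"

lemma inv_under_Inter:
  assumes "\<And>T. T \<in> F \<Longrightarrow> inv_under s l T"
  shows "inv_under s l (\<Inter>F)"
  unfolding inv_under_def
proof (intro conjI allI ballI)
  fix x
  have "s x \<in> T \<longleftrightarrow> x \<in> T" if "T \<in> F" for T
    using assms[OF that] unfolding inv_under_def by blast
  then show "s x \<in> \<Inter>F \<longleftrightarrow> x \<in> \<Inter>F" by simp
next
  fix p assume p: "p \<in> set l"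
  obtain a b where ab: "p = (a,b)" by (cases p)
  have "a \<in> T \<longleftrightarrow> b \<in> T" if "T \<in> F" for T
    using assms[OF that] p unfolding inv_under_def ab by blast
  then show "case p of (a,b) \<Rightarrow> a \<in> \<Inter>F \<longleftrightarrow> b \<in> \<Inter>F" unfolding ab by simp
qed

lemma component_props:
  assumes "s permutes S" "set l \<subseteq> S \<times> S" "m \<in> S"
  shows "component S m s l \<subseteq> S" "m \<in> component S m s l" "inv_under s l (component S m s l)"
    "\<And>T. T \<subseteq> S \<Longrightarrow> m \<in> T \<Longrightarrow> inv_under s l T \<Longrightarrow> component S m s l \<subseteq> T"
proof -
  show "component S m s l \<subseteq> S" using inv_under_S[OF assms(1,2)] assms(3) by (auto simp: component_def)
  show "m \<in> component S m s l" by (auto simp: component_def)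
  show "inv_under s l (component S m s l)" unfolding component_def by (rule inv_under_Inter) simp
  show "\<And>T. T \<subseteq> S \<Longrightarrow> m \<in> T \<Longrightarrow> inv_under s l T \<Longrightarrow> component S m s l \<subseteq> T" by (auto simp: component_def)
qed

text \<open>A subset of the component that is invariant for the restricted tuple is invariant for
  the whole one. It or its complement in the component contains \<open>m\<close>, and by minimality
  that part is everything.\<close>

lemma component_conn:
  assumes "s permutes S" "set l \<subseteq> S \<times> S" "m \<in> S"
  defines "T \<equiv> component S m s l"
  shows "conn T (perm_restrict s T) (filter (\<lambda>p. fst p \<in> T) l)"
  unfolding conn_def
proof (intro allI impI)
  note T = component_props[OF assms(1-3), folded T_def]
  fix X assume X: "X \<subseteq> T" "inv_under (perm_restrict s T) (filter (\<lambda>p. fst p \<in> T) l) X"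
  have XS: "X \<subseteq> S" using X T by auto
  have iX: "inv_under s l X"
    unfolding inv_under_def
  proof (intro conjI allI ballI)
    fix x
    have "s x \<in> T \<longleftrightarrow> x \<in> T" using T(3) by (simp add: inv_under_def)
    moreover have "perm_restrict s T x \<in> X \<longleftrightarrow> x \<in> X" using X(2) by (simp add: inv_under_def)
    ultimately show "s x \<in> X \<longleftrightarrow> x \<in> X" using X(1) by (auto simp: perm_restrict_def split: if_splits)
  next
    fix p assume p: "p \<in> set l"
    obtain a b where ab: "p = (a,b)" by (cases p)
    have "a \<in> T \<longleftrightarrow> b \<in> T" using T(3) p ab by (auto simp: inv_under_def)
    moreover have "a \<in> X \<longleftrightarrow> b \<in> X" if "a \<in> T" using X(2) p ab that by (auto simp: inv_under_def)
    ultimately show "case p of (a,b) \<Rightarrow> a \<in> X \<longleftrightarrow> b \<in> X" using X(1) ab by auto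
  qed
  show "X = {} \<or> X = T"
  proof (cases "m \<in> X")
    case True
    then show ?thesis using T(4)[OF XS True iX] X(1) by auto
  next
    case False
    have "T \<subseteq> T - X" by (rule T(4)) (use T False inv_under_diff[OF T(3) iX] in auto)
    then show ?thesis using X(1) by auto
  qed
qed

lemma tuple_weight_split:
  assumes S: "finite S" "s permutes S" "set l \<subseteq> S \<times> S" and T: "T \<subseteq> S" "inv_under s l T"
  shows "tuple_weight N A B S (s, l) = tuple_weight N A B T (perm_restrict s T, filter (\<lambda>p. fst p \<in> T)
      l) *
     tuple_weight N A B (S - T) (perm_restrict s (S - T), filter (\<lambda>p. fst p \<notin> T) l)"
proof -
  have fT: "finite T" "finite (S - T)" using S T finite_subset by auto
  have ST: "S = T \<union> (S - T)" using T by auto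
  have cl: "a \<in> T \<longleftrightarrow> b \<in> T" "a \<in> - T \<longleftrightarrow> b \<in> - T" if "(a,b) \<in> set l" for a b
    using T(2) that by (auto simp: inv_under_def)
  have sT: "s x \<in> T \<longleftrightarrow> x \<in> T" for x using T(2) by (auto simp: inv_under_def)
  have sS: "s x \<in> S \<longleftrightarrow> x \<in> S" for x using S(2) by (rule permutes_in_image)
  have tS: "transp_prod l x \<in> S \<longleftrightarrow> x \<in> S" for x using transp_prod_permutes[OF S(3)]
      by (rule permutes_in_image)
  have tT: "transp_prod l x \<in> T \<longleftrightarrow> x \<in> T" "x \<in> T \<Longrightarrow> transp_prod l x
      = transp_prod (filter (\<lambda>p. fst p \<in> T) l) x" for x
    using transp_prod_filter[of l T x] cl by auto
  have tC: "x \<notin> T \<Longrightarrow> transp_prod l x = transp_prod (filter (\<lambda>p. fst p \<notin> T) l) x" for x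
    using transp_prod_filter[of l "-T" x] cl by auto
  have split: "ptrace N S C p = ptrace N T C p * ptrace N (S - T) C p" if "p ` T \<subseteq> T" "p ` (S - T) \<subseteq> S
      - T" for p C
    using ptrace_Un[OF fT _ that, of N C] ST by auto
  have "ptrace N S (\<lambda>_. B) s = ptrace N T (\<lambda>_. B) s * ptrace N (S - T) (\<lambda>_. B) s"
    by (rule split) (auto simp: sT sS)
  moreover have "ptrace N S (\<lambda>_. A) (s \<circ> transp_prod l) = ptrace N T (\<lambda>_. A) (s \<circ> transp_prod l)
      * ptrace N (S - T) (\<lambda>_. A) (s \<circ> transp_prod l)"
    by (rule split) (auto simp: sT sS tT(1) tS)
  moreover have "ptrace N T (\<lambda>_. B) s = ptrace N T (\<lambda>_. B) (perm_restrict s T)"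
    "ptrace N (S - T) (\<lambda>_. B) s = ptrace N (S - T) (\<lambda>_. B) (perm_restrict s (S - T))"
    by (intro ptrace_cong; simp add: perm_restrict_def)+
  moreover have "ptrace N T (\<lambda>_. A) (s \<circ> transp_prod l)
      = ptrace N T (\<lambda>_. A) (perm_restrict s T \<circ> transp_prod (filter (\<lambda>p. fst p \<in> T) l))"
  proof (rule ptrace_cong)
    fix k assume "k \<in> T"
    then show "(s \<circ> transp_prod l) k = (perm_restrict s T \<circ> transp_prod (filter (\<lambda>p. fst p \<in> T) l)) k"
      using tT(2)[of k] tT(1)[of k] by (simp add: perm_restrict_def)
  qed simp
  moreover have "ptrace N (S - T) (\<lambda>_. A) (s \<circ> transp_prod l) =
     ptrace N (S - T) (\<lambda>_. A) (perm_restrict s (S - T) \<circ> transp_prod (filter (\<lambda>p. fst p \<notin> T) l))"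
  proof (rule ptrace_cong)
    fix k assume "k \<in> S - T"
    then show "(s \<circ> transp_prod l) k = (perm_restrict s (S
        - T) \<circ> transp_prod (filter (\<lambda>p. fst p \<notin> T) l)) k"
      using tC[of k] tT(1)[of k] tS[of k] by (simp add: perm_restrict_def)
  qed simp
  ultimately show ?thesis by (simp add: tuple_weight_def)
qed

lemma mono_lists_filter:
  assumes l: "l \<in> mono_lists S r" and T: "T \<subseteq> S" "inv_under s l T"
  shows "filter (\<lambda>p. fst p \<in> T) l \<in> mono_lists T (length (filter (\<lambda>p. fst p \<in> T) l))"
    "filter (\<lambda>p. fst p \<notin> T) l \<in> mono_lists (S - T) (r - length (filter (\<lambda>p. fst p \<in> T) l))"
    "length (filter (\<lambda>p. fst p \<in> T) l) \<le> r"
proof -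
  have cl: "a \<in> T \<longleftrightarrow> b \<in> T" if "(a,b) \<in> set l" for a b
    using T(2) that by (auto simp: inv_under_def)
  have el: "a \<in> S" "b \<in> S" "a < b" if "(a,b) \<in> set l" for a b
    using l that by (auto simp: mono_lists_def)
  have len: "length (filter (\<lambda>p. fst p \<in> T) l) + length (filter (\<lambda>p. fst p \<notin> T) l) = r"
    using l sum_length_filter_compl[of "\<lambda>p. fst p \<in> T" l] by (simp add: mono_lists_def)
  have sorted: "sorted (map snd (filter P l))" for P
    using l by (intro sorted_filter) (simp add: mono_lists_def)
  show "filter (\<lambda>p. fst p \<in> T) l \<in> mono_lists T (length (filter (\<lambda>p. fst p \<in> T) l))"
    using sorted cl el by (auto simp: mono_lists_def)
  show "filter (\<lambda>p. fst p \<notin> T) l \<in> mono_lists (S - T) (r - length (filter (\<lambda>p. fst p \<in> T) l))"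
    using sorted cl el len by (auto simp: mono_lists_def)
  show "length (filter (\<lambda>p. fst p \<in> T) l) \<le> r" using len by simp
qed

text \<open>A connected tuple on \<open>T\<close> and an arbitrary tuple on the rest. Composing the
  permutations and merging the lists loses nothing: both tuples are recovered by restriction, and
  \<open>T\<close> as the component of \<open>m\<close>.\<close>

context
  fixes S T :: "nat set" and m q r :: nat and s1 s2 :: "nat \<Rightarrow> nat" and l1 l2 :: "(nat \<times> nat) list"
  assumes S: "finite S" and T: "T \<subseteq> S" "m \<in> T" and x1: "(s1, l1) \<in> conn_tuples T q"
      and x2: "(s2, l2) \<in> perm_tuples (S - T) (r - q)"
    and q: "q \<le> r"
begin

lemma s12: "s1 permutes T" "s2 permutes S - T"
  using x1 x2 by (auto simp: conn_tuples_def perm_tuples_def)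

lemma l12: "l1 \<in> mono_lists T q" "l2 \<in> mono_lists (S - T) (r - q)"
  using x1 x2 by (auto simp: conn_tuples_def perm_tuples_def)

lemma s12_on: "x \<in> T \<Longrightarrow> (s1 \<circ> s2) x = s1 x" "x \<notin> T \<Longrightarrow> (s1 \<circ> s2) x = s2 x"
proof -
  show "(s1 \<circ> s2) x = s1 x" if "x \<in> T" using that s12(2) by (simp add: permutes_not_in)
  show "(s1 \<circ> s2) x = s2 x" if x: "x \<notin> T"
  proof -
    have "s2 x \<notin> T"
      using x permutes_in_image[OF s12(2), of x] permutes_not_in[OF s12(2), of x] T by (cases "x \<in> S
          - T") auto
    then show ?thesis using s12(1) by (simp add: permutes_not_in)
  qed
qed

lemma merged: "(s1 \<circ> s2, sort_key snd (l1 @ l2)) \<in> perm_tuples S r"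
proof -
  have "s1 \<circ> s2 permutes S"
    using s12 T by (intro permutes_compose) (auto intro: permutes_subset)
  moreover have "sort_key snd (l1 @ l2) \<in> mono_lists S r"
    using l12 T q by (auto simp: mono_lists_def)
  ultimately show ?thesis by (simp add: perm_tuples_def)
qed

lemma merged_inv: "inv_under (s1 \<circ> s2) (sort_key snd (l1 @ l2)) T"
proof -
  have "(s1 \<circ> s2) x \<in> T \<longleftrightarrow> x \<in> T" for x
  proof (cases "x \<in> T")
    case True then show ?thesis using s12_on(1) permutes_in_image[OF s12(1)] by simp
  next
    case False
    have "s2 x \<notin> T"
      using False permutes_in_image[OF s12(2), of x] permutes_not_in[OF s12(2), of x] T by (cases "x \<in> S
          - T") auto
    then show ?thesis using False s12_on(2)[OF False] by simp
  qed
  then show ?thesis using l12 by (auto simp: inv_under_def mono_lists_def)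
qed

lemma merged_filter:
  "filter (\<lambda>p. fst p \<in> T) (sort_key snd (l1 @ l2)) = l1"
  "filter (\<lambda>p. fst p \<notin> T) (sort_key snd (l1 @ l2)) = l2"
proof -
  have e1: "fst p \<in> T" if "p \<in> set l1" for p using l12 that by (auto simp: mono_lists_def)
  have e2: "fst p \<notin> T" if "p \<in> set l2" for p using l12 that by (auto simp: mono_lists_def)
  have f: "filter (\<lambda>p. fst p \<in> T) (l1 @ l2) = l1" "filter (\<lambda>p. fst p \<notin> T) (l1 @ l2) = l2"
    using e1 e2 by (auto simp: filter_empty_conv filter_id_conv)
  show "filter (\<lambda>p. fst p \<in> T) (sort_key snd (l1 @ l2)) = l1"
    unfolding filter_sort f using l12 by (intro sort_key_sorted) (simp add: mono_lists_def)
  show "filter (\<lambda>p. fst p \<notin> T) (sort_key snd (l1 @ l2)) = l2"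
    unfolding filter_sort f using l12 by (intro sort_key_sorted) (simp add: mono_lists_def)
qed

lemma merged_restrict: "perm_restrict (s1 \<circ> s2) T = s1" "perm_restrict (s1 \<circ> s2) (S - T) = s2"
proof -
  show "perm_restrict (s1 \<circ> s2) T = s1"
  proof
    fix x show "perm_restrict (s1 \<circ> s2) T x = s1 x"
      using s12_on(1)[of x] permutes_not_in[OF s12(1), of x] by (simp add: perm_restrict_def)
  qed
  show "perm_restrict (s1 \<circ> s2) (S - T) = s2"
  proof
    fix x show "perm_restrict (s1 \<circ> s2) (S - T) x = s2 x"
      using s12_on(2)[of x] permutes_not_in[OF s12(2), of x] by (auto simp: perm_restrict_def)
  qed
qed

text \<open>Minimality puts the component inside \<open>T\<close>. It is invariant for the first
  tuple and contains \<open>m\<close>, so connectedness of that tuple leaves only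
  \<open>T\<close>.\<close>

lemma merged_component: "component S m (s1 \<circ> s2) (sort_key snd (l1 @ l2)) = T"
proof -
  let ?s = "s1 \<circ> s2" and ?l = "sort_key snd (l1 @ l2)"
  have "?s permutes S" "set ?l \<subseteq> S \<times> S" using merged by (auto simp: perm_tuples_def mono_lists_def)
  note c = component_props[OF this, of m]
  have mS: "m \<in> S" using T by auto
  have sub: "component S m ?s ?l \<subseteq> T" by (rule c(4)[OF mS T merged_inv])
  have "inv_under s1 l1 (component S m ?s ?l)"
    unfolding inv_under_def
  proof (intro conjI allI ballI)
    let ?C = "component S m ?s ?l"
    fix x
    have "?s x \<in> ?C \<longleftrightarrow> x \<in> ?C" using c(3)[OF mS] by (simp only: inv_under_def)
    then show "s1 x \<in> ?C \<longleftrightarrow> x \<in> ?C"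
    proof (cases "x \<in> T")
      case True
      then show ?thesis using \<open>?s x \<in> ?C \<longleftrightarrow> x \<in> ?C\<close> s12_on(1)[OF True] by simp
    next
      case False
      then show ?thesis using permutes_not_in[OF s12(1) False] by simp
    qed
  next
    fix p assume "p \<in> set l1"
    then have "p \<in> set ?l" by simp
    then show "case p of (a,b) \<Rightarrow> a \<in> component S m ?s ?l \<longleftrightarrow> b \<in> component S m ?s ?l"
      using c(3)[OF mS] by (simp only: inv_under_def)
  qed
  moreover have "conn T s1 l1" using x1 by (simp add: conn_tuples_def)
  ultimately show ?thesis using sub c(2)[OF mS] unfolding conn_def by blast
qed

end

text \<open>Marking \<open>m\<close> distinguishes one component, so no set partitions occur and the
  identity has the shape of the differential equation of an exponential. Weights multiply and list
  lengths add under the splitting.\<close>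

theorem exponential_formula:
  assumes S: "finite S" and m: "m \<in> S"
  shows "full_sum N A B S r = (\<Sum>T | T \<subseteq> S \<and> m \<in> T. \<Sum>q\<le>r. conn_sum N A B T q * full_sum N A B (S - T) (r
      - q))"
proof -
  let ?Z = "SIGMA T:{T. T \<subseteq> S \<and> m \<in> T}. SIGMA q:{..r}. conn_tuples T q \<times> perm_tuples (S - T) (r - q)"
  have fin: "finite T" "finite (S - T)" if "T \<subseteq> S" for T using S that finite_subset by auto
  have finS: "finite {T. T \<subseteq> S \<and> m \<in> T}" using S by simp
  have "(\<Sum>T | T \<subseteq> S \<and> m \<in> T. \<Sum>q\<le>r. conn_sum N A B T q * full_sum N A B (S - T) (r - q)) =
    (\<Sum>T | T \<subseteq> S \<and> m \<in> T. \<Sum>q\<le>r. \<Sum>(x,y)\<in>conn_tuples T q \<times> perm_tuples (S - T) (r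
        - q). tuple_weight N A B T x * tuple_weight N A B (S - T) y)"
    by (simp add: conn_sum_def full_sum_eq sum_product sum.cartesian_product)
  also have "\<dots> = (\<Sum>T | T \<subseteq> S \<and> m \<in> T. \<Sum>(q,x,y)\<in>(SIGMA q:{..r}. conn_tuples T q \<times> perm_tuples (S - T) (r
      - q)). tuple_weight N A B T x * tuple_weight N A B (S - T) y)"
    using fin by (intro sum.cong refl sum.Sigma) auto
  also have "\<dots> = (\<Sum>(T,q,x,y)\<in>?Z. tuple_weight N A B T x * tuple_weight N A B (S - T) y)"
    using fin finS by (intro sum.Sigma) auto
  also have "\<dots> = (\<Sum>x\<in>perm_tuples S r. tuple_weight N A B S x)"
  proof (rule sum.reindex_bij_witness[symmetric, where
        j = "\<lambda>(s,l). let T = component S m s l in (T, length (filter (\<lambda>p. fst p \<in> T) l),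
           (perm_restrict s T, filter (\<lambda>p. fst p \<in> T) l), (perm_restrict s (S
               - T), filter (\<lambda>p. fst p \<notin> T) l))"
        and i = "\<lambda>(T,q,(s1,l1),(s2,l2)). (s1 \<circ> s2, sort_key snd (l1 @ l2))"], goal_cases)
    case (1 x)
    obtain s l where x: "x = (s,l)" by (cases x)
    have s: "s permutes S" "l \<in> mono_lists S r" "set l \<subseteq> S \<times> S" using 1 x
        by (auto simp: perm_tuples_def mono_lists_def)
    define T where "T = component S m s l"
    note T = component_props[OF s(1,3) m, folded T_def]
    have cl: "a \<in> T \<longleftrightarrow> b \<in> T" if "(a,b) \<in> set l" for a b
      using T(3) that by (auto simp: inv_under_def)
    have "sort_key snd (filter (\<lambda>p. fst p \<in> T) l @ filter (\<lambda>p. fst p \<notin> T) l) = l"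
      by (rule sort_merge) (use s cl in \<open>auto simp: mono_lists_def\<close>)
    moreover have "perm_restrict s T \<circ> perm_restrict s (S - T) = s"
    proof
      fix y
      have "s y \<in> T \<longleftrightarrow> y \<in> T" using T(3) by (simp add: inv_under_def)
      then show "(perm_restrict s T \<circ> perm_restrict s (S - T)) y = s y"
        using T(1) permutes_not_in[OF s(1), of y] by (auto simp: perm_restrict_def)
    qed
    ultimately show ?case by (simp add: x Let_def T_def[symmetric])
  next
    case (2 x)
    obtain s l where x: "x = (s,l)" by (cases x)
    have s: "s permutes S" "l \<in> mono_lists S r" "set l \<subseteq> S \<times> S" using 2 x
        by (auto simp: perm_tuples_def mono_lists_def)
    define T where "T = component S m s l"
    note T = component_props[OF s(1,3) m, folded T_def]
    have iS: "inv_under s l (S - T)" by (rule inv_under_diff[OF inv_under_S[OF s(1,3)] T(3)])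
    show ?case
      using T mono_lists_filter[OF s(2) T(1,3)] perm_restrict_permutes[OF s(1) T(3)]
          perm_restrict_permutes[OF s(1) iS]
        component_conn[OF s(1,3) m, folded T_def]
      by (simp add: x Let_def T_def[symmetric] conn_tuples_def perm_tuples_def)
  next
    case (3 b)
    obtain T q s1 l1 s2 l2 where b: "b = (T,q,(s1,l1),(s2,l2))" by (metis prod.exhaust_sel)
    have *: "T \<subseteq> S" "m \<in> T" "(s1,l1) \<in> conn_tuples T q" "(s2,l2) \<in> perm_tuples (S - T) (r - q)" "q \<le> r"
      using 3 b by auto
    have "length l1 = q" using *(3) by (auto simp: conn_tuples_def perm_tuples_def mono_lists_def)
    then show ?case
      by (simp only: b prod.case Let_def merged_component[OF S *] merged_filter[OF S *]
          merged_restrict[OF S *])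
  next
    case (4 b)
    obtain T q s1 l1 s2 l2 where b: "b = (T,q,(s1,l1),(s2,l2))" by (metis prod.exhaust_sel)
    have *: "T \<subseteq> S" "m \<in> T" "(s1,l1) \<in> conn_tuples T q" "(s2,l2) \<in> perm_tuples (S - T) (r - q)" "q \<le> r"
      using 4 b by auto
    show ?case by (simp only: b prod.case merged[OF S *])
  next
    case (5 x)
    obtain s l where x: "x = (s,l)" by (cases x)
    have s: "s permutes S" "l \<in> mono_lists S r" "set l \<subseteq> S \<times> S" using 5 x
        by (auto simp: perm_tuples_def mono_lists_def)
    show ?case
      using tuple_weight_split[OF S s(1,3) component_props(1,3)[OF s(1,3) m]] by (simp add: x Let_def)
  qed
  finally show ?thesis by (simp add: full_sum_eq)
qed

section \<open>Cycles, components and the genus of a connected tuple\<close>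

section \<open>Non-negativity of the genus\<close>

definition closed_sets :: "nat set \<Rightarrow> (nat \<Rightarrow> nat) \<Rightarrow> (nat \<times> nat) list \<Rightarrow> nat set set" where
  "closed_sets S s l = {T. T \<subseteq> S \<and> inv_under s l T}"

definition num_cycles :: "nat set \<Rightarrow> (nat \<Rightarrow> nat) \<Rightarrow> nat" where
  "num_cycles S p = card (orbit p ` S)"

lemma finite_closed_sets [simp]: "finite S \<Longrightarrow> finite (closed_sets S s l)"
  by (rule finite_subset[of _ "Pow S"]) (auto simp: closed_sets_def)

lemma inj_on_Union_partition:
  assumes "disjoint P" "{} \<notin> P"
  shows "inj_on Union (Pow P)"
proof (rule inj_onI)
  have "F \<subseteq> G" if h: "F \<in> Pow P" "G \<in> Pow P" "\<Union>F = \<Union>G" for F G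
  proof
    fix X assume X: "X \<in> F"
    then have "X \<in> P" "X \<noteq> {}" using h assms(2) by auto
    then obtain x where x: "x \<in> X" by auto
    then obtain Y where Y: "Y \<in> G" "x \<in> Y" using X h(3) by blast
    have "Y \<in> P" using Y h by auto
    have "X = Y"
    proof (rule ccontr)
      assume "X \<noteq> Y"
      then have "X \<inter> Y = {}" using disjointD[OF assms(1) \<open>X \<in> P\<close> \<open>Y \<in> P\<close>] by simp
      then show False using x Y by auto
    qed
    then show "X \<in> G" using Y by simp
  qed
  then show "F = G" if "F \<in> Pow P" "G \<in> Pow P" "\<Union>F = \<Union>G" for F G
    using that by (metis subset_antisym)
qed

text \<open>The closed sets of a single permutation are exactly the unions of its cycles.\<close>

lemma card_closed_sets_perm:
  assumes S: "finite S" "p permutes S"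
  shows "card (closed_sets S p []) = 2 ^ num_cycles S p"
proof -
  have orb: "x \<in> orbit p x" for x
    using S by (intro permutation_self_in_orbit) (auto simp: permutation_permutes)
  have "closed_sets S p [] = Union ` Pow (orbit p ` S)"
  proof (intro Set.equalityI subsetI)
    fix T assume "T \<in> closed_sets S p []"
    then have T: "T \<subseteq> S" "\<And>x. p x \<in> T \<longleftrightarrow> x \<in> T" by (auto simp: closed_sets_def inv_under_def)
    have sub: "orbit p x \<subseteq> T" if "x \<in> T" for x
    proof
      fix y assume "y \<in> orbit p x"
      then show "y \<in> T" by induction (use that T in auto)
    qed
    have "T = \<Union> (orbit p ` T)" using sub orb by blast
    moreover have "orbit p ` T \<in> Pow (orbit p ` S)" using T by auto
    ultimately show "T \<in> Union ` Pow (orbit p ` S)" by blast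
  next
    fix T assume "T \<in> Union ` Pow (orbit p ` S)"
    then obtain F where F: "F \<subseteq> orbit p ` S" "T = \<Union>F" by auto
    have TS: "T \<subseteq> S" using F permutes_orbit_subset[OF S(2)] by auto
    moreover have "inv_under p [] T"
    proof (rule inv_underI[OF S(2) finite_subset[OF TS S(1)]])
      show "p ` T \<subseteq> T"
      proof (clarify)
        fix x assume "x \<in> T"
        then obtain y where y: "orbit p y \<in> F" "x \<in> orbit p y" using F by auto
        then have "p x \<in> orbit p y" by (auto intro: orbit.step)
        then show "p x \<in> T" using y F by auto
      qed
    qed simp
    ultimately show "T \<in> closed_sets S p []" by (simp add: closed_sets_def)
  qed
  moreover have "inj_on Union (Pow (orbit p ` S))"
    using orb by (intro inj_on_Union_partition disjoint_orbits S) auto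
  ultimately show ?thesis
    using S by (simp add: card_image card_Pow num_cycles_def)
qed

lemma inv_under_symdiff:
  assumes "inv_under s l T" "inv_under s l T'"
  shows "inv_under s l (sym_diff T T')"
  using assms unfolding inv_under_def by blast

definition separated :: "nat set \<Rightarrow> (nat \<Rightarrow> nat) \<Rightarrow> (nat \<times> nat) list \<Rightarrow> nat \<Rightarrow> nat \<Rightarrow> bool" where
  "separated S s l a b \<longleftrightarrow> (\<exists>T\<in>closed_sets S s l. a \<in> T \<and> b \<notin> T)"

lemma separated_sym:
  assumes "s permutes S" "set l \<subseteq> S \<times> S" "a \<in> S" "b \<in> S" "T \<in> closed_sets S s l" "(a \<in> T) \<noteq> (b \<in> T)"
  shows "separated S s l a b"
proof (cases "a \<in> T")
  case False
  have "S - T \<in> closed_sets S s l"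
    using assms inv_under_diff[OF inv_under_S[OF assms(1,2)]] by (auto simp: closed_sets_def)
  then show ?thesis using assms False by (auto simp: separated_def)
qed (use assms in \<open>auto simp: separated_def\<close>)

text \<open>If a closed set separates \<open>a\<close> from \<open>b\<close>, symmetric difference
  with it is an involution that exchanges separating and non-separating closed sets, so exactly half
  of them survive the new condition. Otherwise all do.\<close>

lemma card_closed_sets_snoc:
  assumes S: "finite S" "s permutes S" "set l \<subseteq> S \<times> S" "a \<in> S" "b \<in> S"
  shows "card (closed_sets S s l) = (if separated S s l a b then 2 else 1)
      * card {T \<in> closed_sets S s l. a \<in> T \<longleftrightarrow> b \<in> T}"
proof -
  let ?K = "closed_sets S s l"
  let ?E = "{T \<in> ?K. a \<in> T \<longleftrightarrow> b \<in> T}" and ?F = "{T \<in> ?K. (a \<in> T) \<noteq> (b \<in> T)}"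
  have fin: "finite ?K" using S by simp
  have "card ?K = card (?E \<union> ?F)" by (rule arg_cong[of _ _ card]) auto
  also have "\<dots> = card ?E + card ?F" using fin by (intro card_Un_disjoint) auto
  finally have K: "card ?K = card ?E + card ?F" .
  show ?thesis
  proof (cases "separated S s l a b")
    case True
    then obtain D where D: "D \<in> ?K" "a \<in> D" "b \<notin> D" by (auto simp: separated_def)
    have cl: "sym_diff T D \<in> ?K" if "T \<in> ?K" for T
    proof -
      have "inv_under s l (sym_diff T D)" using that D
          by (intro inv_under_symdiff) (auto simp: closed_sets_def)
      then show ?thesis using that D by (auto simp: closed_sets_def)
    qed
    have "bij_betw (\<lambda>T. sym_diff T D) ?E ?F"
    proof (rule bij_betw_byWitness[where f' = "\<lambda>T. sym_diff T D"])
      show "(\<lambda>T. sym_diff T D) ` ?E \<subseteq> ?F" "(\<lambda>T. sym_diff T D) ` ?F \<subseteq> ?E"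
        using cl D by (simp_all only: image_subset_iff mem_Collect_eq) blast+
    qed auto
    then have "card ?E = card ?F" by (rule bij_betw_same_card)
    then show ?thesis using K True by simp
  next
    case False
    then have "?F = {}" using separated_sym[OF S(2-5)] by blast
    then have "card ?F = 0" by (simp only: card.empty)
    then show ?thesis using K False by simp
  qed
qed

text \<open>With an empty list, being separated means lying in different cycles. This is the
  dichotomy that a transposition either joins two cycles or splits one.\<close>

lemma separated_swp:
  assumes S: "finite S" "p permutes S" "a \<in> S" "b \<in> S" "a \<noteq> b"
  shows "separated S (p \<circ> swp a b) [] a b \<longleftrightarrow> \<not> separated S p [] a b"
proof -
  let ?q = "p \<circ> swp a b"
  have q: "?q permutes S" using S by (intro permutes_compose permutes_swap_id)
  have qa: "?q a = p b" "?q b = p a" and qx: "\<And>x. x \<noteq> a \<Longrightarrow> x \<noteq> b \<Longrightarrow> ?q x = p x" by simp_all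
  have "\<not> (separated S p [] a b \<and> separated S ?q [] a b)"
  proof
    assume "separated S p [] a b \<and> separated S ?q [] a b"
    then obtain T T' where T: "T \<subseteq> S" "\<And>x. p x \<in> T \<longleftrightarrow> x \<in> T" "a \<in> T" "b \<notin> T"
      and T': "\<And>x. ?q x \<in> T' \<longleftrightarrow> x \<in> T'" "a \<in> T'" "b \<notin> T'"
      unfolding separated_def closed_sets_def inv_under_def by blast
    \<comment> \<open>For an element of \<open>?Y\<close> its preimage under \<open>p\<close> lies
      in \<open>?Y\<close> again and differs from \<open>a\<close>. As \<open>a\<close> belongs to
      \<open>?Y\<close>, this contradicts finiteness.\<close>
    let ?Y = "T \<inter> T'"
    have fin: "finite ?Y" using T S finite_subset by blast
    have "?Y \<subseteq> p ` (?Y - {a})"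
    proof
      fix y assume y: "y \<in> ?Y"
      obtain x where x: "y = p x" using S(2) by (metis permutes_inverses(1))
      have xT: "x \<in> T" using y x T(2) by auto
      then have xb: "x \<noteq> b" using T by auto
      have xa: "x \<noteq> a"
      proof
        assume "x = a"
        then have "?q b \<in> T'" using y x qa by simp
        then show False using T'(1,3) by blast
      qed
      have "?q x \<in> T'" using y x qx[OF xa xb] by simp
      then have "x \<in> T'" using T'(1) by blast
      then show "y \<in> p ` (?Y - {a})" using x xT xa by auto
    qed
    then have "card ?Y \<le> card (p ` (?Y - {a}))" using fin by (intro card_mono) auto
    also have "\<dots> \<le> card (?Y - {a})" using fin by (intro card_image_le) auto
    also have "\<dots> < card ?Y" using fin T T' by (intro psubset_card_mono) auto
    finally show False by simp
  qed
  moreover have "separated S ?q [] a b" if ns: "\<not> separated S p [] a b"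
  proof -
    have bb: "b \<in> orbit p b"
      using S by (intro permutation_self_in_orbit) (auto simp: permutation_permutes)
    have Osub: "orbit p b \<subseteq> S" by (rule permutes_orbit_subset[OF S(2,4)])
    have "inv_under p [] (orbit p b)"
      by (rule inv_underI[OF S(2) finite_subset[OF Osub S(1)]]) (auto intro: orbit.step)
    then have Ocl: "orbit p b \<in> closed_sets S p []" using Osub by (simp add: closed_sets_def)
    have "a \<in> orbit p b"
      using separated_sym[OF S(2) _ S(3,4) Ocl] ns bb by auto
    then obtain n0 where n0: "0 < n0" "(p ^^ n0) b = a" by (auto simp: orbit_altdef)
    \<comment> \<open>The first time after the start at which the orbit of \<open>b\<close> meets
      \<open>a\<close> or \<open>b\<close>. It must meet \<open>a\<close>: a return to
      \<open>b\<close> would close the cycle without reaching \<open>a\<close>.\<close>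
    define n where "n = (LEAST n. 0 < n \<and> (p ^^ n) b \<in> {a,b})"
    have n: "0 < n" "(p ^^ n) b \<in> {a,b}"
      using LeastI[of "\<lambda>n. 0 < n \<and> (p ^^ n) b \<in> {a,b}" n0] n0 by (auto simp: n_def)
    have least: "(p ^^ k) b \<notin> {a,b}" if "0 < k" "k < n" for k
      using not_less_Least[of k "\<lambda>n. 0 < n \<and> (p ^^ n) b \<in> {a,b}"] that by (auto simp: n_def)
    have na: "(p ^^ n) b = a"
    proof (rule ccontr)
      assume "(p ^^ n) b \<noteq> a"
      then have "(p ^^ n) b = b" using n by auto
      from orbit_altdef_bounded[OF this n(1)] obtain k where k: "k < n" "(p ^^ k) b = a"
        using \<open>a \<in> orbit p b\<close> by auto
      then show False using least[of k] S(5) by (cases k) auto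
    qed
    \<comment> \<open>The arc from \<open>p b\<close> up to \<open>a\<close>. Since
      \<open>?q a = p b\<close>, the transposition closes this arc into a cycle that omits
      \<open>b\<close>.\<close>
    define Y where "Y = (\<lambda>k. (p ^^ k) b) ` {1..n}"
    have YS: "Y \<subseteq> S"
      using permutes_in_image[OF permutes_funpow[OF S(2)]] S(4) by (auto simp: Y_def)
    have aY: "a \<in> Y" using na n(1) by (auto simp: Y_def intro!: image_eqI[of _ _ n])
    have bY: "b \<notin> Y"
    proof
      assume "b \<in> Y"
      then obtain k where k: "1 \<le> k" "k \<le> n" "b = (p ^^ k) b" by (auto simp: Y_def)
      then show False using least[of k] na S(5) by (cases "k = n") auto
    qed
    have "inv_under ?q [] Y"
    proof (rule inv_underI[OF q finite_subset[OF YS S(1)]])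
      show "?q ` Y \<subseteq> Y"
      proof (rule image_subsetI)
        fix y assume "y \<in> Y"
        then obtain k where k: "1 \<le> k" "k \<le> n" "y = (p ^^ k) b" by (auto simp: Y_def)
        show "?q y \<in> Y"
        proof (cases "k = n")
          case True
          then have "?q y = (p ^^ 1) b" using k na qa by simp
          then show ?thesis using n(1) by (auto simp: Y_def intro!: image_eqI[of _ _ 1])
        next
          case False
          then have "y \<noteq> a" "y \<noteq> b" using least[of k] k by auto
          then have "?q y = (p ^^ Suc k) b" using k qx by simp
          then show ?thesis using k False by (auto simp: Y_def intro!: image_eqI[of _ _ "Suc k"])
        qed
      qed
    qed simp
    then show ?thesis using YS aY bY by (auto simp: separated_def closed_sets_def)
  qed
  ultimately show ?thesis by blast
qed

lemma inv_under_comp: "inv_under s l T \<Longrightarrow> inv_under (s \<circ> transp_prod l) [] T"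
  using transp_prod_filter[of l T] by (fastforce simp: inv_under_def)

lemma closed_sets_snoc:
  "closed_sets S s (l @ [(a,b)]) = {T \<in> closed_sets S s l. a \<in> T \<longleftrightarrow> b \<in> T}"
  by (auto simp: closed_sets_def inv_under_def)

lemma common_closed_sets:
  "{T \<in> closed_sets S (p \<circ> swp a b) []. a \<in> T \<longleftrightarrow> b \<in> T} = {T \<in> closed_sets S p []. a \<in> T \<longleftrightarrow> b \<in> T}"
proof -
  have "inv_under (p \<circ> swp a b) [] T \<longleftrightarrow> inv_under p [] T" if ab: "a \<in> T \<longleftrightarrow> b \<in> T" for T
  proof -
    have sw: "swp a b x \<in> T \<longleftrightarrow> x \<in> T" for x using ab by (auto simp: Transposition.transpose_def)
    show ?thesis
    proof
      assume tensor_trace: "inv_under (p \<circ> swp a b) [] T"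
      have "p x \<in> T \<longleftrightarrow> x \<in> T" for x
      proof -
        have "(p \<circ> swp a b) (swp a b x) \<in> T \<longleftrightarrow> swp a b x \<in> T" using tensor_trace unfolding inv_under_def
            by blast
        then show ?thesis using sw by simp
      qed
      then show "inv_under p [] T" by (simp add: inv_under_def)
    next
      assume "inv_under p [] T"
      then show "inv_under (p \<circ> swp a b) [] T" using sw by (simp add: inv_under_def)
    qed
  qed
  then show ?thesis by (auto simp: closed_sets_def)
qed

text \<open>There are \<open>2 ^ c\<close> invariant sets if there are \<open>c\<close> components, so this is a statement on numbers of
  components in exponential form. It becomes the Riemann-Hurwitz relation in the connected case.\<close>

lemma closed_sets_genus:
  assumes S: "finite S" "s permutes S"
  shows "set l \<subseteq> {(a,b). a \<in> S \<and> b \<in> S \<and> a \<noteq> b} \<Longrightarrow>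
    \<exists>g. 2 ^ length l * card (closed_sets S s l) ^ 2 =
      card (closed_sets S s []) * card (closed_sets S (s \<circ> transp_prod l) []) * 4 ^ g"
proof (induction l rule: rev_induct)
  case Nil
  show ?case by (rule exI[of _ 0]) (simp add: power2_eq_square)
next
  case (snoc x l)
  obtain a b where x: "x = (a,b)" by (cases x)
  have ab: "a \<in> S" "b \<in> S" "a \<noteq> b" and l: "set l \<subseteq> {(a,b). a \<in> S \<and> b \<in> S \<and> a \<noteq> b}" "set l \<subseteq> S \<times> S"
    using snoc.prems x by auto
  let ?p = "s \<circ> transp_prod l"
  let ?q = "?p \<circ> swp a b"
  have p: "?p permutes S" by (intro permutes_compose S transp_prod_permutes l)
  have q: "?q permutes S" by (intro permutes_compose p permutes_swap_id ab)
  have tq: "s \<circ> transp_prod (l @ [(a,b)]) = ?q" by (simp add: comp_assoc)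
  define c where "c = card {T \<in> closed_sets S ?p []. a \<in> T \<longleftrightarrow> b \<in> T}"
  define k where "k = card (closed_sets S s (l @ [(a,b)]))"
  obtain g where IH: "2 ^ length l * card (closed_sets S s l) ^ 2 =
      card (closed_sets S s []) * card (closed_sets S ?p []) * 4 ^ g"
    using snoc.IH[OF l(1)] by blast
  have Kp: "card (closed_sets S ?p []) = (if separated S ?p [] a b then 2 else 1) * c"
    unfolding c_def by (rule card_closed_sets_snoc[OF S(1) p _ ab(1,2)]) simp
  have Kq: "card (closed_sets S ?q []) = (if separated S ?q [] a b then 2 else 1) * c"
    using card_closed_sets_snoc[OF S(1) q _ ab(1,2), of "[]"]
        unfolding common_closed_sets[of S ?p a b] c_def by simp
  have Kl: "card (closed_sets S s l) = (if separated S s l a b then 2 else 1) * k"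
    unfolding k_def closed_sets_snoc by (rule card_closed_sets_snoc[OF S l(2) ab(1,2)])
  have sq: "separated S ?q [] a b \<longleftrightarrow> \<not> separated S ?p [] a b" by (rule separated_swp[OF S(1) p ab])
  have sl: "separated S s l a b \<Longrightarrow> separated S ?p [] a b"
    using inv_under_comp by (auto simp: separated_def closed_sets_def)
  have "\<exists>g'. 2 ^ Suc (length l) * k ^ 2 = card (closed_sets S s []) * card (closed_sets S ?q [])
      * 4 ^ g'"
  \<comment> \<open>Joining two components or splitting a cycle keeps \<open>g\<close>. Joining two
    cycles of the same component adds a handle and raises \<open>g\<close> by one.\<close>
  proof (cases "separated S s l a b")
    case True
    then show ?thesis using IH sl sq unfolding Kp Kq Kl
      by (intro exI[of _ g]) (simp add: power_mult_distrib mult_ac)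
  next
    case False
    show ?thesis
    proof (cases "separated S ?p [] a b")
      case True
      then show ?thesis using IH False sq unfolding Kp Kq Kl
        by (intro exI[of _ "Suc g"]) (simp add: mult_ac)
    next
      case f: False
      then show ?thesis using IH False sq unfolding Kp Kq Kl
        by (intro exI[of _ g]) (simp add: mult_ac)
    qed
  qed
  then show ?case unfolding x tq k_def length_append_singleton .
qed

text \<open>A connected tuple has exactly two invariant sets, so \<open>closed_sets_genus\<close>
  becomes an equation between powers of two, and the exponents can be compared.\<close>

theorem genus_exists:
  assumes S: "finite S" "S \<noteq> {}" and x: "(s, l) \<in> conn_tuples S r"
  shows "\<exists>g. r + 2 = num_cycles S s + num_cycles S (s \<circ> transp_prod l) + 2 * g"
proof -
  have s: "s permutes S" and l: "l \<in> mono_lists S r" and c: "conn S s l"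
    using x by (auto simp: conn_tuples_def perm_tuples_def)
  have l': "set l \<subseteq> {(a,b). a \<in> S \<and> b \<in> S \<and> a \<noteq> b}" "set l \<subseteq> S \<times> S" and r: "length l = r"
    using l by (auto simp: mono_lists_def)
  have t: "s \<circ> transp_prod l permutes S" by (intro permutes_compose s transp_prod_permutes l')
  have "closed_sets S s l = {{}, S}"
    using c inv_under_empty inv_under_S[OF s l'(2)] by (auto simp: closed_sets_def conn_def)
  then have 2: "card (closed_sets S s l) = 2" using S(2) by simp
  obtain g where "2 ^ length l * card (closed_sets S s l) ^ 2 =
      card (closed_sets S s []) * card (closed_sets S (s \<circ> transp_prod l) []) * 4 ^ g"
    using closed_sets_genus[OF S(1) s l'(1)] by blast
  then have "(2::nat) ^ r * 2 ^ 2 = 2 ^ num_cycles S s * 2 ^ num_cycles S (s \<circ> transp_prod l)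
      * (2 ^ 2) ^ g"
    unfolding 2 r card_closed_sets_perm[OF S(1) s] card_closed_sets_perm[OF S(1) t] by simp
  then have "(2::nat) ^ (r + 2) = 2 ^ (num_cycles S s + num_cycles S (s \<circ> transp_prod l) + 2 * g)"
    unfolding power_add power_mult .
  then show ?thesis by (intro exI[of _ g]) (simp only: power_inject_exp[of "2::nat"]
      one_less_numeral_iff semiring_norm)
qed

section \<open>Power series of the integral and the recursion for its logarithm\<close>

section \<open>The integral and its logarithm near the origin\<close>

context haar
begin

lemma bdd_meas_trace:
  assumes "A \<in> carrier_mat N N" "B \<in> carrier_mat N N"
  shows "bdd_meas (\<lambda>U. mat_trace (A * U * B * mat_adjoint U))"
proof -
  have g: "bdd_meas (\<lambda>U. \<Sum>i<N. \<Sum>j<N. A $$ (j, i) * conj_mat N (\<lambda>a b. B $$ (a, b)) U i j)"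
    by (intro bdd_meas_sum bdd_meas_mult bdd_meas_const bdd_meas_conj_mat) auto
  have eq: "mat_trace (A * U * B * mat_adjoint U) = (\<Sum>i<N. \<Sum>j<N. A $$ (j, i)
      * conj_mat N (\<lambda>a b. B $$ (a, b)) U i j)"
    if "U \<in> space \<kappa>" for U
    by (rule trace_eq_conj_mat[OF assms]) (use that unitary_carrier in \<open>auto simp: space_kappa\<close>)
  have "(\<lambda>U. mat_trace (A * U * B * mat_adjoint U)) \<in> borel_measurable \<kappa>"
  proof (subst measurable_cong)
    show "mat_trace (A * U * B * mat_adjoint U) = (\<Sum>i<N. \<Sum>j<N. A $$ (j, i)
        * conj_mat N (\<lambda>a b. B $$ (a, b)) U i j)"
      if "U \<in> space \<kappa>" for U by (rule eq[OF that])
  qed (use g in \<open>simp add: bdd_meas_def\<close>)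
  moreover obtain K where "\<And>U. U \<in> space \<kappa> \<Longrightarrow> norm (\<Sum>i<N. \<Sum>j<N. A $$ (j, i)
      * conj_mat N (\<lambda>a b. B $$ (a, b)) U i j) \<le> K"
    using g unfolding bdd_meas_def by blast
  then have "\<forall>U\<in>space \<kappa>. norm (mat_trace (A * U * B * mat_adjoint U)) \<le> K" using eq by simp
  ultimately show ?thesis unfolding bdd_meas_def by blast
qed

text \<open>A bound on \<open>Y\<close> supplies an exponential series as majorant, which permits
  termwise integration.\<close>

lemma exp_integral_sums:
  assumes Y: "bdd_meas Y"
  shows "(\<lambda>n. (LINT U|\<kappa>. Y U ^ n) / fact n * z ^ n) sums (LINT U|\<kappa>. exp (z * Y U))"
proof -
  obtain K where K: "\<And>U. U \<in> space \<kappa> \<Longrightarrow> norm (Y U) \<le> K" using Y unfolding bdd_meas_def by blast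
  have pw: "bdd_meas (\<lambda>U. Y U ^ n)" for n
    using bdd_meas_prod[of "{..<n}" "\<lambda>_. Y"] Y by simp
  define f where "f = (\<lambda>n U. (z ^ n / fact n) * Y U ^ n)"
  have gf: "bdd_meas (f n)" for n unfolding f_def by (intro bdd_meas_mult bdd_meas_const pw)
  have bound: "norm (f n U) \<le> (norm z * K) ^ n / fact n" if "U \<in> space \<kappa>" for n U
  proof -
    have "norm (Y U) ^ n \<le> K ^ n" using K[OF that] by (intro power_mono) auto
    then have "norm z ^ n / fact n * norm (Y U) ^ n \<le> norm z ^ n / fact n * K ^ n"
      by (intro mult_left_mono) auto
    then show ?thesis by (simp add: f_def norm_mult norm_divide norm_power power_mult_distrib)
  qed
  have sm: "summable (\<lambda>n. (norm z * K) ^ n / fact n)"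
    using summable_exp_generic[of "norm z * K"]
        by (simp add: divide_inverse scaleR_conv_of_real mult.commute)
  have smU: "summable (\<lambda>n. norm (f n U))" if "U \<in> space \<kappa>" for U
    by (rule summable_comparison_test'[OF sm]) (use bound[OF that] in auto)
  have int: "(\<integral>U. norm (f n U) \<partial>\<kappa>) \<le> (norm z * K) ^ n / fact n" for n
  proof -
    have "(\<integral>U. norm (f n U) \<partial>\<kappa>) \<le> (\<integral>U. (norm z * K) ^ n / fact n \<partial>\<kappa>)"
      by (intro integral_mono integrable_norm bdd_meas_integrable gf bound) auto
    then show ?thesis by (simp add: prob_space)
  qed
  have "(\<lambda>n. LINT U|\<kappa>. f n U) sums (LINT U|\<kappa>. (\<Sum>n. f n U))"
  proof (rule sums_integral)
    show "integrable \<kappa> (f n)" for n by (rule bdd_meas_integrable[OF gf])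
    show "AE U in \<kappa>. summable (\<lambda>n. norm (f n U))" by (intro AE_I2 smU)
    show "summable (\<lambda>n. \<integral>U. norm (f n U) \<partial>\<kappa>)"
      by (rule summable_comparison_test'[OF sm]) (use int in auto)
  qed
  moreover have "(\<Sum>n. f n U) = exp (z * Y U)" for U
    unfolding exp_def f_def by (simp add: power_mult_distrib scaleR_conv_of_real divide_inverse mult_ac)
  ultimately show ?thesis by (simp add: f_def mult_ac)
qed

end

text \<open>Comparison of coefficients in f' = c F' f. Multiplying by factorials turns the
  convolution into a binomial one, the form that counts subsets.\<close>

lemma log_derivative_recursion:
  fixes f F :: "complex \<Rightarrow> complex" and c :: complex
  assumes f: "f has_fps_expansion G" and r: "r > 0" and F: "F holomorphic_on ball 0 r"
    and fF: "\<And>z. z \<in> ball 0 r \<Longrightarrow> f z = exp (c * F z)"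
  shows "fps_nth G (Suc n) * fact (Suc n) =
    c * (\<Sum>k\<le>n. of_nat (n choose k) * (deriv ^^ (Suc k)) F 0 * (fps_nth G (n - k) * fact (n - k)))"
proof -
  define H where "H = fps_expansion F 0"
  have H: "F has_fps_expansion H"
    unfolding H_def by (rule has_fps_expansion_fps_expansion[of "ball 0 r"]) (use r F in auto)
  have Hn: "fps_nth H k = (deriv ^^ k) F 0 / fact k" for k by (rule fps_nth_fps_expansion[OF H])
  have D: "deriv f has_fps_expansion fps_deriv G" by (rule has_fps_expansion_deriv[OF f])
  have R: "(\<lambda>z. c * deriv F z * f z) has_fps_expansion fps_const c * fps_deriv H * G"
    by (intro has_fps_expansion_mult has_fps_expansion_cmult_left has_fps_expansion_deriv H f)
  have eq: "deriv f z = c * deriv F z * f z" if z: "z \<in> ball 0 r" for z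
  proof -
    have "(F has_field_derivative deriv F z) (at z)"
      using F z by (intro holomorphic_derivI[of _ "ball 0 r"]) auto
    then have "((\<lambda>z. exp (c * F z)) has_field_derivative exp (c * F z) * (c * deriv F z)) (at z)"
      by (auto intro!: derivative_eq_intros)
    moreover have ev: "eventually (\<lambda>w. exp (c * F w) = f w) (nhds z)"
      using eventually_nhds_in_open[of "ball 0 r" z] z fF by (auto elim!: eventually_mono)
    ultimately have "(f has_field_derivative exp (c * F z) * (c * deriv F z)) (at z)"
      by (simp only: DERIV_cong_ev[OF refl ev refl])
    then show ?thesis using fF[OF z] by (simp add: DERIV_imp_deriv)
  qed
  have "eventually (\<lambda>z. deriv f z = c * deriv F z * f z) (nhds 0)"
    using eventually_nhds_in_open[of "ball 0 r" 0] r eq by (auto elim!: eventually_mono)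
  then have D': "deriv f has_fps_expansion fps_const c * fps_deriv H * G"
    using R unfolding has_fps_expansion_def by (auto elim: eventually_elim2)
  have "fps_nth (fps_deriv G) n = fps_nth (fps_const c * fps_deriv H * G) n"
    using fps_nth_fps_expansion[OF D] fps_nth_fps_expansion[OF D'] by simp
  also have "\<dots> = c * (\<Sum>k\<le>n. of_nat (Suc k) * fps_nth H (Suc k) * fps_nth G (n - k))"
    unfolding mult.assoc fps_mult_left_const_nth by (simp add: fps_mult_nth atLeast0AtMost mult.assoc)
  finally have *: "of_nat (Suc n) * fps_nth G (Suc n) =
     c * (\<Sum>k\<le>n. of_nat (Suc k) * fps_nth H (Suc k) * fps_nth G (n - k))" by simp
  have "fps_nth G (Suc n) * fact (Suc n) = fact n * (of_nat (Suc n) * fps_nth G (Suc n))"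
    by (simp add: mult_ac)
  also have "\<dots> = c * (\<Sum>k\<le>n. fact n * (of_nat (Suc k) * fps_nth H (Suc k) * fps_nth G (n - k)))"
    unfolding * by (simp add: sum_distrib_left mult.left_commute)
  also have "(\<Sum>k\<le>n. fact n * (of_nat (Suc k) * fps_nth H (Suc k) * fps_nth G (n - k))) =
    (\<Sum>k\<le>n. of_nat (n choose k) * (deriv ^^ (Suc k)) F 0 * (fps_nth G (n - k) * fact (n - k)))"
  proof (intro sum.cong refl)
    fix k assume "k \<in> {..n}"
    then have k: "k \<le> n" by simp
    have b: "(fact n :: complex) = of_nat (n choose k) * (fact k * fact (n - k))"
    proof -
      have "(fact n :: nat) = (n choose k) * (fact k * fact (n - k))"
        using binomial_fact_lemma[OF k] by (simp only: mult.commute)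
      then have "of_nat (fact n) = (of_nat ((n choose k) * (fact k * fact (n - k))) :: complex)"
        by (rule arg_cong)
      then show ?thesis by (simp only: of_nat_mult of_nat_fact)
    qed
    have d: "of_nat (Suc k) * fps_nth H (Suc k) * fact k = (deriv ^^ (Suc k)) F 0"
    proof -
      have "fps_nth H (Suc k) * fact (Suc k) = (deriv ^^ (Suc k)) F 0"
        using Hn[of "Suc k"] unfolding nonzero_eq_divide_eq[OF fact_nonzero] .
      then show ?thesis by (simp only: fact_Suc mult_ac)
    qed
    show "fact n * (of_nat (Suc k) * fps_nth H (Suc k) * fps_nth G (n - k)) =
       of_nat (n choose k) * (deriv ^^ (Suc k)) F 0 * (fps_nth G (n - k) * fact (n - k))"
      unfolding b d[symmetric] by (simp only: mult_ac)
  qed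
  finally show ?thesis .
qed

text \<open>Near the origin \<open>f\<close> stays within distance one of its value 1, hence off the
  branch cut of the principal logarithm.\<close>

lemma log_exists:
  fixes f :: "complex \<Rightarrow> complex"
  assumes f: "f has_fps_expansion G" "f 0 = 1" and c: "c \<noteq> 0"
  shows "\<exists>F. F 0 = 0 \<and> (\<exists>r>0. F holomorphic_on ball 0 r \<and> (\<forall>z\<in>ball 0 r. f z = exp (c * F z)))"
proof -
  obtain s where s: "open s" "0 \<in> s" "f holomorphic_on s"
    using has_fps_expansion_imp_holomorphic[OF f(1)] by metis
  have cont: "continuous (at 0) f"
    using s holomorphic_on_imp_continuous_on[OF s(3)] continuous_on_eq_continuous_at[OF s(1)] by blast
  have "\<exists>d>0. \<forall>z. dist z 0 < d \<longrightarrow> dist (f z) (f 0) < 1"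
    by (rule cont[unfolded continuous_at_eps_delta, rule_format]) simp
  then obtain r1 where r1: "r1 > 0" "\<And>z. dist z 0 < r1 \<Longrightarrow> dist (f z) 1 < 1"
    using f(2) by auto
  obtain r2 where r2: "r2 > 0" "ball 0 r2 \<subseteq> s" using s open_contains_ball by blast
  define r where "r = min r1 r2"
  have r: "r > 0" using r1 r2 by (simp add: r_def)
  have fh: "f holomorphic_on ball 0 r"
    by (rule holomorphic_on_subset[OF s(3)]) (use r2 in \<open>auto simp: r_def\<close>)
  have near: "dist (f z) 1 < 1" if "z \<in> ball 0 r" for z
    using that r1(2)[of z] by (auto simp: r_def dist_commute)
  have nz: "f z \<notin> \<real>\<^sub>\<le>\<^sub>0" if "z \<in> ball 0 r" for z
  proof
    assume "f z \<in> \<real>\<^sub>\<le>\<^sub>0"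
    then have "Re (f z) \<le> 0" by (auto simp: complex_nonpos_Reals_iff)
    moreover have "\<bar>Re (f z - 1)\<bar> < 1"
      using near[OF that] abs_Re_le_cmod[of "f z - 1"] by (simp add: dist_norm)
    ultimately show False by simp
  qed
  let ?F = "\<lambda>z. Ln (f z) / c"
  have "?F holomorphic_on ball 0 r"
    by (intro holomorphic_intros fh nz) (use c in auto)
  moreover have "f z = exp (c * ?F z)" if "z \<in> ball 0 r" for z
  proof -
    have "f z \<noteq> 0" using nz[OF that] by auto
    then show ?thesis using c by simp
  qed
  ultimately show ?thesis using r f(2) by (intro exI[of _ ?F]) auto
qed

text \<open>\<open>F_log\<close> is a choice and is known only through its specification; the
  recursion holds for every admissible representative. \<open>mI n\<close> is the n-th derivative of
  the integral at the origin.\<close>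

theorem (in haar) F_log_recursion:
  assumes N: "N > 0" and AB: "A \<in> carrier_mat N N" "B \<in> carrier_mat N N"
  defines "mI \<equiv> \<lambda>n. (- of_nat N) ^ n * (LINT U|\<kappa>. mat_trace (A * U * B * mat_adjoint U) ^ n)"
    and "mF \<equiv> \<lambda>n. (deriv ^^ n) (F_log \<kappa> N A B) 0"
  shows "mI (Suc n) = of_nat N ^ 2 * (\<Sum>k\<le>n. of_nat (n choose k) * mF (Suc k) * mI (n - k))"
proof -
  let ?Y = "\<lambda>U. - of_nat N * mat_trace (A * U * B * mat_adjoint U)"
  have Y: "bdd_meas ?Y" by (intro bdd_meas_mult bdd_meas_const bdd_meas_trace AB)
  have I: "I_int \<kappa> N A B z = (LINT U|\<kappa>. exp (z * ?Y U))" for z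
    by (simp add: I_int_def mult.assoc)
  have mI: "(LINT U|\<kappa>. ?Y U ^ n) = mI n" for n
    by (simp only: mI_def power_mult_distrib integral_mult_right_zero)
  define G where "G = Abs_fps (\<lambda>n. mI n / fact n)"
  have G: "I_int \<kappa> N A B has_fps_expansion G"
    using exp_integral_sums[OF Y] unfolding I[symmetric] mI
    by (intro has_fps_expansionI always_eventually allI) (simp add: G_def)
  have I0: "I_int \<kappa> N A B 0 = 1" unfolding I by (simp add: prob_space)
  let ?P = "\<lambda>F. F 0 = 0 \<and> (\<exists>r>0. F holomorphic_on ball 0 r \<and>
        (\<forall>z\<in>ball 0 r. I_int \<kappa> N A B z = exp (of_nat N ^ 2 * F z)))"
  have "\<exists>F. ?P F" by (rule log_exists[OF G I0]) (use N in simp)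
  then have "?P (F_log \<kappa> N A B)" unfolding F_log_def by (rule someI_ex)
  then obtain r where r: "r > 0" "F_log \<kappa> N A B holomorphic_on ball 0 r"
    "\<And>z. z \<in> ball 0 r \<Longrightarrow> I_int \<kappa> N A B z = exp (of_nat N ^ 2 * F_log \<kappa> N A B z)" by blast
  have Gn: "fps_nth G k * fact k = mI k" for k by (simp add: G_def)
  show ?thesis
    using log_derivative_recursion[OF G r, of n] unfolding Gn mF_def .
qed

lemma card_perm_tuples_le:
  assumes "finite S"
  shows "card (perm_tuples S r) \<le> fact (card S) * (card S ^ 2) ^ r"
  unfolding perm_tuples_def card_cartesian_product
  using card_mono_lists[OF assms, of r] card_permutations[OF refl assms] by simp

lemma conn_sum_bound:
  assumes S: "finite S" and K: "\<And>x. x \<in> conn_tuples S r \<Longrightarrow> norm (tuple_weight N A B S x) \<le> K" "K \<ge> 0"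
  shows "norm (conn_sum N A B S r) \<le> fact (card S) * (real (card S ^ 2)) ^ r * K"
proof -
  have "norm (conn_sum N A B S r) \<le> real (card (conn_tuples S r)) * K"
    unfolding conn_sum_def using K(1) by (intro sum_norm_bound)
  also have "real (card (conn_tuples S r)) \<le> real (card (perm_tuples S r))"
    using S by (intro of_nat_mono card_mono) (auto simp: conn_tuples_def)
  also have "real (card (perm_tuples S r)) \<le> real (fact (card S) * (card S ^ 2) ^ r)"
    using card_perm_tuples_le[OF S] by (rule of_nat_mono)
  finally show ?thesis using K(2) by (simp add: mult_right_mono)
qed

lemma tuple_weight_bounded:
  assumes S: "finite S"
  obtains K where "K \<ge> 0" "\<And>r x. x \<in> perm_tuples S r \<Longrightarrow> norm (tuple_weight N A B S x) \<le> K"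
proof -
  define P where "P = {p. p permutes S}"
  have fP: "finite P" unfolding P_def using S by (rule finite_permutations)
  define K where "K = (\<Sum>s\<in>P. norm (ptrace N S (\<lambda>_. B) s)) * (\<Sum>s\<in>P. norm (ptrace N S (\<lambda>_. A) s))"
  have "norm (tuple_weight N A B S x) \<le> K" if "x \<in> perm_tuples S r" for r x
  proof -
    obtain s l where x: "x = (s,l)" by (cases x)
    have s: "s permutes S" and l: "l \<in> mono_lists S r" using that x by (auto simp: perm_tuples_def)
    have "s \<circ> transp_prod l permutes S" using mono_lists_permutes[OF l subset_refl] s
        by (rule permutes_compose)
    then have "s \<circ> transp_prod l \<in> P" by (simp only: P_def mem_Collect_eq)
    then have "norm (ptrace N S (\<lambda>_. A) (s \<circ> transp_prod l)) \<le> (\<Sum>s\<in>P. norm (ptrace N S (\<lambda>_. A) s))"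
      by (rule member_le_sum[where f = "\<lambda>p. norm (ptrace N S (\<lambda>_. A) p)"]) (simp_all add: fP)
    moreover have "norm (ptrace N S (\<lambda>_. B) s) \<le> (\<Sum>s\<in>P. norm (ptrace N S (\<lambda>_. B) s))"
      using fP s by (intro member_le_sum) (auto simp: P_def)
    ultimately show ?thesis unfolding x K_def tuple_weight_def prod.case norm_mult
        by (intro mult_mono) (auto intro: sum_nonneg)
  qed
  moreover have "K \<ge> 0" unfolding K_def by (intro mult_nonneg_nonneg sum_nonneg) auto
  ultimately show ?thesis using that by blast
qed

lemma conn_sum_summable:
  assumes S: "finite S" and y: "norm y * real (card S ^ 2) < 1"
  shows "summable (\<lambda>r. norm (y ^ r * conn_sum N A B S r))"
proof -
  obtain K where K: "K \<ge> 0" "\<And>r x. x \<in> perm_tuples S r \<Longrightarrow> norm (tuple_weight N A B S x) \<le> K"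
    using tuple_weight_bounded[OF S] by metis
  show ?thesis
  proof (rule summable_comparison_test')
    show "summable (\<lambda>r. (fact (card S) * K) * (norm y * real (card S ^ 2)) ^ r)"
      by (intro summable_mult summable_geometric) (use y in \<open>simp add: abs_mult\<close>)
    fix r :: nat
    have "norm (conn_sum N A B S r) \<le> fact (card S) * (real (card S ^ 2)) ^ r * K"
      by (rule conn_sum_bound[OF S _ K(1)]) (use K(2) in \<open>auto simp: conn_tuples_def\<close>)
    then have "norm y ^ r * norm (conn_sum N A B S r) \<le> norm y ^ r * (fact (card S)
        * (real (card S ^ 2)) ^ r * K)"
      by (intro mult_left_mono) auto
    then show "norm (norm (y ^ r * conn_sum N A B S r)) \<le> (fact (card S) * K) * (norm y
        * real (card S ^ 2)) ^ r"
      by (simp add: norm_mult norm_power power_mult_distrib mult_ac)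
  qed
qed

text \<open>Translates a sum over subsets with a marked point, as in
  \<open>exponential_formula\<close>, into the binomial sum of the logarithmic recursion.\<close>

lemma sum_subsets_containing:
  fixes h :: "nat \<Rightarrow> complex"
  assumes S: "finite S" "m \<in> S" "card S = Suc n"
  shows "(\<Sum>T | T \<subseteq> S \<and> m \<in> T. h (card T)) = (\<Sum>k\<le>n. of_nat (n choose k) * h (Suc k))"
proof -
  let ?S = "S - {m}"
  have fS: "finite ?S" and cS: "card ?S = n" using S by auto
  have "(\<Sum>T | T \<subseteq> S \<and> m \<in> T. h (card T)) = (\<Sum>T\<in>Pow ?S. h (Suc (card T)))"
  proof (rule sum.reindex_bij_witness[where i = "insert m" and j = "\<lambda>T. T - {m}"], goal_cases)
    case (5 T)
    then have "finite T" "m \<in> T" using S finite_subset by auto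
    then show ?case by (metis card.remove)
  qed (use S in auto)
  also have "\<dots> = (\<Sum>k\<le>n. \<Sum>T | T \<in> Pow ?S \<and> card T = k. h (Suc (card T)))"
  proof (rule sum.group[symmetric])
    show "finite (Pow ?S)" using fS by simp
    show "card ` Pow ?S \<subseteq> {..n}" using card_mono[OF fS] cS by auto
  qed simp
  also have "\<dots> = (\<Sum>k\<le>n. of_nat (n choose k) * h (Suc k))"
  proof (intro sum.cong refl)
    fix k
    have "(\<Sum>T | T \<in> Pow ?S \<and> card T = k. h (Suc (card T))) = (\<Sum>T | T \<subseteq> ?S \<and> card T = k. h (Suc k))"
      by (intro sum.cong) auto
    then show "(\<Sum>T | T \<in> Pow ?S \<and> card T = k. h (Suc (card T))) = of_nat (n choose k) * h (Suc k)"
      by (simp add: n_subsets[OF fS] cS)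
  qed
  finally show ?thesis .
qed

section \<open>Derivatives of the logarithm as sums over connected tuples\<close>

context haar
begin

context
  fixes A B :: "complex mat"
  assumes AB: "A \<in> carrier_mat N N" "B \<in> carrier_mat N N"
begin

private definition "y = - 1 / (of_nat N :: complex)"
private abbreviation "a \<equiv> \<lambda>i j. A $$ (i, j)"
private abbreviation "b \<equiv> \<lambda>i j. B $$ (i, j)"
private definition "mI n = (- of_nat N) ^ n * (LINT U|\<kappa>. mat_trace (A * U * B * mat_adjoint U) ^ n)"
private definition "mF n = (deriv ^^ n) (F_log \<kappa> N A B) 0"
private definition "Dval S = (\<Sum>r. y ^ r * full_sum N a b S r)"
private definition "Cval S = (\<Sum>r. y ^ r * conn_sum N a b S r)"

private lemma y_small: "N > card S ^ 2 \<Longrightarrow> norm y * real (card S ^ 2) < 1"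
proof -
  assume "N > card S ^ 2"
  then have "real (card S ^ 2) < real N" "N > 0" by (simp_all only: of_nat_less_iff)
  then show ?thesis by (simp add: y_def norm_divide)
qed

private lemma mI_Dval:
  assumes "finite S" "N > card S ^ 2"
  shows "mI (card S) = (-1) ^ card S * Dval S"
  using moment_formula(1)[OF assms AB]
  by (simp add: mI_def Dval_def y_def power_minus[of "of_nat N"] mult.assoc)

text \<open>\<open>exponential_formula\<close> holds for every list length separately. Both factors
  are absolutely summable, also over subsets of \<open>S\<close>, so Cauchy products assemble the
  identities at y = -1/N.\<close>

private lemma Dval_exponential:
  assumes S: "finite S" "N > card S ^ 2" and m: "m \<in> S"
  shows "Dval S = (\<Sum>T | T \<subseteq> S \<and> m \<in> T. Cval T * Dval (S - T))"
proof -
  have sub: "finite T" "N > card T ^ 2" if "T \<subseteq> S" for T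
  proof -
    show "finite T" using that S finite_subset by blast
    have "card T ^ 2 \<le> card S ^ 2" using that S by (intro power_mono card_mono) auto
    then show "N > card T ^ 2" using S(2) by (rule le_less_trans)
  qed
  have *: "(\<lambda>r. \<Sum>q\<le>r. (y ^ q * conn_sum N a b T q) * (y ^ (r - q) * full_sum N a b (S - T) (r
      - q))) sums (Cval T * Dval (S - T))"
    if "T \<subseteq> S" for T
    unfolding Cval_def Dval_def
    by (intro Cauchy_product_sums conn_sum_summable y_small sub that)
       (unfold y_def, intro moment_formula(2) sub AB, auto)
  have "y ^ r * full_sum N a b S r = (\<Sum>T | T \<subseteq> S \<and> m \<in> T. \<Sum>q\<le>r. (y ^ q * conn_sum N a b T q) * (y ^ (r
      - q) * full_sum N a b (S - T) (r - q)))" for r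
  proof -
    have e: "y ^ q * conn_sum N a b T q * (y ^ (r - q) * full_sum N a b (S - T) (r - q)) =
      y ^ r * (conn_sum N a b T q * full_sum N a b (S - T) (r - q))" if "q \<le> r" for q T
    proof -
      have "y ^ r = y ^ q * y ^ (r - q)" using that by (simp add: power_add[symmetric])
      then show ?thesis by simp
    qed
    show ?thesis
      unfolding exponential_formula[OF S(1) m] sum_distrib_left
      by (intro sum.cong refl, rule e[symmetric]) simp
  qed
  then have "Dval S = (\<Sum>r. \<Sum>T | T \<subseteq> S \<and> m \<in> T. \<Sum>q\<le>r. (y ^ q * conn_sum N a b T q) * (y ^ (r - q)
      * full_sum N a b (S - T) (r - q)))"
    unfolding Dval_def by simp
  also have "\<dots> = (\<Sum>T | T \<subseteq> S \<and> m \<in> T. \<Sum>r. \<Sum>q\<le>r. (y ^ q * conn_sum N a b T q) * (y ^ (r - q)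
      * full_sum N a b (S - T) (r - q)))"
    by (rule suminf_sum, rule sums_summable[OF *]) simp
  also have "\<dots> = (\<Sum>T | T \<subseteq> S \<and> m \<in> T. Cval T * Dval (S - T))"
    by (intro sum.cong refl, rule sums_unique[OF *, symmetric]) simp
  finally show ?thesis .
qed

text \<open>Both sides obey the same triangular recursion. The subset \<open>T = S\<close> enters
  with coefficient \<open>mI 0 = 1\<close>, and every other subset containing the marked point is
  smaller and covered by induction.\<close>

private lemma mF_Cval:
  assumes "finite S" "N > card S ^ 2" "S \<noteq> {}"
  shows "of_nat N ^ 2 * mF (card S) = (-1) ^ card S * Cval S"
  using assms
proof (induction "card S" arbitrary: S rule: less_induct)
  case less
  obtain m where m: "m \<in> S" using less.prems by auto
  obtain n where n: "card S = Suc n" using less.prems by (metis card_0_eq not0_implies_Suc)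
  have N0: "N > 0" using less.prems by simp
  let ?F = "{T. T \<subseteq> S \<and> m \<in> T}"
  have fF: "finite ?F" using less.prems by simp
  have sub: "finite T" "card T \<le> card S" "N > card T ^ 2" if "T \<subseteq> S" for T
  proof -
    show "finite T" using that less.prems finite_subset by blast
    show c: "card T \<le> card S" using that less.prems by (intro card_mono) auto
    have "card T ^ 2 \<le> card S ^ 2" using c by (intro power_mono) auto
    then show "N > card T ^ 2" using less.prems(2) by (rule le_less_trans)
  qed
  have mI0: "mI 0 = 1" by (simp add: mI_def prob_space)
  have split: "(\<Sum>T\<in>?F. f T) = f S + (\<Sum>T\<in>?F-{S}. f T)" for f :: "nat set \<Rightarrow> complex"
    using fF m by (intro sum.remove) auto
  have "mI (Suc n) = (-1) ^ card S * (\<Sum>T\<in>?F. Cval T * Dval (S - T))"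
    using mI_Dval[OF less.prems(1,2)] Dval_exponential[OF less.prems(1,2) m] n by simp
  also have "\<dots> = (\<Sum>T\<in>?F. ((-1) ^ card T * Cval T) * mI (card S - card T))"
    unfolding sum_distrib_left
  proof (intro sum.cong refl)
    fix T assume "T \<in> ?F"
    then have T: "T \<subseteq> S" by auto
    have c: "card (S - T) = card S - card T" using T sub(1)[OF T] by (simp add: card_Diff_subset)
    have "(-1 :: complex) ^ card S = (-1) ^ card T * (-1) ^ card (S - T)"
      using sub(2)[OF T] unfolding c power_add[symmetric] by simp
    moreover have "mI (card S - card T) = (-1) ^ card (S - T) * Dval (S - T)"
      unfolding c[symmetric] by (rule mI_Dval) (use sub[of "S - T"] in auto)
    ultimately show "(-1) ^ card S * (Cval T * Dval (S - T)) = ((-1) ^ card T * Cval T) * mI (card S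
        - card T)"
      by simp
  qed
  also have "\<dots> = (-1) ^ card S * Cval S + (\<Sum>T\<in>?F-{S}. ((-1) ^ card T * Cval T) * mI (card S - card T))"
    unfolding split by (simp add: mI0)
  also have "(\<Sum>T\<in>?F-{S}. ((-1) ^ card T * Cval T) * mI (card S - card T)) =
     (\<Sum>T\<in>?F-{S}. (of_nat N ^ 2 * mF (card T)) * mI (card S - card T))"
  proof (intro sum.cong refl)
    fix T assume "T \<in> ?F - {S}"
    then have T: "T \<subset> S" "T \<noteq> {}" by auto
    have "card T < card S" using T less.prems by (intro psubset_card_mono) auto
    then have "of_nat N ^ 2 * mF (card T) = (-1) ^ card T * Cval T"
      using T sub[of T] by (intro less.hyps) auto
    then show "((-1) ^ card T * Cval T) * mI (card S - card T) =
      (of_nat N ^ 2 * mF (card T)) * mI (card S - card T)" by simp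
  qed
  finally have 1: "mI (Suc n) = (-1) ^ card S * Cval S +
     (\<Sum>T\<in>?F-{S}. (of_nat N ^ 2 * mF (card T)) * mI (card S - card T))" .
  have "mI (Suc n) = of_nat N ^ 2 * (\<Sum>k\<le>n. of_nat (n choose k) * mF (Suc k) * mI (n - k))"
    unfolding mI_def mF_def by (rule F_log_recursion[OF N0 AB])
  also have "\<dots> = (\<Sum>k\<le>n. of_nat (n choose k) * ((of_nat N ^ 2 * mF (Suc k)) * mI (card S - Suc k)))"
    by (simp add: sum_distrib_left n mult_ac)
  also have "\<dots> = (\<Sum>T\<in>?F. (of_nat N ^ 2 * mF (card T)) * mI (card S - card T))"
    by (rule sum_subsets_containing[OF less.prems(1) m n, symmetric])
  also have "\<dots> = of_nat N ^ 2 * mF (card S) + (\<Sum>T\<in>?F-{S}. (of_nat N ^ 2 * mF (card T)) * mI (card S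
      - card T))"
    unfolding split by (simp add: mI0)
  finally show ?case using 1 by simp
qed

theorem F_log_deriv_series:
  assumes "finite S" "S \<noteq> {}" "N > card S ^ 2"
  shows "of_nat N ^ 2 * (deriv ^^ card S) (F_log \<kappa> N A B) 0 =
    (-1) ^ card S * (\<Sum>r. (- 1 / of_nat N) ^ r * conn_sum N (\<lambda>i j. A $$ (i, j)) (\<lambda>i j. B $$ (i, j)) S r)"
  using mF_Cval[OF assms(1,3,2)] unfolding mF_def Cval_def y_def .

end

end

section \<open>From connected tuples to monotone double Hurwitz numbers\<close>

section \<open>Monotone double Hurwitz numbers\<close>

definition cycle_prod :: "(nat \<Rightarrow> complex) \<Rightarrow> nat set \<Rightarrow> (nat \<Rightarrow> nat) \<Rightarrow> complex" where
  "cycle_prod \<phi> S p = (\<Prod>Z\<in>orbit p ` S. \<phi> (card Z))"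

lemma finite_orbit_in: "finite S \<Longrightarrow> p permutes S \<Longrightarrow> Z \<in> orbit p ` S \<Longrightarrow> finite Z"
  by (auto intro: finite_cyclic_on[OF cyclic_on_orbit])

lemma part_prod_cycle_type: "part_prod \<phi> (cycle_type_of d p) = cycle_prod \<phi> {1..d} p"
  by (simp add: part_prod_def cycle_type_of_def cycle_prod_def prod_unfold_prod_mset
      image_mset.compositionality comp_def)

lemma size_cycle_type: "size (cycle_type_of d p) = num_cycles {1..d} p"
  by (simp add: cycle_type_of_def num_cycles_def)

lemma cycle_type_in_partitions:
  assumes "p permutes {1..d}"
  shows "cycle_type_of d p \<in> partitions d"
proof -
  have fin: "finite Z" if "Z \<in> orbit p ` {1..d}" for Z
    using finite_orbit_in[OF _ assms that] by simp
  have ne: "Z \<noteq> {}" if "Z \<in> orbit p ` {1..d}" for Z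
    using that orbit_nonempty by fast
  have "sum_mset (cycle_type_of d p) = (\<Sum>Z\<in>orbit p ` {1..d}. card Z)"
    by (simp add: cycle_type_of_def sum_unfold_sum_mset)
  also have "\<dots> = card (\<Union> (orbit p ` {1..d}))"
    using disjoint_orbits[OF assms] fin by (subst card_Union_disjoint) auto
  also have "\<dots> = d" unfolding Union_orbits[OF assms finite_atLeastAtMost] by simp
  finally have "sum_mset (cycle_type_of d p) = d" .
  moreover have "0 \<notin># cycle_type_of d p"
    using fin ne by (auto simp: cycle_type_of_def)
  ultimately show ?thesis by (simp add: partitions_def)
qed

lemma finite_partitions: "finite (partitions d)"
proof (rule finite_subset)
  show "partitions d \<subseteq> (\<Union>n\<in>{..d}. multisets_of_size {..d} n)"
  proof
    fix \<alpha> assume a: "\<alpha> \<in> partitions d"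
    have "size \<alpha> \<le> d"
    proof -
      have "size \<alpha> = (\<Sum>x\<in>#\<alpha>. 1)" by simp
      also have "\<dots> \<le> (\<Sum>x\<in>#\<alpha>. x)"
        using a by (intro sum_mset_mono) (auto simp: partitions_def Suc_le_eq intro: gr0I)
      finally show ?thesis using a by (simp add: partitions_def)
    qed
    moreover have "x \<le> d" if "x \<in># \<alpha>" for x
      using that a by (auto simp: partitions_def dest!: multi_member_split)
    ultimately show "\<alpha> \<in> (\<Union>n\<in>{..d}. multisets_of_size {..d} n)"
      by (auto simp: multisets_of_size_def)
  qed
qed (auto intro!: finite_multisets_of_size)

lemma cycle_type_inv: "p permutes {1..d} \<Longrightarrow> cycle_type_of d (inv' p) = cycle_type_of d p"
proof -
  assume "p permutes {1..d}"
  then have "orbit (inv' p) = orbit p"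
    by (intro ext orbit_inv_eq) (auto simp: permutation_permutes)
  then show ?thesis by (simp add: cycle_type_of_def)
qed

text \<open>The genus relation ties the length of the list to the cycle numbers, so tuples of all
  lengths are collected at once. Adding 2 on the left avoids subtraction of natural numbers.\<close>

definition genus_tuples :: "nat \<Rightarrow> nat \<Rightarrow> ((nat \<Rightarrow> nat) \<times> (nat \<times> nat) list) set" where
  "genus_tuples d g = {(s, l). (s, l) \<in> conn_tuples {1..d} (length l) \<and>
     length l + 2 = 2 * g + num_cycles {1..d} (s \<circ> transp_prod l) + num_cycles {1..d} s}"

lemma num_cycles_le: "num_cycles {1..d} p \<le> d"
  using card_image_le[of "{1..d}" "orbit p"] by (simp add: num_cycles_def)

lemma genus_tuples_subset: "genus_tuples d g \<subseteq> (\<Union>r\<le>2 * g + 2 * d. conn_tuples {1..d} r)"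
proof
  fix x assume x: "x \<in> genus_tuples d g"
  obtain s l where sl: "x = (s,l)" by (cases x)
  have "length l + 2 \<le> 2 * g + 2 * d"
    using x num_cycles_le[of d s] num_cycles_le[of d "s \<circ> transp_prod l"]
        by (simp add: genus_tuples_def sl)
  then show "x \<in> (\<Union>r\<le>2 * g + 2 * d. conn_tuples {1..d} r)"
    using x by (auto simp: genus_tuples_def sl)
qed

lemma finite_genus_tuples: "finite (genus_tuples d g)"
  by (rule finite_subset[OF genus_tuples_subset]) simp

lemma foldr_transp_prod: "foldr (\<circ>) (map (\<lambda>(a,b). swp a b) l) id = transp_prod l"
  by (induction l) auto

lemma generate_preserves:
  assumes p: "p \<in> generate (sym_group d) X" and X: "X \<subseteq> carrier (sym_group d)"
    and T: "\<And>q x. q \<in> X \<Longrightarrow> q x \<in> T \<longleftrightarrow> x \<in> T"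
  shows "p x \<in> T \<longleftrightarrow> x \<in> T"
  using p
proof (induction p arbitrary: x rule: generate.induct)
  case one
  then show ?case by (simp add: sym_group_one)
next
  case (incl h)
  then show ?case using T by simp
next
  case (inv h)
  then have h: "h \<in> carrier (sym_group d)" using X by auto
  then have hp: "h permutes {1..d}" by (simp add: sym_group_carrier)
  have "h (inv' h x) = x" using hp by (simp add: permutes_inverses)
  then have "inv' h x \<in> T \<longleftrightarrow> x \<in> T" using T[OF inv, of "inv' h x"] by simp
  then show ?case using sym_group_inv_equality[OF h] by simp
next
  case (eng h1 h2)
  then show ?case by (simp add: sym_group_mult)
qed

text \<open>An orbit of the generated group is an invariant set, so connectedness makes it
  everything. Conversely, a set invariant under the generators is preserved by the whole
  group.\<close>

lemma conn_iff_transitive: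
  assumes s: "s permutes {1..d}" and l: "set l \<subseteq> {1..d} \<times> {1..d}"
  defines "r \<equiv> inv' (s \<circ> transp_prod l)"
  shows "conn {1..d} s l \<longleftrightarrow> (\<forall>x\<in>{1..d}. \<forall>y\<in>{1..d}.
     \<exists>p\<in>generate (sym_group d) ({r, s} \<union> set (map (\<lambda>(a,b). swp a b) l)). p x = y)"
proof -
  let ?X = "{r, s} \<union> set (map (\<lambda>(a,b). swp a b) l)"
  let ?H = "generate (sym_group d) ?X"
  have t: "s \<circ> transp_prod l permutes {1..d}" by (intro permutes_compose s transp_prod_permutes l)
  have X: "?X \<subseteq> carrier (sym_group d)"
    using s permutes_inv[OF t] l unfolding r_def
        by (auto simp: sym_group_carrier intro!: permutes_swap_id)
  have Hcar: "p \<in> carrier (sym_group d)" if "p \<in> ?H" for p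
    using group.generate_in_carrier[OF sym_group_is_group X that] .
  show ?thesis
  proof
    assume c: "conn {1..d} s l"
    show "\<forall>x\<in>{1..d}. \<forall>y\<in>{1..d}. \<exists>p\<in>?H. p x = y"
    proof (intro ballI)
      fix x y assume xy: "x \<in> {1..d}" "y \<in> {1..d}"
      define T where "T = (\<lambda>p. p x) ` ?H"
      have TS: "T \<subseteq> {1..d}"
        using Hcar xy permutes_in_image by (fastforce simp: T_def sym_group_carrier)
      have step: "q z \<in> T" if "q \<in> ?X" "z \<in> T" for q z
      proof -
        obtain p where p: "p \<in> ?H" "z = p x" using \<open>z \<in> T\<close> by (auto simp: T_def)
        have "q \<otimes>\<^bsub>sym_group d\<^esub> p \<in> ?H" by (rule generate.eng[OF generate.incl[OF that(1)] p(1)])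
        then have "q \<circ> p \<in> ?H" by (simp only: sym_group_mult)
        then show ?thesis unfolding T_def p by (rule image_eqI[rotated]) simp
      qed
      have "inv_under s l T"
      proof (rule inv_underI[OF s])
        show "finite T" using TS by (rule finite_subset) simp
        show "s ` T \<subseteq> T" using step[of s] by auto
        fix a b assume ab: "(a,b) \<in> set l"
        then have "swp a b \<in> ?X" by force
        from step[OF this, of a] step[OF this, of b] show "a \<in> T \<longleftrightarrow> b \<in> T" by auto
      qed
      moreover have "x \<in> T"
      proof -
        have "\<one>\<^bsub>sym_group d\<^esub> \<in> ?H" by (rule generate.one)
        then have "id \<in> ?H" by (simp only: sym_group_one)
        then show ?thesis unfolding T_def by (rule image_eqI[rotated]) simp
      qed
      ultimately have "T = {1..d}" using c TS unfolding conn_def by blast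
      then have "y \<in> T" using xy by simp
      then show "\<exists>p\<in>?H. p x = y" by (auto simp: T_def)
    qed
  next
    assume tr: "\<forall>x\<in>{1..d}. \<forall>y\<in>{1..d}. \<exists>p\<in>?H. p x = y"
    show "conn {1..d} s l"
      unfolding conn_def
    proof (intro allI impI)
      fix T assume T: "T \<subseteq> {1..d}" "inv_under s l T"
      have it: "inv_under (s \<circ> transp_prod l) [] T" by (rule inv_under_comp[OF T(2)])
      have pres: "q z \<in> T \<longleftrightarrow> z \<in> T" if q: "q \<in> ?X" for q z
      proof -
        consider "q = r" | "q = s" | a b where "(a,b) \<in> set l" "q = swp a b" using q by auto
        then show ?thesis
        proof cases
          case 1
          have "(s \<circ> transp_prod l) (r z) = z" unfolding r_def using t by (rule permutes_inverses)
          then show ?thesis using it unfolding inv_under_def 1 by metis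
        next
          case 2
          then show ?thesis using T(2) by (simp add: inv_under_def)
        next
          case 3
          then have "a \<in> T \<longleftrightarrow> b \<in> T" using T(2) by (auto simp: inv_under_def)
          then show ?thesis using 3 by (auto simp: Transposition.transpose_def)
        qed
      qed
      show "T = {} \<or> T = {1..d}"
      proof (cases "T = {}")
        case False
        then obtain x where x: "x \<in> T" by auto
        have "{1..d} \<subseteq> T"
        proof
          fix y assume "y \<in> {1..d}"
          then obtain p where p: "p \<in> ?H" "p x = y" using tr x T(1) by blast
          have "p x \<in> T \<longleftrightarrow> x \<in> T" using generate_preserves[OF p(1) X, of T x] pres by blast
          then show "y \<in> T" using x p(2) by simp
        qed
        then show ?thesis using T(1) by auto
      qed simp
    qed
  qed
qed

text \<open>A transposition determines its support, and the order of the two entries determines the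
  pair. Lists of functions and lists of pairs are therefore counted alike.\<close>

lemma swp_inj:
  assumes "a < b" "a' < b'" "swp a b = swp a' b'"
  shows "a = a'" "b = b'"
proof -
  have "{x. swp a b x \<noteq> x} = {a, b}" if "a < b" for a b :: nat
    using that by (auto simp: Transposition.transpose_def)
  then have "{a, b} = {a', b'}" using assms by metis
  then show "a = a'" "b = b'" using assms by (auto simp: doubleton_eq_iff)
qed

lemma monotone_transpositions_iff:
  "monotone_transpositions d \<tau>s \<longleftrightarrow> (\<exists>l \<in> mono_lists {1..d} (length \<tau>s). \<tau>s = map (\<lambda>(a,b). swp a b) l)"
proof
  assume "monotone_transpositions d \<tau>s"
  then obtain ss ts where st: "length ss = length \<tau>s" "length ts = length \<tau>s"
    "set ss \<subseteq> {1..d}" "set ts \<subseteq> {1..d}"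
    "\<And>i. i < length \<tau>s \<Longrightarrow> ss ! i < ts ! i \<and> \<tau>s ! i = swp (ss ! i) (ts ! i)" "sorted ts"
    unfolding monotone_transpositions_def by metis
  have "zip ss ts \<in> mono_lists {1..d} (length \<tau>s)"
    using st unfolding mono_lists_def
    by (auto simp: in_set_zip subset_iff)
  moreover have "\<tau>s = map (\<lambda>(a,b). swp a b) (zip ss ts)"
    by (rule nth_equalityI) (use st in auto)
  ultimately show "\<exists>l \<in> mono_lists {1..d} (length \<tau>s). \<tau>s = map (\<lambda>(a,b). swp a b) l" by blast
next
  assume "\<exists>l \<in> mono_lists {1..d} (length \<tau>s). \<tau>s = map (\<lambda>(a,b). swp a b) l"
  then obtain l where l: "l \<in> mono_lists {1..d} (length \<tau>s)" "\<tau>s = map (\<lambda>(a,b). swp a b) l" by blast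
  have el: "fst (l ! i) < snd (l ! i)" if "i < length l" for i
    using l(1) nth_mem[OF that] by (force simp: mono_lists_def)
  have "\<tau>s ! i = swp (map fst l ! i) (map snd l ! i)" if "i < length l" for i
    using that l(2) by (simp add: case_prod_beta)
  moreover have "length l = length \<tau>s" "set (map fst l) \<subseteq> {1..d}" "set (map snd l) \<subseteq> {1..d}" "sorted
      (map snd l)"
    using l(1) by (auto simp: mono_lists_def)
  ultimately show "monotone_transpositions d \<tau>s"
    unfolding monotone_transpositions_def
    by (intro exI[of _ "map fst l"] exI[of _ "map snd l"] conjI allI impI) (simp_all add: el)
qed

text \<open>The product relation forces \<rho> to be the inverse of
  \<open>s \<circ> transp_prod l\<close>, and inversion preserves the cycle type, so the condition
  on \<alpha> moves to \<open>s \<circ> transp_prod l\<close>.\<close>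

lemma monotone_hurwitz_eq:
  assumes a: "\<alpha> \<in> partitions d"
  shows "monotone_hurwitz g \<alpha> \<beta> = card {(s, l) \<in> genus_tuples d g.
     cycle_type_of d (s \<circ> transp_prod l) = \<alpha> \<and> cycle_type_of d s = \<beta>}"
proof -
  have d: "sum_mset \<alpha> = d" using a by (simp add: partitions_def)
  let ?P = "{(s, l) \<in> genus_tuples d g. cycle_type_of d (s \<circ> transp_prod l) = \<alpha> \<and> cycle_type_of d s
      = \<beta>}"
  let ?f = "\<lambda>(s, l). (inv' (s \<circ> transp_prod l), s, map (\<lambda>(a,b). swp a b) l)"
  let ?Q = "{(\<rho>, \<sigma>, \<tau>s). \<rho> \<in> carrier (sym_group d) \<and> \<sigma> \<in> carrier (sym_group d) \<and>
       cycle_type_of d \<rho> = \<alpha> \<and> cycle_type_of d \<sigma> = \<beta> \<and>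
       int (length \<tau>s) = 2 * int g - 2 + int (size \<alpha>) + int (size \<beta>) \<and>
       monotone_transpositions d \<tau>s \<and>
       \<rho> \<circ> \<sigma> \<circ> foldr (\<circ>) \<tau>s id = id \<and>
       (\<forall>x\<in>{1..d}. \<forall>y\<in>{1..d}.
          \<exists>p\<in>generate (sym_group d) ({\<rho>, \<sigma>} \<union> set \<tau>s). p x = y)}"
  have memP: "(s, l) \<in> ?P \<longleftrightarrow> s permutes {1..d} \<and> l \<in> mono_lists {1..d} (length l) \<and> conn {1..d} s l \<and>
     length l + 2 = 2 * g + size \<alpha> + size \<beta> \<and> cycle_type_of d (s \<circ> transp_prod l) = \<alpha>
         \<and> cycle_type_of d s = \<beta>" for s l
    by (auto simp: genus_tuples_def conn_tuples_def perm_tuples_def size_cycle_type)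
  have "inj_on ?f ?P"
  proof (rule inj_onI)
    fix x x' assume x: "x \<in> ?P" "x' \<in> ?P" "?f x = ?f x'"
    obtain s l where sl: "x = (s,l)" by (cases x)
    obtain s' l' where sl': "x' = (s',l')" by (cases x')
    have l: "l \<in> mono_lists {1..d} (length l)" "l' \<in> mono_lists {1..d} (length l')"
      using x memP unfolding sl sl' by blast+
    have m: "map (\<lambda>(a,b). swp a b) l = map (\<lambda>(a,b). swp a b) l'" using x(3) by (simp add: sl sl')
    have "l = l'"
    proof (rule map_inj_on[OF m])
      show "inj_on (\<lambda>(a,b). swp a b) (set l \<union> set l')"
      proof (rule inj_onI, clarify)
        fix a b a' b' assume "(a,b) \<in> set l \<union> set l'" "(a',b') \<in> set l \<union> set l'" "swp a b = swp a' b'"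
        then show "a = a' \<and> b = b'" using swp_inj[of a b a' b'] l by (auto simp: mono_lists_def)
      qed
    qed
    then show "x = x'" using x(3) by (simp add: sl sl')
  qed
  moreover have "?f ` ?P = ?Q"
  proof (intro Set.equalityI subsetI)
    fix z assume "z \<in> ?f ` ?P"
    then obtain s l where z: "z = ?f (s,l)" and P: "(s,l) \<in> ?P" by blast
    have s: "s permutes {1..d}" and l: "l \<in> mono_lists {1..d} (length l)" and c: "conn {1..d} s l"
      and len: "length l + 2 = 2 * g + size \<alpha> + size \<beta>"
      and ct: "cycle_type_of d (s \<circ> transp_prod l) = \<alpha>" "cycle_type_of d s = \<beta>"
      using P memP by blast+
    have lS: "set l \<subseteq> {1..d} \<times> {1..d}" using l by (auto simp: mono_lists_def)
    have t: "s \<circ> transp_prod l permutes {1..d}" by (intro permutes_compose s transp_prod_permutes lS)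
    have "inv' (s \<circ> transp_prod l) \<circ> s \<circ> transp_prod l = id"
      using permutes_inv_o(2)[OF t] by (simp add: comp_assoc)
    moreover have "monotone_transpositions d (map (\<lambda>(a,b). swp a b) l)"
      unfolding monotone_transpositions_iff length_map using l by blast
    moreover have "int (length (map (\<lambda>(a,b). swp a b) l)) = 2 * int g - 2 + int (size \<alpha>) + int (size \<beta>)"
      using len by simp
    moreover have "inv' (s \<circ> transp_prod l) \<in> carrier (sym_group d)" "s \<in> carrier (sym_group d)"
      unfolding sym_group_carrier by (rule permutes_inv[OF t], rule s)
    ultimately show "z \<in> ?Q"
      using conn_iff_transitive[OF s lS, THEN iffD1, OF c] ct cycle_type_inv[OF t]
      unfolding z prod.case mem_Collect_eq foldr_transp_prod by (intro conjI; simp only:)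
  next
    fix z assume z: "z \<in> ?Q"
    obtain \<rho> \<sigma> \<tau>s where zz: "z = (\<rho>, \<sigma>, \<tau>s)" by (cases z)
    have q: "\<rho> permutes {1..d}" "\<sigma> permutes {1..d}" "cycle_type_of d \<rho> = \<alpha>" "cycle_type_of d \<sigma> = \<beta>"
       "int (length \<tau>s) = 2 * int g - 2 + int (size \<alpha>) + int (size \<beta>)"
       "monotone_transpositions d \<tau>s" "\<rho> \<circ> \<sigma> \<circ> foldr (\<circ>) \<tau>s id = id"
       and tr: "\<forall>x\<in>{1..d}. \<forall>y\<in>{1..d}. \<exists>p\<in>generate (sym_group d) ({\<rho>, \<sigma>} \<union> set \<tau>s). p x = y"
      using z unfolding zz by (simp_all add: sym_group_carrier)
    obtain l where l: "l \<in> mono_lists {1..d} (length \<tau>s)" "\<tau>s = map (\<lambda>(a,b). swp a b) l"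
      using q(6) monotone_transpositions_iff by blast
    have ll: "length \<tau>s = length l" using l(2) by simp
    have lS: "set l \<subseteq> {1..d} \<times> {1..d}" using l by (auto simp: mono_lists_def)
    have t: "\<sigma> \<circ> transp_prod l permutes {1..d}" by (intro permutes_compose q(2) transp_prod_permutes lS)
    have rho: "\<rho> = inv' (\<sigma> \<circ> transp_prod l)"
    proof -
      have "\<rho> \<circ> (\<sigma> \<circ> transp_prod l) = id" using q(7) unfolding l(2) foldr_transp_prod
          by (simp only: comp_assoc)
      then have "\<rho> \<circ> (\<sigma> \<circ> transp_prod l) \<circ> inv' (\<sigma> \<circ> transp_prod l) = inv' (\<sigma> \<circ> transp_prod l)" by simp
      then show ?thesis unfolding comp_assoc[of \<rho>] permutes_inv_o(1)[OF t] by simp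
    qed
    have "length l + 2 = 2 * g + size \<alpha> + size \<beta>" using q(5) ll by linarith
    moreover have "cycle_type_of d (\<sigma> \<circ> transp_prod l) = \<alpha>" using q(3)
        unfolding rho cycle_type_inv[OF t] .
    moreover have "conn {1..d} \<sigma> l"
      using tr conn_iff_transitive[OF q(2) lS] unfolding rho l(2) by blast
    ultimately have "(\<sigma>, l) \<in> ?P" using memP q(2,4) l(1) ll by simp
    then show "z \<in> ?f ` ?P" unfolding zz rho l(2) by (rule image_eqI[rotated]) simp
  qed
  ultimately have "card ?Q = card ?P" using card_image[of ?f ?P] by (simp only:)
  then show ?thesis unfolding monotone_hurwitz_def d Let_def .
qed

text \<open>Every tuple has exactly one pair of cycle types, so the double sum over partitions
  collapses to a sum over tuples.\<close>

theorem C_coeff_eq: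
  "C_coeff g d \<phi> \<psi> = (\<Sum>(s, l)\<in>genus_tuples d g.
     (-1) ^ (d + length l) * cycle_prod \<phi> {1..d} (s \<circ> transp_prod l) * cycle_prod \<psi> {1..d} s)"
proof -
  let ?P = "partitions d" and ?G = "genus_tuples d g"
  define w where "w = (\<lambda>\<alpha> \<beta>. (-1) ^ (d + size \<alpha> + size \<beta>) * part_prod \<phi> \<alpha> * part_prod \<psi> \<beta>)"
  let ?a = "\<lambda>(s, l). cycle_type_of d (s \<circ> transp_prod l)" and ?b = "\<lambda>(s, l). cycle_type_of d s"
  have "C_coeff g d \<phi> \<psi> = (\<Sum>\<alpha>\<in>?P. \<Sum>\<beta>\<in>?P. of_nat (monotone_hurwitz g \<alpha> \<beta>) * w \<alpha> \<beta>)"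
    unfolding C_coeff_def w_def by (intro sum.cong refl) (simp only: mult_ac)
  also have "\<dots> = (\<Sum>\<alpha>\<in>?P. \<Sum>\<beta>\<in>?P. \<Sum>z\<in>?G. if ?a z = \<alpha> \<and> ?b z = \<beta> then w \<alpha> \<beta> else 0)"
  proof (intro sum.cong refl)
    fix \<alpha> \<beta> assume a: "\<alpha> \<in> ?P"
    have "monotone_hurwitz g \<alpha> \<beta> = card {z \<in> ?G. ?a z = \<alpha> \<and> ?b z = \<beta>}"
      unfolding monotone_hurwitz_eq[OF a] by (rule arg_cong[of _ _ card]) auto
    then have "of_nat (monotone_hurwitz g \<alpha> \<beta>) * w \<alpha> \<beta> = (\<Sum>z | z \<in> ?G \<and> ?a z = \<alpha> \<and> ?b z = \<beta>. w \<alpha> \<beta>)"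
      by simp
    also have "\<dots> = (\<Sum>z\<in>?G. if ?a z = \<alpha> \<and> ?b z = \<beta> then w \<alpha> \<beta> else 0)"
      by (rule sum.inter_filter[OF finite_genus_tuples])
    finally show "of_nat (monotone_hurwitz g \<alpha> \<beta>) * w \<alpha> \<beta> =
        (\<Sum>z\<in>?G. if ?a z = \<alpha> \<and> ?b z = \<beta> then w \<alpha> \<beta> else 0)" .
  qed
  also have "\<dots> = (\<Sum>\<alpha>\<in>?P. \<Sum>z\<in>?G. \<Sum>\<beta>\<in>?P. if ?a z = \<alpha> \<and> ?b z = \<beta> then w \<alpha> \<beta> else 0)"
    by (intro sum.cong refl sum.swap)
  also have "\<dots> = (\<Sum>z\<in>?G. \<Sum>\<alpha>\<in>?P. \<Sum>\<beta>\<in>?P. if ?a z = \<alpha> \<and> ?b z = \<beta> then w \<alpha> \<beta> else 0)"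
    by (rule sum.swap)
  also have "\<dots> = (\<Sum>z\<in>?G. w (?a z) (?b z))"
  proof (intro sum.cong refl)
    fix z assume z: "z \<in> ?G"
    obtain s l where sl: "z = (s,l)" by (cases z)
    have s: "s permutes {1..d}" and lS: "set l \<subseteq> {1..d} \<times> {1..d}"
      using z by (auto simp: sl genus_tuples_def conn_tuples_def perm_tuples_def mono_lists_def)
    have t: "s \<circ> transp_prod l permutes {1..d}" by (intro permutes_compose s transp_prod_permutes lS)
    have in1: "?a z \<in> ?P" "?b z \<in> ?P" unfolding sl prod.case by (intro cycle_type_in_partitions s t)+
    have "(\<Sum>\<beta>\<in>?P. if ?a z = \<alpha> \<and> ?b z = \<beta> then w \<alpha> \<beta> else 0) = (if ?a z = \<alpha> then w \<alpha> (?b z) else 0)"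
        for \<alpha>
    proof (cases "?a z = \<alpha>")
      case True
      then have "(\<Sum>\<beta>\<in>?P. if ?a z = \<alpha> \<and> ?b z = \<beta> then w \<alpha> \<beta> else 0) = (\<Sum>\<beta>\<in>?P. if ?b z = \<beta>
          then w \<alpha> \<beta> else 0)"
        by (intro sum.cong) auto
      then show ?thesis using True finite_partitions in1 by (simp add: sum.delta')
    qed simp
    then show "(\<Sum>\<alpha>\<in>?P. \<Sum>\<beta>\<in>?P. if ?a z = \<alpha> \<and> ?b z = \<beta> then w \<alpha> \<beta> else 0) = w (?a z) (?b z)"
      using finite_partitions in1 by (simp only: sum.delta' if_True)
  qed
  also have "\<dots> = (\<Sum>(s, l)\<in>?G. (-1) ^ (d + length l) * cycle_prod \<phi> {1..d} (s \<circ> transp_prod l)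
      * cycle_prod \<psi> {1..d} s)"
  proof (intro sum.cong refl)
    fix z assume z: "z \<in> ?G"
    obtain s l where sl: "z = (s,l)" by (cases z)
    have "length l + 2 = 2 * g + num_cycles {1..d} (s \<circ> transp_prod l) + num_cycles {1..d} s"
      using z by (simp add: sl genus_tuples_def)
    \<comment> \<open>By the genus relation the list length has the parity of the total number of
      cycles, which converts one sign into the other.\<close>
    then have "d + length l + 2 = 2 * g + (d + num_cycles {1..d} (s \<circ> transp_prod l)
        + num_cycles {1..d} s)" by simp
    then have "(-1 :: complex) ^ (d + length l + 2) = (-1) ^ (2 * g + (d
        + num_cycles {1..d} (s \<circ> transp_prod l) + num_cycles {1..d} s))"
      by (rule arg_cong)
    then have "(-1 :: complex) ^ (d + length l) = (-1) ^ (d + num_cycles {1..d} (s \<circ> transp_prod l)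
        + num_cycles {1..d} s)"
      by (simp add: power_add power_mult)
    then show "w (?a z) (?b z) = (case z of (s, l) \<Rightarrow> (-1) ^ (d + length l)
        * cycle_prod \<phi> {1..d} (s \<circ> transp_prod l) * cycle_prod \<psi> {1..d} s)"
      unfolding sl w_def prod.case size_cycle_type part_prod_cycle_type by simp
  qed
  finally show ?thesis .
qed

section \<open>Error estimates and the truncated expansion\<close>

section \<open>The asymptotic expansion\<close>

lemma cmat_prod_const_eq_pow:
  assumes A: "A \<in> carrier_mat N N" and ij: "i < N" "j < N"
  shows "cmat_prod N (\<lambda>_ i j. A $$ (i, j)) k i j = (A ^\<^sub>m Suc k) $$ (i, j)"
  using ij(2)
proof (induction k arbitrary: j)
  case 0
  then show ?case using left_mult_one_mat[OF A] carrier_matD(1)[OF A] by simp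
next
  case (Suc k)
  have P: "A ^\<^sub>m Suc k \<in> carrier_mat N N" using A by (rule pow_carrier_mat)
  have "(A ^\<^sub>m Suc (Suc k)) $$ (i, j) = (\<Sum>a<N. (A ^\<^sub>m Suc k) $$ (i, a) * A $$ (a, j))"
    unfolding pow_mat.simps(2)[of A "Suc k"] by (rule mult_index[OF P A ij(1) Suc.prems])
  also have "\<dots> = (\<Sum>a<N. cmat_prod N (\<lambda>_ i j. A $$ (i, j)) k i a * A $$ (a, j))"
    using Suc.IH by (intro sum.cong refl) (simp del: pow_mat.simps)
  finally show ?case by (simp only: cmat_prod.simps cmat_mult_def)
qed

lemma cmat_trace_cmat_prod:
  assumes A: "A \<in> carrier_mat N N" and k: "k \<ge> 1"
  shows "cmat_trace N (cmat_prod N (\<lambda>_ i j. A $$ (i, j)) (k - 1)) = mat_trace (A ^\<^sub>m k)"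
proof -
  have "A ^\<^sub>m k \<in> carrier_mat N N" using A by (rule pow_carrier_mat)
  then have "dim_row (A ^\<^sub>m k) = N" by (rule carrier_matD(1))
  then show ?thesis
    unfolding cmat_trace_def mat_trace_def using k cmat_prod_const_eq_pow[OF A, of _ _ "k - 1"]
    by (intro sum.cong) (simp_all del: pow_mat.simps)
qed

text \<open>Normalizing the traces extracts one factor \<open>N\<close> per cycle. These factors are
  what the genus relation balances against the powers of 1/N.\<close>

lemma ptrace_eq_cycle_prod:
  assumes A: "A \<in> carrier_mat N N" and N: "N > 0" and S: "finite S" "p permutes S"
  shows "ptrace N S (\<lambda>_ i j. A $$ (i, j)) p = of_nat N ^ num_cycles S p
      * cycle_prod (\<lambda>k. mat_trace (A ^\<^sub>m k) / of_nat N) S p"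
proof -
  have "ptrace N S (\<lambda>_ i j. A $$ (i, j)) p =
     (\<Prod>Z\<in>orbit p ` S. cmat_trace N (cmat_prod N (\<lambda>_ i j. A $$ (i, j)) (card Z - 1)))"
    by (rule ptrace_orbits[OF S(2,1)])
  also have "\<dots> = (\<Prod>Z\<in>orbit p ` S. of_nat N * (mat_trace (A ^\<^sub>m card Z) / of_nat N))"
  proof (intro prod.cong refl)
    fix Z assume Z: "Z \<in> orbit p ` S"
    then have "finite Z" "Z \<noteq> {}" using finite_orbit_in[OF S Z] orbit_nonempty by fast+
    then have "card Z \<ge> 1" by (simp add: Suc_le_eq card_gt_0_iff)
    then show "cmat_trace N (cmat_prod N (\<lambda>_ i j. A $$ (i, j)) (card Z - 1)) = of_nat N
        * (mat_trace (A ^\<^sub>m card Z) / of_nat N)"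
      using cmat_trace_cmat_prod[OF A] N by simp
  qed
  also have "\<dots> = of_nat N ^ num_cycles S p * cycle_prod (\<lambda>k. mat_trace (A ^\<^sub>m k) / of_nat N) S p"
    unfolding prod.distrib prod_constant num_cycles_def cycle_prod_def ..
  finally show ?thesis .
qed

lemma norm_inverse_power_le_1:
  assumes "N \<ge> 1"
  shows "norm (1 / of_nat N ^ n :: complex) \<le> 1"
proof -
  have "(1::real) \<le> real N ^ n" using assms by (intro one_le_power) simp
  then have "1 / real N ^ n \<le> 1" using divide_le_eq_1_pos[of "real N ^ n" 1] by linarith
  then show ?thesis by (simp only: norm_divide norm_power norm_one norm_of_nat)
qed

lemma smallo_bounded:
  fixes f :: "nat \<Rightarrow> complex"
  assumes "(\<lambda>N. f N - c) \<in> o(\<lambda>N. 1 / of_nat N ^ (2 * h))"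
  shows "eventually (\<lambda>N. norm (f N) \<le> norm c + 1) at_top"
proof -
  have "eventually (\<lambda>N. norm (f N - c) \<le> 1 * norm (1 / of_nat N ^ (2 * h) :: complex)) at_top"
    by (rule landau_o.smallD[OF assms]) simp
  moreover have "eventually (\<lambda>N::nat. N \<ge> 1) at_top" by (rule eventually_ge_at_top)
  ultimately show ?thesis
  proof eventually_elim
    case (elim N)
    have "norm (f N - c) \<le> 1" using elim(1) norm_inverse_power_le_1[OF elim(2), of "2 * h"] by linarith
    then show ?case using norm_triangle_sub[of "f N" c] by simp
  qed
qed

text \<open>From f g - c c' = (f - c) g + c (g - c') and the boundedness of g.\<close>

lemma smallo_mult_limits:
  fixes f g :: "nat \<Rightarrow> complex"
  assumes f: "(\<lambda>N. f N - c) \<in> o(\<lambda>N. 1 / of_nat N ^ (2 * h))"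
    and g: "(\<lambda>N. g N - c') \<in> o(\<lambda>N. 1 / of_nat N ^ (2 * h))"
  shows "(\<lambda>N. f N * g N - c * c') \<in> o(\<lambda>N. 1 / of_nat N ^ (2 * h))"
proof -
  have "g \<in> O(\<lambda>_. 1)"
    using smallo_bounded[OF g] by (intro bigoI[of _ "norm c' + 1"]) simp
  from landau_o.small_big_mult[OF f this]
  have "(\<lambda>N. (f N - c) * g N) \<in> o(\<lambda>N. 1 / of_nat N ^ (2 * h))" by simp
  moreover have "(\<lambda>N. c * (g N - c')) \<in> o(\<lambda>N. 1 / of_nat N ^ (2 * h))"
    using g by (cases "c = 0") simp_all
  ultimately have "(\<lambda>N. (f N - c) * g N + c * (g N - c')) \<in> o(\<lambda>N. 1 / of_nat N ^ (2 * h))"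
    by (rule sum_in_smallo)
  then show ?thesis by (simp add: algebra_simps)
qed

lemma smallo_prod_limits:
  fixes f :: "nat \<Rightarrow> 'k \<Rightarrow> complex"
  assumes "finite F" "\<And>k. k \<in> F \<Longrightarrow> (\<lambda>N. f N k - c k) \<in> o(\<lambda>N. 1 / of_nat N ^ (2 * h))"
  shows "(\<lambda>N. (\<Prod>k\<in>F. f N k) - (\<Prod>k\<in>F. c k)) \<in> o(\<lambda>N. 1 / of_nat N ^ (2 * h))"
  using assms
proof (induction F rule: finite_induct)
  case (insert k F)
  then show ?case by (simp add: smallo_mult_limits)
qed simp

lemma cycle_prod_limit:
  assumes "\<And>k. k \<ge> 1 \<Longrightarrow> (\<lambda>N. a N k - \<phi> k) \<in> o(\<lambda>N. 1 / of_nat N ^ (2 * h))"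
    and S: "finite S" "p permutes S"
  shows "(\<lambda>N. cycle_prod (a N) S p - cycle_prod \<phi> S p) \<in> o(\<lambda>N. 1 / of_nat N ^ (2 * h))"
  unfolding cycle_prod_def
proof (rule smallo_prod_limits)
  fix Z assume Z: "Z \<in> orbit p ` S"
  then have "finite Z" "Z \<noteq> {}" using finite_orbit_in[OF S Z] orbit_nonempty by fast+
  then have "card Z \<ge> 1" by (simp add: Suc_le_eq card_gt_0_iff)
  then show "(\<lambda>N. a N (card Z) - \<phi> (card Z)) \<in> o(\<lambda>N. 1 / of_nat N ^ (2 * h))" by (rule assms(1))
qed (use S in simp)

text \<open>For \<open>d \<ge> 1\<close>, subtraction and division are exact on connected tuples by
  \<open>genus_exists\<close>; elsewhere the value has no meaning.\<close>

definition genus :: "nat \<Rightarrow> nat \<Rightarrow> (nat \<Rightarrow> nat) \<times> (nat \<times> nat) list \<Rightarrow> nat" where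
  "genus d r = (\<lambda>(s,l). (r + 2 - num_cycles {1..d} s - num_cycles {1..d} (s \<circ> transp_prod l)) div 2)"

lemma genus:
  assumes "d \<ge> 1" "(s, l) \<in> conn_tuples {1..d} r"
  shows "r + 2 = 2 * genus d r (s, l) + num_cycles {1..d} (s \<circ> transp_prod l) + num_cycles {1..d} s"
proof -
  obtain g where g: "r + 2 = num_cycles {1..d} s + num_cycles {1..d} (s \<circ> transp_prod l) + 2 * g"
    using genus_exists[OF _ _ assms(2)] assms(1) by auto
  then show ?thesis by (simp add: genus_def)
qed

text \<open>The contribution of a tuple apart from its power of \<open>N\<close>. The sign joins
  (-1)^d from the exponent of the integral with the signs of the powers of -1/N.\<close>

definition amplitude :: "nat \<Rightarrow> (nat \<Rightarrow> complex) \<Rightarrow> (nat \<Rightarrow> complex) \<Rightarrow> nat \<Rightarrow> (nat \<Rightarrow> nat) \<times> (nat \<times> nat) list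
    \<Rightarrow> complex" where
  "amplitude d \<phi> \<psi> r = (\<lambda>(s,l). (-1) ^ (d + r) * cycle_prod \<phi> {1..d} (s \<circ> transp_prod l)
      * cycle_prod \<psi> {1..d} s)"

text \<open>There are at most 2 d cycles in total, so a tuple of genus at most \<open>h\<close> has
  fewer than 2 h + 2 d transpositions and truncation at \<open>R\<close> omits none of them.\<close>

lemma C_coeff_amplitude:
  assumes d: "d \<ge> 1" and R: "R > 2 * h + 2 * d" and g: "g \<le> h"
  shows "C_coeff g d \<phi> \<psi> = (\<Sum>r<R. \<Sum>x\<in>conn_tuples {1..d} r. if genus d r x = g
      then amplitude d \<phi> \<psi> r x else 0)"
proof -
  have "(\<Sum>r<R. \<Sum>x\<in>conn_tuples {1..d} r. if genus d r x = g then amplitude d \<phi> \<psi> r x else 0) =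
    (\<Sum>r<R. \<Sum>x | x \<in> conn_tuples {1..d} r \<and> genus d r x = g. amplitude d \<phi> \<psi> r x)"
    by (intro sum.cong refl sum.inter_filter[symmetric]) simp
  also have "\<dots> = (\<Sum>(r,x)\<in>(SIGMA r:{..<R}. {x \<in> conn_tuples {1..d} r. genus d r x
      = g}). amplitude d \<phi> \<psi> r x)"
    by (intro sum.Sigma) auto
  also have "\<dots> = (\<Sum>x\<in>genus_tuples d g. amplitude d \<phi> \<psi> (length (snd x)) x)"
  proof (rule sum.reindex_bij_witness[where i = "\<lambda>x. (length (snd x), x)" and j = snd], goal_cases)
    case (1 z)
    then show ?case by (auto simp: conn_tuples_def perm_tuples_def mono_lists_def)
  next
    case (2 z)
    obtain r s l where z: "z = (r,(s,l))" by (cases z) auto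
    have x: "(s,l) \<in> conn_tuples {1..d} r" "genus d r (s,l) = g" using 2 z by auto
    have len: "length l = r" using x(1) by (auto simp: conn_tuples_def perm_tuples_def mono_lists_def)
    show ?case using genus[OF d x(1)] x by (simp add: z genus_tuples_def len)
  next
    case (4 x)
    obtain s l where x: "x = (s,l)" by (cases x)
    have c: "(s,l) \<in> conn_tuples {1..d} (length l)"
      and e: "length l + 2 = 2 * g + num_cycles {1..d} (s \<circ> transp_prod l) + num_cycles {1..d} s"
      using 4 by (auto simp: x genus_tuples_def)
    have "genus d (length l) (s,l) = g" using genus[OF d c] e by simp
    moreover have "length l < R"
      using e num_cycles_le[of d s] num_cycles_le[of d "s \<circ> transp_prod l"] R g by simp
    ultimately show ?case using c by (simp add: x)
  next
    case (5 z)
    then show ?case by (auto simp: conn_tuples_def perm_tuples_def mono_lists_def)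
  qed simp
  also have "\<dots> = C_coeff g d \<phi> \<psi>"
    unfolding C_coeff_eq amplitude_def by (intro sum.cong) auto
  finally show ?thesis ..
qed

lemma main_sum:
  assumes d: "d \<ge> 1" and R: "R > 2 * h + 2 * d"
  shows "(\<Sum>g=0..h. C_coeff g d \<phi> \<psi> / of_nat N ^ (2 * g)) =
    (\<Sum>r<R. \<Sum>x\<in>conn_tuples {1..d} r. if genus d r x \<le> h then amplitude d \<phi> \<psi> r x / of_nat N ^ (2
        * genus d r x) else 0)"
proof -
  have "(\<Sum>g=0..h. C_coeff g d \<phi> \<psi> / of_nat N ^ (2 * g)) =
    (\<Sum>g=0..h. \<Sum>r<R. \<Sum>x\<in>conn_tuples {1..d} r. if genus d r x = g then amplitude d \<phi> \<psi> r x / of_nat N ^ (2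
        * genus d r x) else 0)"
  proof (intro sum.cong refl)
    fix g assume "g \<in> {0..h}"
    then have "C_coeff g d \<phi> \<psi> / of_nat N ^ (2 * g) =
      (\<Sum>r<R. \<Sum>x\<in>conn_tuples {1..d} r. (if genus d r x = g
          then amplitude d \<phi> \<psi> r x else 0) / of_nat N ^ (2 * g))"
      using C_coeff_amplitude[OF d R, of g \<phi> \<psi>] by (simp add: sum_divide_distrib)
    also have "\<dots> = (\<Sum>r<R. \<Sum>x\<in>conn_tuples {1..d} r. if genus d r x = g
        then amplitude d \<phi> \<psi> r x / of_nat N ^ (2 * genus d r x) else 0)"
      by (intro sum.cong refl) simp
    finally show "C_coeff g d \<phi> \<psi> / of_nat N ^ (2 * g) =
      (\<Sum>r<R. \<Sum>x\<in>conn_tuples {1..d} r. if genus d r x = g then amplitude d \<phi> \<psi> r x / of_nat N ^ (2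
          * genus d r x) else 0)" .
  qed
  also have "\<dots> = (\<Sum>r<R. \<Sum>g=0..h. \<Sum>x\<in>conn_tuples {1..d} r. if genus d r x = g
      then amplitude d \<phi> \<psi> r x / of_nat N ^ (2 * genus d r x) else 0)"
    by (rule sum.swap)
  also have "\<dots> = (\<Sum>r<R. \<Sum>x\<in>conn_tuples {1..d} r. \<Sum>g=0..h. if genus d r x = g
      then amplitude d \<phi> \<psi> r x / of_nat N ^ (2 * genus d r x) else 0)"
    by (intro sum.cong refl sum.swap)
  also have "\<dots> = (\<Sum>r<R. \<Sum>x\<in>conn_tuples {1..d} r. if genus d r x \<le> h
      then amplitude d \<phi> \<psi> r x / of_nat N ^ (2 * genus d r x) else 0)"
    by (intro sum.cong refl) (simp add: sum.delta')
  finally show ?thesis .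
qed

context
  fixes N d :: nat and A B :: "complex mat"
  assumes N: "N > 0" and d: "d \<ge> 1" and A: "A \<in> carrier_mat N N" and B: "B \<in> carrier_mat N N"
begin

lemma tuple_weight_eq:
  assumes x: "(s, l) \<in> conn_tuples {1..d} r"
  defines "\<alpha> \<equiv> \<lambda>k. mat_trace (A ^\<^sub>m k) / of_nat N" and "\<beta> \<equiv> \<lambda>k. mat_trace (B ^\<^sub>m k) / of_nat N"
  shows "tuple_weight N (\<lambda>i j. A $$ (i, j)) (\<lambda>i j. B $$ (i, j)) {1..d} (s, l) =
    of_nat N ^ (num_cycles {1..d} s + num_cycles {1..d} (s \<circ> transp_prod l)) * (cycle_prod \<beta> {1..d} s
        * cycle_prod \<alpha> {1..d} (s \<circ> transp_prod l))"
proof -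
  have s: "s permutes {1..d}" and l: "l \<in> mono_lists {1..d} r" using x
      by (auto simp: conn_tuples_def perm_tuples_def)
  have t: "s \<circ> transp_prod l permutes {1..d}" using mono_lists_permutes[OF l subset_refl] s
      by (rule permutes_compose)
  show ?thesis
    unfolding tuple_weight_def prod.case \<alpha>_def \<beta>_def ptrace_eq_cycle_prod[OF A N finite_atLeastAtMost t]
        ptrace_eq_cycle_prod[OF B N finite_atLeastAtMost s]
    by (simp add: power_add)
qed

text \<open>With c the total number of cycles, r + 2 = c + 2 g gives N^c / (N^r N^2) = N^(-2g). The
  square comes from the exponent N^2 F of the integral.\<close>

lemma conn_sum_amplitude:
  defines "\<alpha> \<equiv> \<lambda>k. mat_trace (A ^\<^sub>m k) / of_nat N" and "\<beta> \<equiv> \<lambda>k. mat_trace (B ^\<^sub>m k) / of_nat N"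
  shows "(-1) ^ d * ((- 1 / of_nat N) ^ r * conn_sum N (\<lambda>i j. A $$ (i, j)) (\<lambda>i j. B $$ (i, j)) {1..d} r)
      / of_nat N ^ 2 =
    (\<Sum>x\<in>conn_tuples {1..d} r. amplitude d \<alpha> \<beta> r x / of_nat N ^ (2 * genus d r x))"
  unfolding conn_sum_def sum_distrib_left sum_divide_distrib
proof (intro sum.cong refl)
  fix x assume x: "x \<in> conn_tuples {1..d} r"
  obtain s l where sl: "x = (s,l)" by (cases x)
  let ?c = "num_cycles {1..d} s + num_cycles {1..d} (s \<circ> transp_prod l)" and ?g = "genus d r x"
  let ?n = "of_nat N :: complex"
  have n0: "?n \<noteq> 0" using N by simp
  have "r + 2 = ?c + 2 * ?g" using genus[OF d x[unfolded sl]] by (simp add: sl)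
  then have e: "?n ^ r * ?n ^ 2 = ?n ^ ?c * ?n ^ (2 * ?g)" unfolding power_add[symmetric] by simp
  have m: "(- 1 / ?n) ^ r = (-1) ^ r / ?n ^ r" by (rule power_divide)
  let ?u = "cycle_prod \<beta> {1..d} s * cycle_prod \<alpha> {1..d} (s \<circ> transp_prod l)"
  have "(-1) ^ d * ((- 1 / ?n) ^ r * tuple_weight N (\<lambda>i j. A $$ (i, j)) (\<lambda>i j. B $$ (i, j)) {1..d} x) /
      ?n ^ 2 =
    ((-1) ^ d * (-1) ^ r * ?u) * (?n ^ ?c / (?n ^ r * ?n ^ 2))"
    unfolding sl tuple_weight_eq[OF x[unfolded sl], folded \<alpha>_def \<beta>_def] m by simp
  also have "?n ^ ?c / (?n ^ r * ?n ^ 2) = 1 / ?n ^ (2 * ?g)" unfolding e using n0 by simp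
  also have "((-1) ^ d * (-1) ^ r * ?u) * (1 / ?n ^ (2 * ?g)) = amplitude d \<alpha> \<beta> r x / ?n ^ (2 * ?g)"
    unfolding amplitude_def sl by (simp add: power_add mult_ac)
  finally show "(-1) ^ d * ((- 1 / ?n) ^ r * tuple_weight N (\<lambda>i j. A $$ (i, j)) (\<lambda>i j. B $$ (i, j))
      {1..d} x) / ?n ^ 2 =
    amplitude d \<alpha> \<beta> r x / ?n ^ (2 * genus d r x)" .
qed

text \<open>A weight is at most N^(2d) K^2, and the first \<open>R\<close> powers of d^2/N
  contribute N^(-R); the choice of \<open>R\<close> leaves N^(-(2h+1)). For N \<ge> 2 d^2 the
  remaining geometric series has ratio at most 1/2, whence the factor 2.\<close>

lemma tail_bound:
  assumes K: "\<And>p. p permutes {1..d} \<Longrightarrow> norm (cycle_prod (\<lambda>k. mat_trace (A ^\<^sub>m k) / of_nat N) {1..d} p)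
      \<le> K"
     "\<And>p. p permutes {1..d} \<Longrightarrow> norm (cycle_prod (\<lambda>k. mat_trace (B ^\<^sub>m k) / of_nat N) {1..d} p) \<le> K"
    and large: "N \<ge> 2 * d ^ 2" and R: "R = 2 * d + 2 * h + 1"
  shows "norm (\<Sum>r. (- 1 / of_nat N) ^ (r + R) * conn_sum N (\<lambda>i j. A $$ (i, j)) (\<lambda>i j. B $$ (i, j))
      {1..d} (r + R))
     \<le> 2 * fact d * K ^ 2 * real (d ^ 2) ^ R / real N ^ (2 * h + 1)"
proof -
  let ?C = "conn_sum N (\<lambda>i j. A $$ (i, j)) (\<lambda>i j. B $$ (i, j)) {1..d}"
  have K0: "K \<ge> 0" using K(1)[OF permutes_id] norm_ge_zero order_trans by blast
  let ?W = "real N ^ (2 * d) * K ^ 2"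
  have W: "norm (tuple_weight N (\<lambda>i j. A $$ (i, j)) (\<lambda>i j. B $$ (i, j)) {1..d} x) \<le> ?W"
      if x: "x \<in> conn_tuples {1..d} r" for r x
  proof -
    obtain s l where sl: "x = (s,l)" by (cases x)
    have s: "s permutes {1..d}" and l: "l \<in> mono_lists {1..d} r" using x sl
        by (auto simp: conn_tuples_def perm_tuples_def)
    have t: "s \<circ> transp_prod l permutes {1..d}" using mono_lists_permutes[OF l subset_refl] s
        by (rule permutes_compose)
    have p1: "real N ^ (num_cycles {1..d} s + num_cycles {1..d} (s \<circ> transp_prod l)) \<le> real N ^ (2 * d)"
      using N num_cycles_le[of d s] num_cycles_le[of d "s \<circ> transp_prod l"]
          by (intro power_increasing) auto
    have p2: "norm (cycle_prod (\<lambda>k. mat_trace (B ^\<^sub>m k) / of_nat N) {1..d} s) *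
       norm (cycle_prod (\<lambda>k. mat_trace (A ^\<^sub>m k) / of_nat N) {1..d} (s \<circ> transp_prod l)) \<le> K * K"
      by (intro mult_mono K s t K0 norm_ge_zero)
    show ?thesis
      unfolding sl tuple_weight_eq[OF x[unfolded sl]] norm_mult norm_power norm_of_nat power2_eq_square
      by (rule mult_mono[OF p1 p2]) simp_all
  qed
  define q where "q = real (d ^ 2) / real N"
  have q: "0 \<le> q" "q \<le> 1 / 2"
  proof -
    have "real (2 * d ^ 2) \<le> real N" using large by (rule of_nat_mono)
    then show "q \<le> 1 / 2" using N by (simp add: q_def field_simps)
  qed (simp add: q_def)
  have bound: "norm ((- 1 / of_nat N) ^ (r + R) * ?C (r + R)) \<le> fact d * ?W * q ^ R * q ^ r" for r
  proof -
    have "norm (?C (r + R)) \<le> fact d * real (d ^ 2) ^ (r + R) * ?W"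
      using conn_sum_bound[of "{1..d}" "r + R" N "\<lambda>i j. A $$ (i, j)" "\<lambda>i j. B $$ (i, j)" ?W] W K0
          by simp
    then have "(1 / real N) ^ (r + R) * norm (?C (r + R)) \<le> (1 / real N) ^ (r + R) * (fact d
        * real (d ^ 2) ^ (r + R) * ?W)"
      by (intro mult_left_mono) auto
    also have "\<dots> = fact d * ?W * q ^ (r + R)" by (simp add: q_def power_divide)
    finally show ?thesis by (simp add: norm_mult norm_power norm_divide power_add mult_ac)
  qed
  have sq: "summable (\<lambda>r. fact d * ?W * q ^ R * q ^ r)"
    using q by (intro summable_mult summable_geometric) simp
  have "norm (\<Sum>r. (- 1 / of_nat N) ^ (r + R) * ?C (r + R)) \<le> (\<Sum>r. fact d * ?W * q ^ R * q ^ r)"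
    by (rule norm_suminf_le[OF bound sq])
  also have "\<dots> = fact d * ?W * q ^ R * (1 / (1 - q))"
    using q by (subst suminf_mult) (auto simp: suminf_geometric intro!: summable_geometric)
  also have "\<dots> \<le> fact d * ?W * q ^ R * 2"
    using q by (intro mult_left_mono) (auto simp: field_simps)
  also have "\<dots> = 2 * fact d * K ^ 2 * real (d ^ 2) ^ R * (real N ^ (2 * d) / real N ^ R)"
    by (simp add: q_def power_divide)
  also have "real N ^ (2 * d) / real N ^ R = 1 / real N ^ (2 * h + 1)"
    using N unfolding R by (simp add: power_add field_simps)
  finally show ?thesis by simp
qed

end

theorem theorem0p2:
  fixes M :: real and h d :: nat
    and A B :: "nat \<Rightarrow> complex mat" and \<phi> \<psi> :: "nat \<Rightarrow> complex"
    and \<kappa> :: "nat \<Rightarrow> complex mat measure"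
  assumes "M \<ge> 0" and "d \<ge> 1"
    and "\<And>N. N \<ge> 1 \<Longrightarrow> normalized_haar N (\<kappa> N)"
    and "regular_seq M h A \<phi>" and "regular_seq M h B \<psi>"
  shows "(\<lambda>N. (deriv ^^ d) (F_log (\<kappa> N) N (A N) (B N)) 0
               - (\<Sum>g=0..h. C_coeff g d \<phi> \<psi> / of_nat N ^ (2 * g)))
         \<in> o(\<lambda>N. 1 / of_nat N ^ (2 * h))"
proof -
  let ?S = "{1..d}"
  \<comment> \<open>Large enough for all tuples of genus at most \<open>h\<close>, and for a tail of
    order N^(-(2h+1)).\<close>
  define R where "R = 2 * d + 2 * h + 1"
  define \<alpha> where "\<alpha> = (\<lambda>N k. mat_trace (A N ^\<^sub>m k) / of_nat N)"
  define \<beta> where "\<beta> = (\<lambda>N k. mat_trace (B N ^\<^sub>m k) / of_nat N)"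
  define f where "f = (\<lambda>r x N. amplitude d (\<alpha> N) (\<beta> N) r x / of_nat N ^ (2 * genus d r x))"
  \<comment> \<open>The target for each tuple: the limiting amplitude with its exact power of
    \<open>N\<close>, or zero when the genus exceeds \<open>h\<close> and the tuple belongs to the
    error.\<close>
  define fl where "fl = (\<lambda>r x N. if genus d r x \<le> h then amplitude d \<phi> \<psi> r x / of_nat N ^ (2
      * genus d r x) else 0)"
  define C where "C = (\<lambda>N. conn_sum N (\<lambda>i j. A N $$ (i, j)) (\<lambda>i j. B N $$ (i, j)) ?S)"
  define tail where "tail = (\<lambda>N. (-1) ^ d * (\<Sum>r. (- 1 / of_nat N) ^ (r + R) * C N (r
      + R)) / of_nat N ^ 2)"
  have a: "(\<lambda>N. \<alpha> N k - \<phi> k) \<in> o(\<lambda>N. 1 / of_nat N ^ (2 * h))" "(\<lambda>N. \<beta> N k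
      - \<psi> k) \<in> o(\<lambda>N. 1 / of_nat N ^ (2 * h))"
    if "k \<ge> 1" for k
    using assms(4,5) that unfolding regular_seq_def \<alpha>_def \<beta>_def by blast+
  have car: "A N \<in> carrier_mat N N" "B N \<in> carrier_mat N N" if "N \<ge> 1" for N
    using assms(4,5) that unfolding regular_seq_def by blast+
  have nma: "(\<lambda>N. cycle_prod (\<alpha> N) ?S p - cycle_prod \<phi> ?S p) \<in> o(\<lambda>N. 1 / of_nat N ^ (2 * h))"
      if "p permutes ?S" for p
    by (rule cycle_prod_limit[OF _ finite_atLeastAtMost that]) (rule a)
  have nmb: "(\<lambda>N. cycle_prod (\<beta> N) ?S p - cycle_prod \<psi> ?S p) \<in> o(\<lambda>N. 1 / of_nat N ^ (2 * h))"
      if "p permutes ?S" for p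
    by (rule cycle_prod_limit[OF _ finite_atLeastAtMost that]) (rule a)

  have summand: "(\<lambda>N. f r x N - fl r x N) \<in> o(\<lambda>N. 1 / of_nat N ^ (2 * h))" if x: "x \<in> conn_tuples ?S r"
      for r x
  proof -
    obtain s l where sl: "x = (s,l)" by (cases x)
    have s: "s permutes ?S" and l: "l \<in> mono_lists ?S r" using x sl
        by (auto simp: conn_tuples_def perm_tuples_def)
    have t: "s \<circ> transp_prod l permutes ?S" using mono_lists_permutes[OF l subset_refl] s
        by (rule permutes_compose)
    have "(\<lambda>N. (-1) ^ (d + r) - (-1) ^ (d + r)) \<in> o(\<lambda>N. 1 / of_nat N ^ (2 * h) :: complex)" by simp
    then have amplitude: "(\<lambda>N. amplitude d (\<alpha> N) (\<beta> N) r x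
        - amplitude d \<phi> \<psi> r x) \<in> o(\<lambda>N. 1 / of_nat N ^ (2 * h))"
      unfolding amplitude_def sl prod.case by (intro smallo_mult_limits nma nmb s t)
    have inv1: "(\<lambda>N. 1 / of_nat N ^ n :: complex) \<in> O(\<lambda>_. 1)" for n
    proof (rule bigoI[of _ 1])
      show "eventually (\<lambda>N. norm (1 / of_nat N ^ n :: complex) \<le> 1 * norm (1 :: complex)) at_top"
        using eventually_ge_at_top[of 1]
      proof eventually_elim
        case (elim N)
        show ?case using norm_inverse_power_le_1[OF elim, of n] by simp
      qed
    qed
    show ?thesis
    proof (cases "genus d r x \<le> h")
      case True
      have "(\<lambda>N. (amplitude d (\<alpha> N) (\<beta> N) r x - amplitude d \<phi> \<psi> r x) * (1 / of_nat N ^ (2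
          * genus d r x)))
         \<in> o(\<lambda>N. 1 / of_nat N ^ (2 * h) * 1)"
        by (rule landau_o.small_big_mult[OF amplitude inv1])
      then show ?thesis using True by (simp add: f_def fl_def diff_divide_distrib)
    next
      case False
      \<comment> \<open>The exponent beyond 2 h + 1. One factor 1/N supplies the small o, and the
        remaining \<open>k\<close> factors are merely bounded.\<close>
      define k where "k = 2 * genus d r x - (2 * h + 1)"
      have k: "2 * genus d r x = 2 * h + (k + 1)" using False by (simp add: k_def)
      have O1: "(\<lambda>N. amplitude d (\<alpha> N) (\<beta> N) r x) \<in> O(\<lambda>_. 1)"
        using smallo_bounded[OF amplitude] by (intro bigoI[of _ "norm (amplitude d \<phi> \<psi> r x) + 1"]) simp
      have lim: "(\<lambda>N. 1 / of_nat N :: complex) \<in> o(\<lambda>_. 1)"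
        by (intro smalloI_tendsto) (simp_all add: lim_1_over_n)
      have "(\<lambda>N. amplitude d (\<alpha> N) (\<beta> N) r x * (1 / of_nat N ^ k)) \<in> O(\<lambda>_. 1 * 1)"
        by (rule landau_o.big_mult[OF O1 inv1])
      from landau_o.big_small_mult[OF this lim]
      have "(\<lambda>N. amplitude d (\<alpha> N) (\<beta> N) r x * (1 / of_nat N ^ k) * (1 / of_nat N)) \<in> o(\<lambda>_. 1)" by simp
      from landau_o.big_small_mult[OF landau_o.big_refl[of "\<lambda>N. 1 / of_nat N ^ (2 * h)"] this]
      have "(\<lambda>N. 1 / of_nat N ^ (2 * h) * (amplitude d (\<alpha> N) (\<beta> N) r x * (1 / of_nat N ^ k)
          * (1 / of_nat N)))
         \<in> o(\<lambda>N. 1 / of_nat N ^ (2 * h))" by simp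
      then show ?thesis using False unfolding f_def fl_def k power_add by simp
    qed
  qed
  have sums: "(\<lambda>N. \<Sum>r<R. \<Sum>x\<in>conn_tuples ?S r. f r x N - fl r x N) \<in> o(\<lambda>N. 1 / of_nat N ^ (2 * h))"
    by (intro big_sum_in_smallo summand)

  \<comment> \<open>Summing limit-plus-one bounds over all permutations gives one constant,
    independent of \<open>N\<close>, for the cycle products of both sequences.\<close>
  define K where "K = (\<Sum>p | p permutes ?S. (norm (cycle_prod \<phi> ?S p) + 1) + (norm (cycle_prod \<psi> ?S p)
      + 1))"
  have fP: "finite {p. p permutes ?S}" by (intro finite_permutations) simp
  have ev: "eventually (\<lambda>N. \<forall>p\<in>{p. p permutes ?S}. norm (cycle_prod (\<alpha> N) ?S p) \<le> K
      \<and> norm (cycle_prod (\<beta> N) ?S p) \<le> K) at_top"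
  proof (rule eventually_ball_finite[OF fP], rule ballI)
    fix p assume p: "p \<in> {p. p permutes ?S}"
    have K: "(norm (cycle_prod \<phi> ?S p) + 1) + (norm (cycle_prod \<psi> ?S p) + 1) \<le> K"
      unfolding K_def
      by (rule member_le_sum[where f = "\<lambda>p. (norm (cycle_prod \<phi> ?S p) + 1) + (norm (cycle_prod \<psi> ?S p)
          + 1)", OF p _ fP]) simp
    show "eventually (\<lambda>N. norm (cycle_prod (\<alpha> N) ?S p) \<le> K \<and> norm (cycle_prod (\<beta> N) ?S p) \<le> K) at_top"
      using smallo_bounded[OF nma[OF p[unfolded mem_Collect_eq]]] smallo_bounded[OF nmb[OF p[unfolded
          mem_Collect_eq]]]
    proof eventually_elim
      case (elim N)
      then show ?case using K norm_ge_zero[of "cycle_prod \<phi> ?S p"] norm_ge_zero[of "cycle_prod \<psi> ?S p"]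
          by linarith
    qed
  qed
  have tail: "tail \<in> o(\<lambda>N. 1 / of_nat N ^ (2 * h))"
  proof -
    have "tail \<in> O(\<lambda>N. 1 / of_nat N ^ (2 * h + 1))"
    proof (rule bigoI[of _ "2 * fact d * K ^ 2 * real (d ^ 2) ^ R"])
      show "eventually (\<lambda>N. norm (tail N) \<le> 2 * fact d * K ^ 2 * real (d ^ 2) ^ R
          * norm (1 / of_nat N ^ (2 * h + 1) :: complex)) at_top"
        using ev eventually_ge_at_top[of "2 * d ^ 2 + 1"]
      proof eventually_elim
        case (elim N)
        then have N: "N > 0" "N \<ge> 1" "N \<ge> 2 * d ^ 2" by auto
        have "norm (\<Sum>r. (- 1 / of_nat N) ^ (r + R) * C N (r + R)) \<le> 2 * fact d * K ^ 2
            * real (d ^ 2) ^ R / real N ^ (2 * h + 1)"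
          unfolding C_def
          by (rule tail_bound[OF N(1) assms(2) car[OF N(2)] _ _ N(3) R_def])
             (use elim(1) in \<open>auto simp: \<alpha>_def \<beta>_def\<close>)
        moreover have "norm (tail N) \<le> norm (\<Sum>r. (- 1 / of_nat N) ^ (r + R) * C N (r + R))"
        proof -
          have "(1::real) \<le> real N ^ 2" using N by (intro one_le_power) simp
          then have "norm (\<Sum>r. (- 1 / of_nat N) ^ (r + R) * C N (r + R)) / real N ^ 2 \<le>
             norm (\<Sum>r. (- 1 / of_nat N) ^ (r + R) * C N (r + R)) / 1"
            using N(1) by (intro divide_left_mono) auto
          then show ?thesis by (simp add: tail_def norm_mult norm_divide norm_power)
        qed
        ultimately have "norm (tail N) \<le> 2 * fact d * K ^ 2 * real (d ^ 2) ^ R / real N ^ (2 * h + 1)"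
          by linarith
        then show ?case
          by (simp only: norm_divide norm_power norm_of_nat norm_one times_divide_eq_right mult_1_right)
      qed
    qed
    moreover have "(\<lambda>N. 1 / of_nat N ^ (2 * h + 1) :: complex) \<in> o(\<lambda>N. 1 / of_nat N ^ (2 * h))"
    proof -
      have lim: "(\<lambda>N. 1 / of_nat N :: complex) \<in> o(\<lambda>_. 1)"
        by (intro smalloI_tendsto) (simp_all add: lim_1_over_n)
      from landau_o.big_small_mult[OF landau_o.big_refl[of "\<lambda>N. 1 / of_nat N ^ (2 * h)"] this]
      show ?thesis by (simp add: mult.commute)
    qed
    ultimately show ?thesis by (rule landau_o.big_small_trans)
  qed
  have eq: "eventually (\<lambda>N. (\<Sum>r<R. \<Sum>x\<in>conn_tuples ?S r. f r x N - fl r x N) + tail N =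
     (deriv ^^ d) (F_log (\<kappa> N) N (A N) (B N)) 0 - (\<Sum>g=0..h. C_coeff g d \<phi> \<psi> / of_nat N ^ (2
         * g))) at_top"
    \<comment> \<open>From here on \<open>N\<close> exceeds \<open>card ?S ^ 2\<close>, so the
      connected series represents the derivative and may be split at \<open>R\<close>.\<close>
    using eventually_ge_at_top[of "d ^ 2 + 1"]
  proof eventually_elim
    case (elim N)
    then have N: "N > 0" "N \<ge> 1" "N > card ?S ^ 2" by auto
    interpret haar N "\<kappa> N" by unfold_locales (rule assms(3)[OF N(2)])
    let ?y = "- 1 / of_nat N :: complex"
    have ser: "of_nat N ^ 2 * (deriv ^^ d) (F_log (\<kappa> N) N (A N) (B N)) 0 = (-1) ^ d * (\<Sum>r. ?y ^ r
        * C N r)"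
      using F_log_deriv_series[OF car[OF N(2)], of ?S] N(3) assms(2) by (simp add: C_def)
    have sm: "summable (\<lambda>r. ?y ^ r * C N r)"
    proof -
      have "real (card ?S ^ 2) < real N" using N(3) by (simp only: of_nat_less_iff)
      then have "norm ?y * real (card ?S ^ 2) < 1" using N(1) by (simp add: norm_divide)
      from conn_sum_summable[OF finite_atLeastAtMost this] show ?thesis
        unfolding C_def by (rule summable_norm_cancel)
    qed
    have "(deriv ^^ d) (F_log (\<kappa> N) N (A N) (B N)) 0 = (-1) ^ d * (\<Sum>r. ?y ^ r * C N r) / of_nat N ^ 2"
      using ser N(1) by (simp add: field_simps)
    also have "(\<Sum>r. ?y ^ r * C N r) = (\<Sum>r. ?y ^ (r + R) * C N (r + R)) + (\<Sum>r<R. ?y ^ r * C N r)"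
      by (rule suminf_split_initial_segment[OF sm])
    also have "(-1) ^ d * ((\<Sum>r. ?y ^ (r + R) * C N (r + R)) + (\<Sum>r<R. ?y ^ r * C N r)) / of_nat N ^ 2 =
       tail N + (\<Sum>r<R. (-1) ^ d * (?y ^ r * C N r) / of_nat N ^ 2)"
      unfolding tail_def by (simp only: distrib_left add_divide_distrib sum_distrib_left
          sum_divide_distrib)
    also have "(\<Sum>r<R. (-1) ^ d * (?y ^ r * C N r) / of_nat N ^ 2)
        = (\<Sum>r<R. \<Sum>x\<in>conn_tuples ?S r. f r x N)"
      unfolding C_def f_def \<alpha>_def \<beta>_def
      by (intro sum.cong refl conn_sum_amplitude N(1) assms(2) car[OF N(2)])
    finally have "(deriv ^^ d) (F_log (\<kappa> N) N (A N) (B N)) 0 = tail N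
        + (\<Sum>r<R. \<Sum>x\<in>conn_tuples ?S r. f r x N)" .
    moreover have "(\<Sum>g=0..h. C_coeff g d \<phi> \<psi> / of_nat N ^ (2 * g))
        = (\<Sum>r<R. \<Sum>x\<in>conn_tuples ?S r. fl r x N)"
      unfolding fl_def by (rule main_sum[OF assms(2)]) (simp add: R_def)
    ultimately show ?case by (simp add: sum_subtractf)
  qed
  show ?thesis
    using sum_in_smallo(1)[OF sums tail] by (rule landau_o.small.in_cong[OF eq, THEN iffD1])
qed

end
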